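(* Let $\mathcal{E}$ be a skeletally small, weakly idempotent complete exact category with enough projectives $\mathcal{P}$. Let $\mathcal{T}$ be a $\tau$-rigid subcategory of $\mathcal{E}$ such that every $P\in\mathcal{P}$ has a left $\mathcal{T}$-approximation $P\to T$ which is an admissible morphism. Then $\mathcal{T}$ is a partial tilting subcategory of the exact category $\mathcal{E}_{\mathcal{T}}$. In particular, if $\mathcal{T}$ is a support $\tau$-tilting subcategory of $\mathcal{E}$, then $\mathcal{T}$ is a tilting subcategory of $\mathcal{E}_{\mathcal{T}}$.
   Context: Subcategories are full and closed under isomorphisms. $\mathcal{E}=(\mathcal{A},\mathcal{S})$ is a (Quillen) exact category with class $\mathcal{S}$ of conflations $X\rightarrowtail Y\twoheadrightarrow Z$ (inflation followed by deflation); $\mathcal{P}$ is the subcategory of projective objects. Weakly idempotent complete means that every section has a cokernel. A morphism is admissible if it equals $i\circ d$ with $d$ a deflation and $i$ an inflation. A sequence of composable morphisms is exact if all morphisms are admissible and $\mathrm{Im}=\mathrm{Ker}$ at each intermediate object. A subcategory is additively closed if it is closed under direct summands of finite direct sums. $\mathsf{Fac}\,\mathcal{T}$ is the subcategory of objects $X$ admitting a deflation $T\twoheadrightarrow X$ with $T\in\mathcal{T}$. A left $\mathcal{T}$-approximation of $X$ is a morphism $f:X\to T$, $T\in\mathcal{T}$, through which every morphism from $X$ to an object of $\mathcal{T}$ factors. An additively closed subcategory $\mathcal{T}$ is $\tau$-rigid if $\mathrm{Ext}^1_{\mathcal{E}}(\mathcal{T},\mathsf{Fac}\,\mathcal{T})=0$.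 It is support $\tau$-tilting if moreover for every $P\in\mathcal{P}$ there is an exact sequence $P\xrightarrow{f}T^0\twoheadrightarrow T^1$ with $T^0,T^1\in\mathcal{T}$ and $f$ a left $\mathcal{T}$-approximation. Definition of $\mathcal{E}_{\mathcal{T}}$: let $\mathcal{I}$ be the ideal of $\mathcal{P}$ consisting of the morphisms $f$ in $\mathcal{P}$ with $\mathrm{Hom}_{\mathcal{E}}(f,T)=0$ for all $T\in\mathcal{T}$. Let $\mathcal{A}_{\mathcal{T}}$ be the full subcategory of $X\in\mathcal{E}$ with $\mathrm{Hom}_{\mathcal{E}}(f,X)=0$ for all $f\in\mathcal{I}$ (equivalently, such that the functor $\mathrm{Hom}_{\mathcal{E}}(-,X)|_{\mathcal{P}}$ lies in $\mathrm{mod}_\infty$ over $\mathcal{P}/\mathcal{I}$, i.e. has a resolution by representable functors of $\mathcal{P}/\mathcal{I}$). Let $\mathcal{S}_{\mathcal{T}}$ be the class of conflations in $\mathcal{S}$ all of whose three terms lie in $\mathcal{A}_{\mathcal{T}}$, and put $\mathcal{E}_{\mathcal{T}}=(\mathcal{A}_{\mathcal{T}},\mathcal{S}_{\mathcal{T}})$. It is an exact category with enough projectives. For an exact category $\mathcal{F}$ with enough projectives, an additive subcategory $\mathcal{T}$ is partial tilting if (1) it is closed under direct summands and $\mathrm{Ext}^i_{\mathcal{F}}(\mathcal{T},\mathcal{T})=0$ for all $i\ge1$, and (2) $\mathrm{Ext}^2_{\mathcal{F}}(T,-)=0$ for all $T\in\mathcal{T}$ (that is, $\mathrm{pd}_{\mathcal{F}}T\le1$).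 It is tilting if moreover (3) every projective $P$ of $\mathcal{F}$ admits a conflation $P\rightarrowtail T^0\twoheadrightarrow T^1$ in $\mathcal{F}$ with $T^0,T^1\in\mathcal{T}$. *)

theory Defs
  imports "HOL-Algebra.FiniteProduct"
begin

section \<open>Additive categories\<close>

text \<open>
  A category is given by a set of objects and a set of arrows, so every category below is small;
  skeletal smallness, which only serves to stay within set theory, needs no separate hypothesis.
  \<open>g \<cdot>\<^bsub>C\<^esub> f\<close> is the composite ``first \<open>f\<close>, then \<open>g\<close>''; it is only meaningful for composable
  arrows, as \<open>Plus C f g\<close> is for parallel arrows.
\<close>

record ('o, 'm) precat =
  Obj :: "'o set"
  Arr :: "'m set"
  Dom :: "'m \<Rightarrow> 'o"
  Cod :: "'m \<Rightarrow> 'o"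
  Id :: "'o \<Rightarrow> 'm"
  Comp :: "'m \<Rightarrow> 'm \<Rightarrow> 'm"  (infixr "\<cdot>\<index>" 70)
  Zero :: "'o \<Rightarrow> 'o \<Rightarrow> 'm"
  Plus :: "'m \<Rightarrow> 'm \<Rightarrow> 'm"

definition Hom :: "('o, 'm, 'x) precat_scheme \<Rightarrow> 'o \<Rightarrow> 'o \<Rightarrow> 'm set" where
  "Hom C X Y = {f \<in> Arr C. Dom C f = X \<and> Cod C f = Y}"

text \<open>The abelian group of morphisms, in the multiplicative notation of \<open>comm_group\<close>.\<close>

definition hom_group :: "('o, 'm, 'x) precat_scheme \<Rightarrow> 'o \<Rightarrow> 'o \<Rightarrow> 'm monoid" where
  "hom_group C X Y = \<lparr>carrier = Hom C X Y, monoid.mult = Plus C, one = Zero C X Y\<rparr>"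

locale category =
  fixes C :: "('o, 'm, 'x) precat_scheme" (structure)
  assumes Dom_in: "f \<in> Arr C \<Longrightarrow> Dom C f \<in> Obj C"
    and Cod_in: "f \<in> Arr C \<Longrightarrow> Cod C f \<in> Obj C"
    and Id_in: "X \<in> Obj C \<Longrightarrow> Id C X \<in> Hom C X X"
    and comp_in: "\<lbrakk>f \<in> Hom C X Y; g \<in> Hom C Y Z\<rbrakk> \<Longrightarrow> g \<cdot> f \<in> Hom C X Z"
    and comp_Id: "f \<in> Hom C X Y \<Longrightarrow> f \<cdot> Id C X = f"
    and Id_comp: "f \<in> Hom C X Y \<Longrightarrow> Id C Y \<cdot> f = f"
    and comp_assoc:
      "\<lbrakk>f \<in> Hom C W X; g \<in> Hom C X Y; h \<in> Hom C Y Z\<rbrakk> \<Longrightarrow> (h \<cdot> g) \<cdot> f = h \<cdot> (g \<cdot> f)"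

locale preadditive_category = category +
  assumes hom_comm_group: "\<lbrakk>X \<in> Obj C; Y \<in> Obj C\<rbrakk> \<Longrightarrow> comm_group (hom_group C X Y)"
    and comp_Plus: "\<lbrakk>f \<in> Hom C X Y; g \<in> Hom C X Y; h \<in> Hom C Y Z\<rbrakk>
      \<Longrightarrow> h \<cdot> Plus C f g = Plus C (h \<cdot> f) (h \<cdot> g)"
    and Plus_comp: "\<lbrakk>f \<in> Hom C X Y; g \<in> Hom C Y Z; h \<in> Hom C Y Z\<rbrakk>
      \<Longrightarrow> Plus C g h \<cdot> f = Plus C (g \<cdot> f) (h \<cdot> f)"

text \<open>
  \<open>B\<close> is the direct sum of \<open>X 0, \<dots>, X (n - 1)\<close>: the last clause says that the sum of all
  \<open>\<iota> k \<cdot> \<pi> k\<close> is the identity of \<open>B\<close>. For \<open>n = 0\<close> it says that \<open>B\<close> is a zero object.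
\<close>

definition is_direct_sum ::
    "('o, 'm, 'x) precat_scheme \<Rightarrow> nat \<Rightarrow> (nat \<Rightarrow> 'o) \<Rightarrow> 'o \<Rightarrow> (nat \<Rightarrow> 'm) \<Rightarrow> (nat \<Rightarrow> 'm) \<Rightarrow> bool" where
  "is_direct_sum C n X B \<iota> \<pi> \<longleftrightarrow>
     B \<in> Obj C \<and>
     (\<forall>k<n. X k \<in> Obj C \<and> \<iota> k \<in> Hom C (X k) B \<and> \<pi> k \<in> Hom C B (X k)) \<and>
     (\<forall>k<n. \<forall>l<n. \<pi> k \<cdot>\<^bsub>C\<^esub> \<iota> l = (if k = l then Id C (X k) else Zero C (X l) (X k))) \<and>
     finprod (hom_group C B B) (\<lambda>k. \<iota> k \<cdot>\<^bsub>C\<^esub> \<pi> k) {..<n} = Id C B"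

locale additive_category = preadditive_category +
  assumes direct_sums:
    "(\<And>k. k < n \<Longrightarrow> X k \<in> Obj C) \<Longrightarrow> \<exists>B \<iota> \<pi>. is_direct_sum C n X B \<iota> \<pi>"

definition direct_summand :: "('o, 'm, 'x) precat_scheme \<Rightarrow> 'o \<Rightarrow> 'o \<Rightarrow> bool" where
  "direct_summand C X Y \<longleftrightarrow> (\<exists>X' \<iota> \<pi>. is_direct_sum C 2 (\<lambda>k. if k = 0 then X else X') Y \<iota> \<pi>)"

definition is_iso :: "('o, 'm, 'x) precat_scheme \<Rightarrow> 'm \<Rightarrow> bool" where
  "is_iso C f \<longleftrightarrow> f \<in> Arr C \<and>
     (\<exists>g \<in> Hom C (Cod C f) (Dom C f). g \<cdot>\<^bsub>C\<^esub> f = Id C (Dom C f) \<and> f \<cdot>\<^bsub>C\<^esub> g = Id C (Cod C f))"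

definition is_kernel :: "('o, 'm, 'x) precat_scheme \<Rightarrow> 'm \<Rightarrow> 'm \<Rightarrow> bool" where
  "is_kernel C i g \<longleftrightarrow>
     i \<in> Arr C \<and> g \<in> Arr C \<and> Cod C i = Dom C g \<and>
     g \<cdot>\<^bsub>C\<^esub> i = Zero C (Dom C i) (Cod C g) \<and>
     (\<forall>W \<in> Obj C. \<forall>h \<in> Hom C W (Dom C g). g \<cdot>\<^bsub>C\<^esub> h = Zero C W (Cod C g) \<longrightarrow>
        (\<exists>!u. u \<in> Hom C W (Dom C i) \<and> i \<cdot>\<^bsub>C\<^esub> u = h))"

definition is_cokernel :: "('o, 'm, 'x) precat_scheme \<Rightarrow> 'm \<Rightarrow> 'm \<Rightarrow> bool" where
  "is_cokernel C f d \<longleftrightarrow>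
     f \<in> Arr C \<and> d \<in> Arr C \<and> Cod C f = Dom C d \<and>
     d \<cdot>\<^bsub>C\<^esub> f = Zero C (Dom C f) (Cod C d) \<and>
     (\<forall>W \<in> Obj C. \<forall>h \<in> Hom C (Cod C f) W. h \<cdot>\<^bsub>C\<^esub> f = Zero C (Dom C f) W \<longrightarrow>
        (\<exists>!u. u \<in> Hom C (Cod C d) W \<and> u \<cdot>\<^bsub>C\<^esub> d = h))"

definition weakly_idempotent_complete :: "('o, 'm, 'x) precat_scheme \<Rightarrow> bool" where
  "weakly_idempotent_complete C \<longleftrightarrow>
     (\<forall>X Y. \<forall>s \<in> Hom C X Y. \<forall>r \<in> Hom C Y X. r \<cdot>\<^bsub>C\<^esub> s = Id C X \<longrightarrow> (\<exists>d. is_cokernel C s d))"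

text \<open>The square with sides \<open>f : X \<rightarrow> Y\<close>, \<open>g : X \<rightarrow> Z\<close>, \<open>g' : Y \<rightarrow> V\<close>, \<open>f' : Z \<rightarrow> V\<close>.\<close>

definition is_pushout :: "('o, 'm, 'x) precat_scheme \<Rightarrow> 'm \<Rightarrow> 'm \<Rightarrow> 'm \<Rightarrow> 'm \<Rightarrow> bool" where
  "is_pushout C f g f' g' \<longleftrightarrow>
     {f, g, f', g'} \<subseteq> Arr C \<and>
     Dom C f = Dom C g \<and> Dom C g' = Cod C f \<and> Dom C f' = Cod C g \<and> Cod C f' = Cod C g' \<and>
     g' \<cdot>\<^bsub>C\<^esub> f = f' \<cdot>\<^bsub>C\<^esub> g \<and>
     (\<forall>W \<in> Obj C. \<forall>a \<in> Hom C (Cod C f) W. \<forall>b \<in> Hom C (Cod C g) W. a \<cdot>\<^bsub>C\<^esub> f = b \<cdot>\<^bsub>C\<^esub> g \<longrightarrow>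
        (\<exists>!u. u \<in> Hom C (Cod C f') W \<and> u \<cdot>\<^bsub>C\<^esub> g' = a \<and> u \<cdot>\<^bsub>C\<^esub> f' = b))"

text \<open>The square with sides \<open>f : X \<rightarrow> Z\<close>, \<open>g : Y \<rightarrow> Z\<close>, \<open>g' : V \<rightarrow> X\<close>, \<open>f' : V \<rightarrow> Y\<close>.\<close>

definition is_pullback :: "('o, 'm, 'x) precat_scheme \<Rightarrow> 'm \<Rightarrow> 'm \<Rightarrow> 'm \<Rightarrow> 'm \<Rightarrow> bool" where
  "is_pullback C f g f' g' \<longleftrightarrow>
     {f, g, f', g'} \<subseteq> Arr C \<and>
     Cod C f = Cod C g \<and> Cod C g' = Dom C f \<and> Cod C f' = Dom C g \<and> Dom C f' = Dom C g' \<and>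
     f \<cdot>\<^bsub>C\<^esub> g' = g \<cdot>\<^bsub>C\<^esub> f' \<and>
     (\<forall>W \<in> Obj C. \<forall>a \<in> Hom C W (Dom C f). \<forall>b \<in> Hom C W (Dom C g). f \<cdot>\<^bsub>C\<^esub> a = g \<cdot>\<^bsub>C\<^esub> b \<longrightarrow>
        (\<exists>!u. u \<in> Hom C W (Dom C f') \<and> g' \<cdot>\<^bsub>C\<^esub> u = a \<and> f' \<cdot>\<^bsub>C\<^esub> u = b))"


section \<open>Exact categories\<close>

record ('o, 'm) excat = "('o, 'm) precat" +
  Confl :: "('m \<times> 'm) set"

definition inflation :: "('o, 'm, 'x) excat_scheme \<Rightarrow> 'm \<Rightarrow> bool" where
  "inflation E i \<longleftrightarrow> (\<exists>d. (i, d) \<in> Confl E)"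

definition deflation :: "('o, 'm, 'x) excat_scheme \<Rightarrow> 'm \<Rightarrow> bool" where
  "deflation E d \<longleftrightarrow> (\<exists>i. (i, d) \<in> Confl E)"

text \<open>Quillen's axioms, in the self-dual form given by Buehler.\<close>

locale exact_category = additive_category E
  for E :: "('o, 'm, 'x) excat_scheme" (structure) +
  assumes confl_kernel: "(i, d) \<in> Confl E \<Longrightarrow> is_kernel E i d"
    and confl_cokernel: "(i, d) \<in> Confl E \<Longrightarrow> is_cokernel E i d"
    and confl_iso: "\<lbrakk>(i, d) \<in> Confl E; i' \<in> Arr E; d' \<in> Arr E; Cod E i' = Dom E d';
        is_iso E a; is_iso E b; is_iso E c;
        a \<in> Hom E (Dom E i) (Dom E i'); b \<in> Hom E (Cod E i) (Cod E i');
        c \<in> Hom E (Cod E d) (Cod E d'); b \<cdot> i = i' \<cdot> a; c \<cdot> d = d' \<cdot> b\<rbrakk>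
      \<Longrightarrow> (i', d') \<in> Confl E"
    and Id_inflation: "X \<in> Obj E \<Longrightarrow> inflation E (Id E X)"
    and Id_deflation: "X \<in> Obj E \<Longrightarrow> deflation E (Id E X)"
    and inflation_comp: "\<lbrakk>inflation E i; inflation E j; Cod E i = Dom E j\<rbrakk> \<Longrightarrow> inflation E (j \<cdot> i)"
    and deflation_comp: "\<lbrakk>deflation E d; deflation E e; Cod E d = Dom E e\<rbrakk> \<Longrightarrow> deflation E (e \<cdot> d)"
    and inflation_pushout: "\<lbrakk>inflation E i; f \<in> Arr E; Dom E f = Dom E i\<rbrakk>
      \<Longrightarrow> \<exists>i' f'. is_pushout E i f i' f' \<and> inflation E i'"
    and deflation_pullback: "\<lbrakk>deflation E d; f \<in> Arr E; Cod E f = Cod E d\<rbrakk>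
      \<Longrightarrow> \<exists>d' f'. is_pullback E d f d' f' \<and> deflation E d'"

definition admissible :: "('o, 'm, 'x) excat_scheme \<Rightarrow> 'm \<Rightarrow> bool" where
  "admissible E f \<longleftrightarrow>
     (\<exists>i d. deflation E d \<and> inflation E i \<and> Cod E d = Dom E i \<and> f = i \<cdot>\<^bsub>E\<^esub> d)"

text \<open>
  For an admissible \<open>f = i \<cdot> d\<close> the subobject \<open>i\<close> is the image of \<open>f\<close>, so the last clause says that
  image and kernel agree.
\<close>

definition exact_at :: "('o, 'm, 'x) excat_scheme \<Rightarrow> 'm \<Rightarrow> 'm \<Rightarrow> bool" where
  "exact_at E f g \<longleftrightarrow>
     (\<exists>i d. deflation E d \<and> inflation E i \<and> Cod E d = Dom E i \<and> f = i \<cdot>\<^bsub>E\<^esub> d \<and> is_kernel E i g)"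

text \<open>A list \<open>[f\<^sub>1, \<dots>, f\<^sub>n]\<close> stands for the sequence applying \<open>f\<^sub>1\<close> first.\<close>

definition exact_seq :: "('o, 'm, 'x) excat_scheme \<Rightarrow> 'm list \<Rightarrow> bool" where
  "exact_seq E fs \<longleftrightarrow>
     (\<forall>f \<in> set fs. admissible E f) \<and>
     (\<forall>k. Suc k < length fs \<longrightarrow>
        Cod E (fs ! k) = Dom E (fs ! Suc k) \<and> exact_at E (fs ! k) (fs ! Suc k))"

definition projectives :: "('o, 'm, 'x) excat_scheme \<Rightarrow> 'o set" where
  "projectives E = {P \<in> Obj E. \<forall>d. deflation E d \<longrightarrow>
     (\<forall>f \<in> Hom E P (Cod E d). \<exists>g \<in> Hom E P (Dom E d). d \<cdot>\<^bsub>E\<^esub> g = f)}"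

definition enough_projectives :: "('o, 'm, 'x) excat_scheme \<Rightarrow> bool" where
  "enough_projectives E \<longleftrightarrow>
     (\<forall>X \<in> Obj E. \<exists>P \<in> projectives E. \<exists>d \<in> Hom E P X. deflation E d)"


section \<open>Yoneda Ext\<close>

text \<open>
  An \<open>n\<close>-extension \<open>Y \<rightarrowtail> E\<^sub>n \<rightarrow> \<dots> \<rightarrow> E\<^sub>1 \<rightarrow> X\<close> (for \<open>n \<ge> 1\<close>) is the list of its \<open>n + 1\<close> arrows.
  Two of them are Yoneda equivalent if they are linked by a zigzag of morphisms of extensions that
  are the identity on \<open>X\<close> and \<open>Y\<close>.
\<close>

definition extensions :: "('o, 'm, 'x) excat_scheme \<Rightarrow> nat \<Rightarrow> 'o \<Rightarrow> 'o \<Rightarrow> 'm list set" where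
  "extensions E n X Y =
     {fs. length fs = Suc n \<and> exact_seq E fs \<and>
        inflation E (hd fs) \<and> Dom E (hd fs) = Y \<and> deflation E (last fs) \<and> Cod E (last fs) = X}"

text \<open>\<open>a k\<close> is the component between the \<open>k\<close>-th objects, where \<open>a 0\<close> sits at \<open>Y\<close> and
  \<open>a (n + 1)\<close> at \<open>X\<close>.\<close>

definition extension_morphism ::
    "('o, 'm, 'x) excat_scheme \<Rightarrow> nat \<Rightarrow> 'o \<Rightarrow> 'o \<Rightarrow> 'm list \<Rightarrow> 'm list \<Rightarrow> bool" where
  "extension_morphism E n X Y fs gs \<longleftrightarrow>
     fs \<in> extensions E n X Y \<and> gs \<in> extensions E n X Y \<and>
     (\<exists>a. a 0 = Id E Y \<and> a (Suc n) = Id E X \<and>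
        (\<forall>k\<le>n. a k \<in> Hom E (Dom E (fs ! k)) (Dom E (gs ! k))) \<and>
        (\<forall>k\<le>n. (gs ! k) \<cdot>\<^bsub>E\<^esub> a k = a (Suc k) \<cdot>\<^bsub>E\<^esub> (fs ! k)))"

definition Ext :: "('o, 'm, 'x) excat_scheme \<Rightarrow> nat \<Rightarrow> 'o \<Rightarrow> 'o \<Rightarrow> 'm list set set" where
  "Ext E n X Y = extensions E n X Y //
     {(\<xi>, \<eta>). \<xi> \<in> extensions E n X Y \<and> \<eta> \<in> extensions E n X Y \<and>
        equivclp (extension_morphism E n X Y) \<xi> \<eta>}"

text \<open>Used for \<open>n \<ge> 1\<close> only. As \<open>Ext\<close> is a group under Baer sum, it is zero iff it has just one
  element.\<close>

definition Ext_zero :: "('o, 'm, 'x) excat_scheme \<Rightarrow> nat \<Rightarrow> 'o \<Rightarrow> 'o \<Rightarrow> bool" where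
  "Ext_zero E n X Y \<longleftrightarrow> is_singleton (Ext E n X Y)"


section \<open>Subcategories\<close>

text \<open>Full subcategories closed under isomorphisms are represented by their sets of objects.\<close>

definition subcategory :: "('o, 'm, 'x) precat_scheme \<Rightarrow> 'o set \<Rightarrow> bool" where
  "subcategory C T \<longleftrightarrow>
     T \<subseteq> Obj C \<and> (\<forall>f. is_iso C f \<and> Dom C f \<in> T \<longrightarrow> Cod C f \<in> T)"

definition additive_subcategory :: "('o, 'm, 'x) precat_scheme \<Rightarrow> 'o set \<Rightarrow> bool" where
  "additive_subcategory C T \<longleftrightarrow> subcategory C T \<and>
     (\<forall>n X B \<iota> \<pi>. (\<forall>k<n. X k \<in> T) \<and> is_direct_sum C n X B \<iota> \<pi> \<longrightarrow> B \<in> T)"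

definition closed_under_summands :: "('o, 'm, 'x) precat_scheme \<Rightarrow> 'o set \<Rightarrow> bool" where
  "closed_under_summands C T \<longleftrightarrow> (\<forall>X Y. Y \<in> T \<and> direct_summand C X Y \<longrightarrow> X \<in> T)"

definition additively_closed :: "('o, 'm, 'x) precat_scheme \<Rightarrow> 'o set \<Rightarrow> bool" where
  "additively_closed C T \<longleftrightarrow> subcategory C T \<and>
     (\<forall>n X B \<iota> \<pi> Y. (\<forall>k<n. X k \<in> T) \<and> is_direct_sum C n X B \<iota> \<pi> \<and> direct_summand C Y B \<longrightarrow> Y \<in> T)"

definition Fac :: "('o, 'm, 'x) excat_scheme \<Rightarrow> 'o set \<Rightarrow> 'o set" where
  "Fac E T = {X. \<exists>U \<in> T. \<exists>d \<in> Hom E U X. deflation E d}"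

definition left_approximation :: "('o, 'm, 'x) precat_scheme \<Rightarrow> 'o set \<Rightarrow> 'o \<Rightarrow> 'm \<Rightarrow> bool" where
  "left_approximation C T X f \<longleftrightarrow>
     (\<exists>U \<in> T. f \<in> Hom C X U \<and>
        (\<forall>V \<in> T. \<forall>g \<in> Hom C X V. \<exists>h \<in> Hom C U V. g = h \<cdot>\<^bsub>C\<^esub> f))"


section \<open>\<open>\<tau>\<close>-tilting and tilting subcategories\<close>

definition tau_rigid :: "('o, 'm, 'x) excat_scheme \<Rightarrow> 'o set \<Rightarrow> bool" where
  "tau_rigid E T \<longleftrightarrow> additively_closed E T \<and> (\<forall>U \<in> T. \<forall>X \<in> Fac E T. Ext_zero E 1 U X)"

definition support_tau_tilting :: "('o, 'm, 'x) excat_scheme \<Rightarrow> 'o set \<Rightarrow> bool" where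
  "support_tau_tilting E T \<longleftrightarrow> tau_rigid E T \<and>
     (\<forall>P \<in> projectives E. \<exists>T0 \<in> T. \<exists>T1 \<in> T. \<exists>f \<in> Hom E P T0. \<exists>g \<in> Hom E T0 T1.
        exact_seq E [f, g] \<and> deflation E g \<and> left_approximation E T P f)"

definition annihilator_ideal :: "('o, 'm, 'x) excat_scheme \<Rightarrow> 'o set \<Rightarrow> 'm set" where
  "annihilator_ideal E T =
     {f \<in> Arr E. Dom E f \<in> projectives E \<and> Cod E f \<in> projectives E \<and>
        (\<forall>U \<in> T. \<forall>h \<in> Hom E (Cod E f) U. h \<cdot>\<^bsub>E\<^esub> f = Zero E (Dom E f) U)}"

definition A_sub :: "('o, 'm, 'x) excat_scheme \<Rightarrow> 'o set \<Rightarrow> 'o set" where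
  "A_sub E T =
     {X \<in> Obj E. \<forall>f \<in> annihilator_ideal E T. \<forall>h \<in> Hom E (Cod E f) X.
        h \<cdot>\<^bsub>E\<^esub> f = Zero E (Dom E f) X}"

definition E_sub :: "('o, 'm, 'x) excat_scheme \<Rightarrow> 'o set \<Rightarrow> ('o, 'm, 'x) excat_scheme" where
  "E_sub E T = E\<lparr>
     Obj := A_sub E T,
     Arr := {f \<in> Arr E. Dom E f \<in> A_sub E T \<and> Cod E f \<in> A_sub E T},
     Confl := {(i, d) \<in> Confl E. Dom E i \<in> A_sub E T \<and> Cod E i \<in> A_sub E T \<and> Cod E d \<in> A_sub E T}\<rparr>"

text \<open>Being an exact category with enough projectives is part of the notion, so that asserting
  \<open>partial_tilting (E_sub E T) T\<close> includes that \<open>E_sub E T\<close> is one.\<close>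

definition partial_tilting :: "('o, 'm, 'x) excat_scheme \<Rightarrow> 'o set \<Rightarrow> bool" where
  "partial_tilting F T \<longleftrightarrow>
     exact_category F \<and> enough_projectives F \<and>
     additive_subcategory F T \<and> closed_under_summands F T \<and>
     (\<forall>i\<ge>1. \<forall>U \<in> T. \<forall>V \<in> T. Ext_zero F i U V) \<and>
     (\<forall>U \<in> T. \<forall>Y \<in> Obj F. Ext_zero F 2 U Y)"

definition tilting :: "('o, 'm, 'x) excat_scheme \<Rightarrow> 'o set \<Rightarrow> bool" where
  "tilting F T \<longleftrightarrow> partial_tilting F T \<and>
     (\<forall>P \<in> projectives F. \<exists>(i, d) \<in> Confl F. Dom F i = P \<and> Cod F i \<in> T \<and> Cod F d \<in> T)"

end

theory Submission
  imports Defs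
begin

text \<open>
  For \<open>P\<close> projective in \<open>E\<close> let \<open>P \<rightarrow> J \<rightarrow> U\<close> be the factorisation of an admissible left
  \<open>T\<close>-approximation. Every morphism from \<open>P\<close> to an object of \<open>E_sub E T\<close> factors through \<open>J\<close>, so the
  objects \<open>J\<close> are enough projectives of \<open>E_sub E T\<close>. Pushing out \<open>J \<rightarrow> U\<close> along a deflation \<open>J \<rightarrow> B\<close>
  embeds each object \<open>B\<close> of \<open>E_sub E T\<close> into one of \<open>Fac E T\<close>. As \<open>Ext\<^sup>1(T, Fac T) = 0\<close> and
  \<open>Fac T\<close> is closed under quotients, extensions of an object of \<open>T\<close> lift along deflations, and this
  kills \<open>Ext\<^sup>n(T, -)\<close> for all \<open>n \<ge> 2\<close>. For the tilting sequence of a projective \<open>P'\<close>, write \<open>P'\<close>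
  as a retract of such a \<open>J\<close>; by the approximation property the cokernel of
  \<open>P' \<rightarrow> J \<rightarrow> T0\<close> is then a retract of \<open>T0 \<oplus> T1\<close>.
\<close>

section \<open>Preadditive categories, kernels and cokernels\<close>

text \<open>A conflation of \<open>E_sub E T\<close> is one of \<open>E\<close>, so the splitting
  given by rigidity is inherited. Longer extensions of the two categories are not compared; their
  vanishing is proved inside \<open>E_sub E T\<close>, directly from the zigzag definition and
  without long exact sequences. An extension of length \<open>n \<ge> 2\<close> ends in the splice
  of \<open>Ker g -> B -> Im g\<close> and \<open>Im g -> M -> U\<close>. By the classical criterion
  such a splice is zero once some conflation \<open>B -> W -> U\<close> maps to
  \<open>Im g -> M -> U\<close> by \<open>B -> Im g\<close> and the identity of \<open>U\<close>,
  that is, once the class of \<open>M\<close> lifts from \<open>Ext^1(U, B)\<close>. With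
  \<open>B\<close> embedded in \<open>V\<close>, the obstruction is to extending an arrow from
  \<open>Im g\<close> to a quotient of \<open>V\<close>, and it lies in \<open>Ext^1\<close> of
  \<open>U\<close> with values in that quotient; this is where rigidity against all of
  \<open>Fac E T\<close> enters. Weak idempotent completeness has two effects: a deflation
  \<open>P -> J\<close> can be cancelled from a deflation \<open>P -> J -> X\<close>, which makes
  \<open>J -> X\<close> a deflation, and retracts become direct summands, so that they stay in
  \<open>T\<close>.\<close>

context category
begin

lemma Hom_Obj: "f \<in> Hom C X Y \<Longrightarrow> X \<in> Obj C \<and> Y \<in> Obj C"
  using Dom_in Cod_in by (auto simp: Hom_def)

text \<open>Membership in \<open>Hom\<close> leaves the middle object of a composite free; with
  \<open>Arr\<close>, \<open>Dom\<close> and \<open>Cod\<close> the typing conditions can be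
  discharged by rewriting.\<close>

lemma Arr_comp: "\<lbrakk>f \<in> Arr C; g \<in> Arr C; Cod C f = Dom C g\<rbrakk> \<Longrightarrow> g \<cdot> f \<in> Arr C"
  and Dom_comp: "\<lbrakk>f \<in> Arr C; g \<in> Arr C; Cod C f = Dom C g\<rbrakk> \<Longrightarrow> Dom C (g \<cdot> f) = Dom C f"
  and Cod_comp: "\<lbrakk>f \<in> Arr C; g \<in> Arr C; Cod C f = Dom C g\<rbrakk> \<Longrightarrow> Cod C (g \<cdot> f) = Cod C g"
  using comp_in[of f "Dom C f" "Cod C f" g "Cod C g"] by (auto simp: Hom_def)

lemma Arr_assoc:
  "\<lbrakk>f \<in> Arr C; g \<in> Arr C; h \<in> Arr C; Cod C f = Dom C g; Cod C g = Dom C h\<rbrakk>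
    \<Longrightarrow> (h \<cdot> g) \<cdot> f = h \<cdot> (g \<cdot> f)"
  by (rule comp_assoc) (auto simp: Hom_def)

lemma Arr_comp_Id: "f \<in> Arr C \<Longrightarrow> Dom C f = X \<Longrightarrow> f \<cdot> Id C X = f"
  using comp_Id[of f X "Cod C f"] by (auto simp: Hom_def)

lemma Arr_Id_comp: "f \<in> Arr C \<Longrightarrow> Cod C f = Y \<Longrightarrow> Id C Y \<cdot> f = f"
  using Id_comp[of f "Dom C f" Y] by (auto simp: Hom_def)

lemma Arr_Id: "X \<in> Obj C \<Longrightarrow> Id C X \<in> Arr C"
  and Dom_Id: "X \<in> Obj C \<Longrightarrow> Dom C (Id C X) = X"
  and Cod_Id: "X \<in> Obj C \<Longrightarrow> Cod C (Id C X) = X"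
  using Id_in[of X] by (auto simp: Hom_def)

text \<open>\<open>comp_assoc\<close> moves brackets to the right, which hides a known composite
  \<open>g \<cdot> f\<close> whenever something precedes \<open>f\<close>; this is the form that
  still rewrites it.\<close>

lemma comp_eq_assoc:
  "\<lbrakk>g \<cdot> f = k; f \<in> Hom C X Y; g \<in> Hom C Y Z; u \<in> Arr C; Cod C u = X\<rbrakk> \<Longrightarrow> g \<cdot> (f \<cdot> u) = k \<cdot> u"
  using Arr_assoc[of u f g] by (auto simp: Hom_def)

lemmas arr_simps = Arr_comp Dom_comp Cod_comp Arr_assoc Arr_comp_Id Arr_Id_comp Arr_Id Dom_Id Cod_Id
  Dom_in Cod_in

end

context preadditive_category
begin

lemma hom_group_simps:
  "carrier (hom_group C X Y) = Hom C X Y"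
  "x \<otimes>\<^bsub>hom_group C X Y\<^esub> y = Plus C x y"
  "\<one>\<^bsub>hom_group C X Y\<^esub> = Zero C X Y"
  by (auto simp: hom_group_def)

lemma Zero_in: "X \<in> Obj C \<Longrightarrow> Y \<in> Obj C \<Longrightarrow> Zero C X Y \<in> Hom C X Y"
  using comm_group.axioms(1)[OF hom_comm_group[of X Y]] monoid.one_closed[of "hom_group C X Y"]
  by (auto simp: hom_group_simps comm_monoid_def)

lemma Plus_in:
  assumes "f \<in> Hom C X Y" "g \<in> Hom C X Y"
  shows "Plus C f g \<in> Hom C X Y"
proof -
  interpret comm_group "hom_group C X Y" using hom_comm_group Hom_Obj[OF assms(1)] by blast
  show ?thesis using m_closed[of f g] assms by (auto simp: hom_group_simps)
qed

lemma Plus_commute: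
  assumes "f \<in> Hom C X Y" "g \<in> Hom C X Y"
  shows "Plus C f g = Plus C g f"
proof -
  interpret comm_group "hom_group C X Y" using hom_comm_group Hom_Obj[OF assms(1)] by blast
  show ?thesis using m_comm[of f g] assms by (auto simp: hom_group_simps)
qed

lemma Plus_Zero:
  assumes "f \<in> Hom C X Y"
  shows "Plus C f (Zero C X Y) = f"
proof -
  interpret comm_group "hom_group C X Y" using hom_comm_group Hom_Obj[OF assms(1)] by blast
  show ?thesis using r_one[of f] assms by (auto simp: hom_group_simps)
qed

lemma Zero_Plus: "f \<in> Hom C X Y \<Longrightarrow> Plus C (Zero C X Y) f = f"
  using Plus_commute Plus_Zero Zero_in Hom_Obj by metis

lemma Plus_cancel_Zero:
  assumes "f \<in> Hom C X Y" "g \<in> Hom C X Y" "Plus C f g = f"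
  shows "g = Zero C X Y"
proof -
  interpret comm_group "hom_group C X Y" using hom_comm_group Hom_Obj[OF assms(1)] by blast
  show ?thesis using r_cancel_one[of f g] assms Plus_commute[of f X Y g]
    by (auto simp: hom_group_simps)
qed

text \<open>Stands in for the difference \<open>h = f - g\<close>.\<close>

lemma diff_exists:
  assumes "f \<in> Hom C X Y" "g \<in> Hom C X Y"
  shows "\<exists>h \<in> Hom C X Y. f = Plus C g h"
proof -
  interpret comm_group "hom_group C X Y" using hom_comm_group Hom_Obj[OF assms(1)] by blast
  define h where "h = inv\<^bsub>hom_group C X Y\<^esub> g \<otimes>\<^bsub>hom_group C X Y\<^esub> f"
  have fg: "f \<in> carrier (hom_group C X Y)" "g \<in> carrier (hom_group C X Y)"
    using assms by (auto simp: hom_group_simps)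
  then have "h \<in> carrier (hom_group C X Y)" "f = g \<otimes>\<^bsub>hom_group C X Y\<^esub> h"
    unfolding h_def by (auto simp: m_assoc[symmetric])
  then show ?thesis by (auto simp: hom_group_simps)
qed

lemma comp_Zero:
  assumes "g \<in> Hom C Y Z" "X \<in> Obj C"
  shows "g \<cdot> Zero C X Y = Zero C X Z"
proof (rule Plus_cancel_Zero)
  have *: "Zero C X Y \<in> Hom C X Y" using assms Zero_in Hom_Obj by blast
  then show "g \<cdot> Zero C X Y \<in> Hom C X Z" "g \<cdot> Zero C X Y \<in> Hom C X Z" using assms comp_in by blast+
  show "Plus C (g \<cdot> Zero C X Y) (g \<cdot> Zero C X Y) = g \<cdot> Zero C X Y"
    using comp_Plus[OF * * assms(1)] Plus_Zero[OF *] by simp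
qed

lemma Zero_comp:
  assumes "f \<in> Hom C X Y" "Z \<in> Obj C"
  shows "Zero C Y Z \<cdot> f = Zero C X Z"
proof (rule Plus_cancel_Zero)
  have *: "Zero C Y Z \<in> Hom C Y Z" using assms Zero_in Hom_Obj by blast
  then show "Zero C Y Z \<cdot> f \<in> Hom C X Z" "Zero C Y Z \<cdot> f \<in> Hom C X Z" using assms comp_in by blast+
  show "Plus C (Zero C Y Z \<cdot> f) (Zero C Y Z \<cdot> f) = Zero C Y Z \<cdot> f"
    using Plus_comp[OF assms(1) * *] Plus_Zero[OF *] by simp
qed

lemma Arr_Zero: "X \<in> Obj C \<Longrightarrow> Y \<in> Obj C \<Longrightarrow> Zero C X Y \<in> Arr C"
  and Dom_Zero: "X \<in> Obj C \<Longrightarrow> Y \<in> Obj C \<Longrightarrow> Dom C (Zero C X Y) = X"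
  and Cod_Zero: "X \<in> Obj C \<Longrightarrow> Y \<in> Obj C \<Longrightarrow> Cod C (Zero C X Y) = Y"
  using Zero_in[of X Y] by (auto simp: Hom_def)

lemma Arr_comp_Zero: "\<lbrakk>g \<in> Arr C; Dom C g = Y; X \<in> Obj C\<rbrakk> \<Longrightarrow> g \<cdot> Zero C X Y = Zero C X (Cod C g)"
  using comp_Zero[of g Y "Cod C g" X] by (auto simp: Hom_def)

lemma Arr_Zero_comp: "\<lbrakk>f \<in> Arr C; Cod C f = Y; Z \<in> Obj C\<rbrakk> \<Longrightarrow> Zero C Y Z \<cdot> f = Zero C (Dom C f) Z"
  using Zero_comp[of f "Dom C f" Y Z] by (auto simp: Hom_def)

lemma Arr_Plus: "\<lbrakk>f \<in> Arr C; g \<in> Arr C; Dom C g = Dom C f; Cod C g = Cod C f\<rbrakk> \<Longrightarrow> Plus C f g \<in> Arr C"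
  and Dom_Plus: "\<lbrakk>f \<in> Arr C; g \<in> Arr C; Dom C g = Dom C f; Cod C g = Cod C f\<rbrakk> \<Longrightarrow> Dom C (Plus C f g) = Dom C f"
  and Cod_Plus: "\<lbrakk>f \<in> Arr C; g \<in> Arr C; Dom C g = Dom C f; Cod C g = Cod C f\<rbrakk> \<Longrightarrow> Cod C (Plus C f g) = Cod C f"
  using Plus_in[of f "Dom C f" "Cod C f" g] by (auto simp: Hom_def)

lemma Arr_comp_Plus: "\<lbrakk>f \<in> Arr C; g \<in> Arr C; Dom C g = Dom C f; Cod C g = Cod C f; h \<in> Arr C; Dom C h = Cod C f\<rbrakk>
    \<Longrightarrow> h \<cdot> Plus C f g = Plus C (h \<cdot> f) (h \<cdot> g)"
  using comp_Plus[of f "Dom C f" "Cod C f" g h "Cod C h"] by (auto simp: Hom_def)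

lemma Arr_Plus_comp: "\<lbrakk>g \<in> Arr C; h \<in> Arr C; Dom C h = Dom C g; Cod C h = Cod C g; f \<in> Arr C; Cod C f = Dom C g\<rbrakk>
    \<Longrightarrow> Plus C g h \<cdot> f = Plus C (g \<cdot> f) (h \<cdot> f)"
  using Plus_comp[of f "Dom C f" "Cod C f" g "Cod C g" h] by (auto simp: Hom_def)

lemma Arr_Plus_Zero: "\<lbrakk>f \<in> Arr C; Dom C f = X; Cod C f = Y\<rbrakk> \<Longrightarrow> Plus C f (Zero C X Y) = f"
  and Arr_Zero_Plus: "\<lbrakk>f \<in> Arr C; Dom C f = X; Cod C f = Y\<rbrakk> \<Longrightarrow> Plus C (Zero C X Y) f = f"
  using Plus_Zero Zero_Plus by (auto simp: Hom_def)

lemmas add_simps = arr_simps Arr_Zero Dom_Zero Cod_Zero Arr_comp_Zero Arr_Zero_comp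
  Arr_Plus Dom_Plus Cod_Plus Arr_comp_Plus Arr_Plus_comp Arr_Plus_Zero Arr_Zero_Plus Hom_def

lemma
  assumes "is_kernel C i g" "i \<in> Hom C X Y" "g \<in> Hom C Y Z"
  shows kernel_zero: "g \<cdot> i = Zero C X Z"
    and kernel_lift: "\<lbrakk>h \<in> Hom C W Y; g \<cdot> h = Zero C W Z\<rbrakk> \<Longrightarrow> \<exists>u \<in> Hom C W X. i \<cdot> u = h"
proof -
  show "g \<cdot> i = Zero C X Z" using assms unfolding is_kernel_def by (auto simp: Hom_def)
  assume h: "h \<in> Hom C W Y" "g \<cdot> h = Zero C W Z"
  then have "\<exists>!u. u \<in> Hom C W X \<and> i \<cdot> u = h"
    using assms Hom_Obj[OF h(1)] unfolding is_kernel_def Hom_def by simp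
  then show "\<exists>u \<in> Hom C W X. i \<cdot> u = h" by blast
qed

lemma kernel_mono:
  assumes "is_kernel C i g" "i \<in> Hom C X Y" "u \<in> Hom C W X" "v \<in> Hom C W X" "i \<cdot> u = i \<cdot> v"
  shows "u = v"
proof -
  let ?Z = "Cod C g"
  have g: "g \<in> Hom C Y ?Z" using assms unfolding is_kernel_def by (auto simp: Hom_def)
  have W: "W \<in> Obj C" using assms Hom_Obj by blast
  have "g \<cdot> (i \<cdot> u) = Zero C W ?Z"
    using comp_assoc[OF assms(3,2) g] kernel_zero[OF assms(1,2) g] Zero_comp[OF assms(3)] Hom_Obj[OF g]
    by simp
  then have "\<exists>!w. w \<in> Hom C W X \<and> i \<cdot> w = i \<cdot> u"
    using assms comp_in[OF assms(3,2)] W unfolding is_kernel_def by (auto simp: Hom_def)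
  then show ?thesis using assms by metis
qed

text \<open>Hom groups reduce uniqueness of lifts to \<open>mono\<close>: the difference of two
  lifts is killed by \<open>i\<close>.\<close>

lemma kernelI:
  assumes "i \<in> Hom C X Y" "g \<in> Hom C Y Z" "g \<cdot> i = Zero C X Z"
    and lift: "\<And>W h. h \<in> Hom C W Y \<Longrightarrow> g \<cdot> h = Zero C W Z \<Longrightarrow> \<exists>u \<in> Hom C W X. i \<cdot> u = h"
    and mono: "\<And>W u. u \<in> Hom C W X \<Longrightarrow> i \<cdot> u = Zero C W Y \<Longrightarrow> u = Zero C W X"
  shows "is_kernel C i g"
proof -
  have uniq: "u = v" if uv: "u \<in> Hom C W X" "v \<in> Hom C W X" "i \<cdot> u = i \<cdot> v" for W u v
  proof -
    obtain h where h: "h \<in> Hom C W X" "u = Plus C v h" using diff_exists[OF uv(1,2)] by blast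
    have "Plus C (i \<cdot> v) (i \<cdot> h) = i \<cdot> v" using comp_Plus uv h assms(1) by metis
    then have "i \<cdot> h = Zero C W Y" using Plus_cancel_Zero comp_in uv h assms(1) by metis
    then show ?thesis using mono h Plus_Zero uv by metis
  qed
  show ?thesis unfolding is_kernel_def
    using assms(1-3) lift uniq by (auto simp: Hom_def)
qed

lemma
  assumes "is_cokernel C f d" "f \<in> Hom C X Y" "d \<in> Hom C Y Z"
  shows cokernel_zero: "d \<cdot> f = Zero C X Z"
    and cokernel_lift: "\<lbrakk>h \<in> Hom C Y W; h \<cdot> f = Zero C X W\<rbrakk> \<Longrightarrow> \<exists>u \<in> Hom C Z W. u \<cdot> d = h"
proof -
  show "d \<cdot> f = Zero C X Z" using assms unfolding is_cokernel_def by (auto simp: Hom_def)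
  assume h: "h \<in> Hom C Y W" "h \<cdot> f = Zero C X W"
  then have "\<exists>!u. u \<in> Hom C Z W \<and> u \<cdot> d = h"
    using assms Hom_Obj[OF h(1)] unfolding is_cokernel_def Hom_def by simp
  then show "\<exists>u \<in> Hom C Z W. u \<cdot> d = h" by blast
qed

lemma cokernel_epi:
  assumes "is_cokernel C f d" "d \<in> Hom C Y Z" "u \<in> Hom C Z W" "v \<in> Hom C Z W" "u \<cdot> d = v \<cdot> d"
  shows "u = v"
proof -
  let ?X = "Dom C f"
  have f: "f \<in> Hom C ?X Y" using assms unfolding is_cokernel_def by (auto simp: Hom_def)
  have W: "W \<in> Obj C" using assms Hom_Obj by blast
  have "(u \<cdot> d) \<cdot> f = Zero C ?X W"
    using comp_assoc[OF f assms(2,3)] cokernel_zero[OF assms(1) f assms(2)] comp_Zero[OF assms(3)] Hom_Obj[OF f]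
    by simp
  then have "\<exists>!w. w \<in> Hom C Z W \<and> w \<cdot> d = u \<cdot> d"
    using assms comp_in[OF assms(2,3)] W unfolding is_cokernel_def by (auto simp: Hom_def)
  then show ?thesis using assms by metis
qed

lemma cokernelI:
  assumes "f \<in> Hom C X Y" "d \<in> Hom C Y Z" "d \<cdot> f = Zero C X Z"
    and lift: "\<And>W h. h \<in> Hom C Y W \<Longrightarrow> h \<cdot> f = Zero C X W \<Longrightarrow> \<exists>u \<in> Hom C Z W. u \<cdot> d = h"
    and epi: "\<And>W u. u \<in> Hom C Z W \<Longrightarrow> u \<cdot> d = Zero C Y W \<Longrightarrow> u = Zero C Z W"
  shows "is_cokernel C f d"
proof -
  have uniq: "u = v" if uv: "u \<in> Hom C Z W" "v \<in> Hom C Z W" "u \<cdot> d = v \<cdot> d" for W u v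
  proof -
    obtain h where h: "h \<in> Hom C Z W" "u = Plus C v h" using diff_exists[OF uv(1,2)] by blast
    have "Plus C (v \<cdot> d) (h \<cdot> d) = v \<cdot> d" using Plus_comp uv h assms(2) by metis
    then have "h \<cdot> d = Zero C Y W" using Plus_cancel_Zero comp_in uv h assms(2) by metis
    then show ?thesis using epi h Plus_Zero uv by metis
  qed
  show ?thesis unfolding is_cokernel_def
    using assms(1-3) lift uniq by (auto simp: Hom_def)
qed

lemma kernel_unique:
  assumes "is_kernel C i g" "is_kernel C j g" "i \<in> Hom C X Y" "j \<in> Hom C X' Y"
  shows "\<exists>a \<in> Hom C X' X. is_iso C a \<and> i \<cdot> a = j"
proof -
  let ?Z = "Cod C g"
  have g: "g \<in> Hom C Y ?Z" using assms unfolding is_kernel_def by (auto simp: Hom_def)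
  obtain a where a: "a \<in> Hom C X' X" "i \<cdot> a = j"
    using kernel_lift[OF assms(1,3) g assms(4)] kernel_zero[OF assms(2,4) g] by blast
  obtain b where b: "b \<in> Hom C X X'" "j \<cdot> b = i"
    using kernel_lift[OF assms(2,4) g assms(3)] kernel_zero[OF assms(1,3) g] by blast
  have "i \<cdot> (a \<cdot> b) = i \<cdot> Id C X" using a b assms comp_assoc comp_Id by metis
  then have 1: "a \<cdot> b = Id C X"
    using kernel_mono[OF assms(1,3)] comp_in a b Id_in Hom_Obj by metis
  have "j \<cdot> (b \<cdot> a) = j \<cdot> Id C X'" using a b assms comp_assoc comp_Id by metis
  then have 2: "b \<cdot> a = Id C X'"
    using kernel_mono[OF assms(2,4)] comp_in a b Id_in Hom_Obj by metis
  show ?thesis using a b 1 2 unfolding is_iso_def by (auto simp: Hom_def)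
qed

lemma cokernel_unique:
  assumes "is_cokernel C f d" "is_cokernel C f e" "d \<in> Hom C Y Z" "e \<in> Hom C Y Z'"
  shows "\<exists>a \<in> Hom C Z Z'. is_iso C a \<and> a \<cdot> d = e"
proof -
  let ?X = "Dom C f"
  have f: "f \<in> Hom C ?X Y" using assms unfolding is_cokernel_def by (auto simp: Hom_def)
  obtain a where a: "a \<in> Hom C Z Z'" "a \<cdot> d = e"
    using cokernel_lift[OF assms(1) f assms(3,4)] cokernel_zero[OF assms(2) f assms(4)] by blast
  obtain b where b: "b \<in> Hom C Z' Z" "b \<cdot> e = d"
    using cokernel_lift[OF assms(2) f assms(4,3)] cokernel_zero[OF assms(1) f assms(3)] by blast
  have "(b \<cdot> a) \<cdot> d = Id C Z \<cdot> d" using a b assms comp_assoc Id_comp by metis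
  then have 1: "b \<cdot> a = Id C Z"
    using cokernel_epi[OF assms(1,3)] comp_in a b Id_in Hom_Obj by metis
  have "(a \<cdot> b) \<cdot> e = Id C Z' \<cdot> e" using a b assms comp_assoc Id_comp by metis
  then have 2: "a \<cdot> b = Id C Z'"
    using cokernel_epi[OF assms(2,4)] comp_in a b Id_in Hom_Obj by metis
  show ?thesis using a b 1 2 unfolding is_iso_def by (auto simp: Hom_def)
qed

section \<open>Biproducts\<close>

text \<open>Precomposition is a homomorphism of Hom groups, so it distributes over the sum in
  \<open>is_direct_sum\<close>.\<close>

lemma finprod_comp:
  assumes "finite A" "\<And>k. k \<in> A \<Longrightarrow> f k \<in> Hom C Y Z" "u \<in> Hom C X Y" "Y \<in> Obj C" "Z \<in> Obj C"
  shows "finprod (hom_group C Y Z) f A \<cdot> u = finprod (hom_group C X Z) (\<lambda>k. f k \<cdot> u) A"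
  using assms(1,2)
proof (induction A rule: finite_induct)
  case empty
  have X: "X \<in> Obj C" using assms Hom_Obj by blast
  interpret YZ: comm_group "hom_group C Y Z" using hom_comm_group assms by blast
  interpret XZ: comm_group "hom_group C X Z" using hom_comm_group assms X by blast
  show ?case using Zero_comp[OF assms(3,5)] by (simp add: hom_group_simps)
next
  case (insert k A)
  have X: "X \<in> Obj C" using assms Hom_Obj by blast
  interpret YZ: comm_group "hom_group C Y Z" using hom_comm_group assms by blast
  interpret XZ: comm_group "hom_group C X Z" using hom_comm_group assms X by blast
  have 1: "f \<in> A \<rightarrow> carrier (hom_group C Y Z)" "f k \<in> carrier (hom_group C Y Z)"
    using insert.prems by (auto simp: hom_group_simps)
  have 2: "(\<lambda>k. f k \<cdot> u) \<in> A \<rightarrow> carrier (hom_group C X Z)" "f k \<cdot> u \<in> carrier (hom_group C X Z)"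
    using insert.prems comp_in[OF assms(3)] by (auto simp: hom_group_simps)
  have 3: "finprod (hom_group C Y Z) f A \<in> Hom C Y Z"
    using YZ.finprod_closed[OF 1(1)] by (simp add: hom_group_simps)
  have "finprod (hom_group C Y Z) f (insert k A) = Plus C (f k) (finprod (hom_group C Y Z) f A)"
    using YZ.finprod_insert[OF insert.hyps 1] by (simp add: hom_group_simps)
  moreover have "finprod (hom_group C X Z) (\<lambda>k. f k \<cdot> u) (insert k A)
      = Plus C (f k \<cdot> u) (finprod (hom_group C X Z) (\<lambda>k. f k \<cdot> u) A)"
    using XZ.finprod_insert[OF insert.hyps 2] by (simp add: hom_group_simps)
  ultimately show ?case
    using Plus_comp[OF assms(3) _ 3, of "f k"] insert by auto
qed

text \<open>Decompose \<open>u\<close> as the sum of all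
  \<open>\<iota> k \<cdot> (\<pi> k \<cdot> u)\<close>. For \<open>n = 0\<close> there is no
  projection to test, and every arrow into \<open>B\<close> is zero.\<close>

lemma direct_sum_joint_mono:
  assumes "is_direct_sum C n X B \<iota> \<pi>" "u \<in> Hom C W B" "\<And>k. k < n \<Longrightarrow> \<pi> k \<cdot> u = Zero C W (X k)"
  shows "u = Zero C W B"
proof -
  have B: "B \<in> Obj C" "W \<in> Obj C" using assms Hom_Obj by blast+
  interpret WB: comm_group "hom_group C W B" using hom_comm_group B by blast
  have h: "\<iota> k \<in> Hom C (X k) B" "\<pi> k \<in> Hom C B (X k)" if "k < n" for k
    using assms(1) that by (auto simp: is_direct_sum_def)
  have "u = finprod (hom_group C B B) (\<lambda>k. \<iota> k \<cdot> \<pi> k) {..<n} \<cdot> u"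
    using assms(1) Id_comp[OF assms(2)] by (simp add: is_direct_sum_def)
  also have "\<dots> = finprod (hom_group C W B) (\<lambda>k. (\<iota> k \<cdot> \<pi> k) \<cdot> u) {..<n}"
    by (rule finprod_comp[OF _ _ assms(2) B(1) B(1)]) (use h comp_in in blast)+
  also have "\<dots> = finprod (hom_group C W B) (\<lambda>k. \<one>\<^bsub>hom_group C W B\<^esub>) {..<n}"
  proof (rule WB.finprod_cong')
    fix k assume "k \<in> {..<n}"
    then show "(\<iota> k \<cdot> \<pi> k) \<cdot> u = \<one>\<^bsub>hom_group C W B\<^esub>"
      using h[of k] assms(3)[of k] comp_assoc[OF assms(2), of "\<pi> k" _ "\<iota> k"] comp_Zero[of "\<iota> k"] B(2)
      by (auto simp: hom_group_simps)
  qed auto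
  also have "\<dots> = Zero C W B" using WB.finprod_one_eqI[of "{..<n}" "\<lambda>k. \<one>\<^bsub>hom_group C W B\<^esub>"]
    by (simp only: hom_group_simps)
  finally show ?thesis .
qed

text \<open>The case of two summands freed from indexed families and \<open>finprod\<close>, so that
  its equations can serve for rewriting.\<close>

definition biproduct :: "'a \<Rightarrow> 'a \<Rightarrow> 'a \<Rightarrow> 'b \<Rightarrow> 'b \<Rightarrow> 'b \<Rightarrow> 'b \<Rightarrow> bool" where
  "biproduct X Y B i1 i2 p1 p2 \<longleftrightarrow>
     i1 \<in> Hom C X B \<and> i2 \<in> Hom C Y B \<and> p1 \<in> Hom C B X \<and> p2 \<in> Hom C B Y \<and>
     p1 \<cdot> i1 = Id C X \<and> p2 \<cdot> i2 = Id C Y \<and> p1 \<cdot> i2 = Zero C Y X \<and> p2 \<cdot> i1 = Zero C X Y \<and>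
     Plus C (i1 \<cdot> p1) (i2 \<cdot> p2) = Id C B"

lemma finprod_two:
  assumes "X \<in> Obj C" "Y \<in> Obj C" "f 0 \<in> Hom C X Y" "f (Suc 0) \<in> Hom C X Y"
  shows "finprod (hom_group C X Y) f {..<2::nat} = Plus C (f 0) (f (Suc 0))"
proof -
  interpret comm_group "hom_group C X Y" using hom_comm_group assms by blast
  have "{..<2::nat} = {0, Suc 0}" by auto
  moreover have "finprod (hom_group C X Y) f {0, Suc 0} = Plus C (f 0) (f (Suc 0))"
    using finprod_insert[of "{Suc 0}" 0 f] finprod_insert[of "{}" "Suc 0" f] Plus_Zero[OF assms(4)] assms(3,4)
    by (simp add: hom_group_simps)
  ultimately show ?thesis by simp
qed

lemma all_less_two: "(\<forall>k<2. P k) \<longleftrightarrow> P 0 \<and> P (Suc 0)"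
  by (auto simp: less_Suc_eq numeral_2_eq_2)

lemma direct_sum_biproduct:
  assumes ds: "is_direct_sum C 2 (\<lambda>k. if k = 0 then X else Y) B \<iota> \<pi>"
  shows "biproduct X Y B (\<iota> 0) (\<iota> (Suc 0)) (\<pi> 0) (\<pi> (Suc 0))"
proof -
  have h: "B \<in> Obj C" "\<iota> 0 \<in> Hom C X B" "\<pi> 0 \<in> Hom C B X" "\<iota> (Suc 0) \<in> Hom C Y B" "\<pi> (Suc 0) \<in> Hom C B Y"
    using ds unfolding is_direct_sum_def all_less_two by auto
  have "finprod (hom_group C B B) (\<lambda>k. \<iota> k \<cdot> \<pi> k) {..<2::nat} = Plus C (\<iota> 0 \<cdot> \<pi> 0) (\<iota> (Suc 0) \<cdot> \<pi> (Suc 0))"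
    using finprod_two[OF h(1,1), of "\<lambda>k. \<iota> k \<cdot> \<pi> k"] h comp_in by blast
  then show ?thesis
    using ds h unfolding is_direct_sum_def all_less_two biproduct_def by auto
qed

lemma biproduct_direct_sum:
  assumes "biproduct X Y B i1 i2 p1 p2"
  shows "is_direct_sum C 2 (\<lambda>k. if k = 0 then X else Y) B (\<lambda>k. if k = 0 then i1 else i2) (\<lambda>k. if k = 0 then p1 else p2)"
proof -
  have H: "i1 \<in> Hom C X B" "i2 \<in> Hom C Y B" "p1 \<in> Hom C B X" "p2 \<in> Hom C B Y"
    using assms unfolding biproduct_def by blast+
  have "i1 \<cdot> p1 \<in> Hom C B B" "i2 \<cdot> p2 \<in> Hom C B B" using H comp_in by blast+
  then have "finprod (hom_group C B B) (\<lambda>k. (if k = 0 then i1 else i2) \<cdot> (if k = 0 then p1 else p2)) {..<2::nat}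
      = Plus C (i1 \<cdot> p1) (i2 \<cdot> p2)"
    using finprod_two[of B B "\<lambda>k. (if k = 0 then i1 else i2) \<cdot> (if k = 0 then p1 else p2)"] Hom_Obj[OF H(1)]
    by simp
  then show ?thesis
    using assms H Hom_Obj[OF H(1)] Hom_Obj[OF H(2)]
    unfolding is_direct_sum_def biproduct_def all_less_two by simp
qed

lemma direct_summand_iff_biproduct:
  "direct_summand C X B \<longleftrightarrow> (\<exists>Y i1 i2 p1 p2. biproduct X Y B i1 i2 p1 p2)"
  unfolding direct_summand_def using biproduct_direct_sum direct_sum_biproduct by blast

lemma biproduct_commute:
  assumes "biproduct X Y B i1 i2 p1 p2"
  shows "biproduct Y X B i2 i1 p2 p1"
proof -
  have "i1 \<cdot> p1 \<in> Hom C B B" "i2 \<cdot> p2 \<in> Hom C B B" using assms comp_in unfolding biproduct_def by blast+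
  from Plus_commute[OF this] show ?thesis using assms unfolding biproduct_def by simp
qed

text \<open>The complement of the retract is the cokernel of the section, and \<open>t\<close> comes from \<open>Id - s \<cdot> r\<close>.\<close>

lemma retract_biproduct:
  assumes "weakly_idempotent_complete C" "s \<in> Hom C X B" "r \<in> Hom C B X" "r \<cdot> s = Id C X"
  shows "\<exists>K t c. biproduct X K B s t r c"
proof -
  obtain c where c: "is_cokernel C s c" using assms unfolding weakly_idempotent_complete_def by blast
  define K where "K = Cod C c"
  have cH: "c \<in> Hom C B K" using c assms(2) unfolding is_cokernel_def K_def Hom_def by auto
  have ob: "X \<in> Obj C" "B \<in> Obj C" "K \<in> Obj C" using Hom_Obj assms(2) cH by blast+
  note H = assms(2,3,4) cH ob
  have cs: "c \<cdot> s = Zero C X K" using cokernel_zero[OF c assms(2) cH] .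
  have "s \<cdot> r \<in> Hom C B B" using assms comp_in by blast
  then obtain h where h: "h \<in> Hom C B B" "Id C B = Plus C (s \<cdot> r) h"
    using diff_exists Id_in ob by blast
  have "Plus C s (h \<cdot> s) = Plus C (s \<cdot> (r \<cdot> s)) (h \<cdot> s)" using H by (simp add: add_simps)
  also have "\<dots> = Plus C (s \<cdot> r) h \<cdot> s" using H(1,2,4-) h(1) by (simp add: add_simps)
  also have "\<dots> = s" unfolding h(2)[symmetric] using H(1) by (rule Id_comp)
  finally have "h \<cdot> s = Zero C X B" using Plus_cancel_Zero[OF H(1)] comp_in H(1) h(1) by blast
  then obtain t where t: "t \<in> Hom C K B" "t \<cdot> c = h" using cokernel_lift[OF c H(1,4) h(1)] by blast
  have Ids: "Plus C (s \<cdot> r) (t \<cdot> c) = Id C B" using h t by simp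
  have csr: "c \<cdot> (s \<cdot> r) = Zero C B K" using comp_eq_assoc[OF cs H(1,4)] H by (simp add: add_simps)
  have "c = c \<cdot> Plus C (s \<cdot> r) (t \<cdot> c)" unfolding Ids using H by (simp add: add_simps)
  also have "\<dots> = c \<cdot> (t \<cdot> c)" using H t(1) csr by (simp add: add_simps)
  finally have "(c \<cdot> t) \<cdot> c = Id C K \<cdot> c" using H t(1) by (simp add: add_simps)
  then have ct: "c \<cdot> t = Id C K" using cokernel_epi[OF c H(4)] comp_in t H(4) Id_in ob by blast
  have "r = r \<cdot> Plus C (s \<cdot> r) (t \<cdot> c)" unfolding Ids using H by (simp add: add_simps)
  also have "\<dots> = Plus C r (r \<cdot> (t \<cdot> c))" using comp_eq_assoc[OF H(3,1,2)] H t(1) by (simp add: add_simps)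
  finally have "r \<cdot> (t \<cdot> c) = Zero C B X" using Plus_cancel_Zero[OF H(2)] comp_in H t(1) by metis
  then have "(r \<cdot> t) \<cdot> c = Zero C K X \<cdot> c" using H t(1) by (simp add: add_simps)
  then have rt: "r \<cdot> t = Zero C K X"
    using cokernel_epi[OF c H(4)] comp_in t H(2) Zero_in ob by blast
  show ?thesis using H t(1) ct rt cs Ids unfolding biproduct_def by blast
qed

lemma retract_direct_summand:
  assumes "weakly_idempotent_complete C" "s \<in> Hom C X B" "r \<in> Hom C B X" "r \<cdot> s = Id C X"
  shows "direct_summand C X B"
  using retract_biproduct[OF assms] direct_summand_iff_biproduct by blast

lemma biproductD:
  assumes "biproduct X Y B i1 i2 p1 p2"
  shows "i1 \<in> Hom C X B" "i2 \<in> Hom C Y B" "p1 \<in> Hom C B X" "p2 \<in> Hom C B Y"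
     "p1 \<cdot> i1 = Id C X" "p2 \<cdot> i2 = Id C Y" "p1 \<cdot> i2 = Zero C Y X" "p2 \<cdot> i1 = Zero C X Y"
     "Plus C (i1 \<cdot> p1) (i2 \<cdot> p2) = Id C B"
  using assms unfolding biproduct_def by auto

lemma biproduct_pair:
  assumes b: "biproduct X Y B i1 i2 p1 p2" and a: "a1 \<in> Hom C W X" "a2 \<in> Hom C W Y"
  shows "\<exists>u \<in> Hom C W B. p1 \<cdot> u = a1 \<and> p2 \<cdot> u = a2"
proof -
  note H = biproductD[OF b]
  have u: "Plus C (i1 \<cdot> a1) (i2 \<cdot> a2) \<in> Hom C W B" using Plus_in comp_in H(1,2) a by blast
  have 1: "p1 \<cdot> Plus C (i1 \<cdot> a1) (i2 \<cdot> a2) = a1"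
    using comp_eq_assoc[OF H(5,1,3), of a1] comp_eq_assoc[OF H(7,2,3), of a2] H(1-4) a Hom_Obj[OF a(1)] Hom_Obj[OF H(1)]
    by (simp add: add_simps)
  have 2: "p2 \<cdot> Plus C (i1 \<cdot> a1) (i2 \<cdot> a2) = a2"
    using comp_eq_assoc[OF H(8,1,4), of a1] comp_eq_assoc[OF H(6,2,4), of a2] H(1-4) a Hom_Obj[OF a(1)] Hom_Obj[OF H(2)]
    by (simp add: add_simps)
  show ?thesis using u 1 2 by blast
qed

lemma biproduct_joint_mono:
  assumes b: "biproduct X Y B i1 i2 p1 p2" and u: "u \<in> Hom C W B" "p1 \<cdot> u = Zero C W X" "p2 \<cdot> u = Zero C W Y"
  shows "u = Zero C W B"
proof -
  note H = biproductD[OF b]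
  have "u = Plus C (i1 \<cdot> p1) (i2 \<cdot> p2) \<cdot> u" unfolding H(9) using u(1) Id_comp by simp
  also have "\<dots> = Plus C (i1 \<cdot> (p1 \<cdot> u)) (i2 \<cdot> (p2 \<cdot> u))" using H(1-4) u(1) by (simp add: add_simps)
  also have "\<dots> = Zero C W B" unfolding u(2,3) using H(1,2) Hom_Obj[OF u(1)] by (simp add: add_simps)
  finally show ?thesis .
qed

lemma biproduct_kernel:
  assumes b: "biproduct X Y B i1 i2 p1 p2"
  shows "is_kernel C i1 p2" "is_cokernel C i1 p2"
proof -
  have H: "i1 \<in> Hom C X B" "i2 \<in> Hom C Y B" "p1 \<in> Hom C B X" "p2 \<in> Hom C B Y"
     "p1 \<cdot> i1 = Id C X" "p2 \<cdot> i2 = Id C Y" "p1 \<cdot> i2 = Zero C Y X" "p2 \<cdot> i1 = Zero C X Y"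
     "Plus C (i1 \<cdot> p1) (i2 \<cdot> p2) = Id C B" using b unfolding biproduct_def by auto
  have ob: "X \<in> Obj C" "Y \<in> Obj C" "B \<in> Obj C" using H Hom_Obj by blast+
  show "is_kernel C i1 p2"
  proof (rule kernelI[OF H(1,4,8)])
    fix W h assume h: "h \<in> Hom C W B" "p2 \<cdot> h = Zero C W Y"
    have "h = Plus C (i1 \<cdot> p1) (i2 \<cdot> p2) \<cdot> h" unfolding H(9) using h by (simp add: add_simps)
    also have "\<dots> = Plus C (i1 \<cdot> (p1 \<cdot> h)) (i2 \<cdot> (p2 \<cdot> h))" using H(1-4) h(1) by (simp add: add_simps)
    also have "\<dots> = i1 \<cdot> (p1 \<cdot> h)" unfolding h(2) using H(1-4) h(1) Hom_Obj[OF h(1)] by (simp add: add_simps)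
    finally show "\<exists>u \<in> Hom C W X. i1 \<cdot> u = h" using comp_in[OF h(1) H(3)] by metis
  next
    fix W u assume u: "u \<in> Hom C W X" "i1 \<cdot> u = Zero C W B"
    have "u = p1 \<cdot> (i1 \<cdot> u)" using comp_eq_assoc[OF H(5,1,3), of u] u(1) ob by (simp add: add_simps)
    then show "u = Zero C W X" unfolding u(2) using comp_Zero[OF H(3)] Hom_Obj[OF u(1)] by simp
  qed
  show "is_cokernel C i1 p2"
  proof (rule cokernelI[OF H(1,4,8)])
    fix W h assume h: "h \<in> Hom C B W" "h \<cdot> i1 = Zero C X W"
    have "h = h \<cdot> Plus C (i1 \<cdot> p1) (i2 \<cdot> p2)" unfolding H(9) using h by (simp add: add_simps)
    also have "\<dots> = Plus C (h \<cdot> (i1 \<cdot> p1)) (h \<cdot> (i2 \<cdot> p2))" using H(1-4) h(1) by (simp add: add_simps)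
    also have "\<dots> = (h \<cdot> i2) \<cdot> p2"
      using comp_eq_assoc[OF h(2) H(1) h(1), of p1] H(1-4) h(1) Hom_Obj[OF h(1)] ob by (simp add: add_simps)
    finally show "\<exists>u \<in> Hom C Y W. u \<cdot> p2 = h" using comp_in[OF H(2) h(1)] by metis
  next
    fix W u assume u: "u \<in> Hom C Y W" "u \<cdot> p2 = Zero C B W"
    have "u = (u \<cdot> p2) \<cdot> i2" using comp_assoc[OF H(2,4) u(1)] H(6) comp_Id[OF u(1)] by simp
    then show "u = Zero C Y W" unfolding u(2) using Zero_comp[OF H(2)] Hom_Obj[OF u(1)] by simp
  qed
qed

lemma is_isoE:
  assumes "is_iso C a" "a \<in> Hom C X Y"
  obtains b where "b \<in> Hom C Y X" "b \<cdot> a = Id C X" "a \<cdot> b = Id C Y" "is_iso C b"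
proof -
  obtain b where "b \<in> Hom C Y X" "b \<cdot> a = Id C X" "a \<cdot> b = Id C Y"
    using assms unfolding is_iso_def by (auto simp: Hom_def)
  moreover from this have "is_iso C b" using assms unfolding is_iso_def by (auto simp: Hom_def)
  ultimately show ?thesis using that by blast
qed

lemma is_isoI:
  assumes "a \<in> Hom C X Y" "b \<in> Hom C Y X" "b \<cdot> a = Id C X" "a \<cdot> b = Id C Y"
  shows "is_iso C a"
  using assms unfolding is_iso_def by (auto simp: Hom_def)

lemma is_iso_Id: "X \<in> Obj C \<Longrightarrow> is_iso C (Id C X)"
  using is_isoI[OF Id_in Id_in] comp_Id Id_in by blast

end

context additive_category
begin

text \<open>The empty direct sum is a zero object, since \<open>direct_sum_joint_mono\<close>
  applies to its identity without any condition.\<close>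

lemma zero_object_exists: "\<exists>Z \<in> Obj C. Id C Z = Zero C Z Z"
proof -
  obtain B \<iota> \<pi> where b: "is_direct_sum C 0 (\<lambda>_. undefined) B \<iota> \<pi>" using direct_sums[of 0 "\<lambda>_. undefined"] by blast
  then have "B \<in> Obj C" unfolding is_direct_sum_def by blast
  then show ?thesis using direct_sum_joint_mono[OF b, of "Id C B" B] Id_in by auto
qed

lemma biproduct_exists:
  assumes "X \<in> Obj C" "Y \<in> Obj C"
  shows "\<exists>B i1 i2 p1 p2. biproduct X Y B i1 i2 p1 p2"
proof -
  have "\<exists>B \<iota> \<pi>. is_direct_sum C 2 (\<lambda>k. if k = 0 then X else Y) B \<iota> \<pi>"
    by (rule direct_sums) (use assms in auto)
  then show ?thesis using direct_sum_biproduct by blast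
qed

end

section \<open>Exact categories\<close>

context preadditive_category
begin

lemma pullbackI:
  assumes H: "f \<in> Hom C X Z" "g \<in> Hom C Y Z" "f' \<in> Hom C V Y" "g' \<in> Hom C V X" "f \<cdot> g' = g \<cdot> f'"
    and lift: "\<And>W a b. a \<in> Hom C W X \<Longrightarrow> b \<in> Hom C W Y \<Longrightarrow> f \<cdot> a = g \<cdot> b \<Longrightarrow> \<exists>u \<in> Hom C W V. g' \<cdot> u = a \<and> f' \<cdot> u = b"
    and mono: "\<And>W u. u \<in> Hom C W V \<Longrightarrow> g' \<cdot> u = Zero C W X \<Longrightarrow> f' \<cdot> u = Zero C W Y \<Longrightarrow> u = Zero C W V"
  shows "is_pullback C f g f' g'"
proof -
  have uniq: "u = v" if uv: "u \<in> Hom C W V" "v \<in> Hom C W V" "g' \<cdot> u = g' \<cdot> v" "f' \<cdot> u = f' \<cdot> v" for W u v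
  proof -
    obtain h where h: "h \<in> Hom C W V" "u = Plus C v h" using diff_exists[OF uv(1,2)] by blast
    have "Plus C (g' \<cdot> v) (g' \<cdot> h) = g' \<cdot> v" using comp_Plus uv h H by metis
    then have 1: "g' \<cdot> h = Zero C W X" using Plus_cancel_Zero comp_in uv h H by metis
    have "Plus C (f' \<cdot> v) (f' \<cdot> h) = f' \<cdot> v" using comp_Plus uv h H by metis
    then have 2: "f' \<cdot> h = Zero C W Y" using Plus_cancel_Zero comp_in uv h H by metis
    from 1 2 show ?thesis using mono h Plus_Zero uv by metis
  qed
  have ex: "\<exists>!u. u \<in> Hom C W V \<and> g' \<cdot> u = a \<and> f' \<cdot> u = b"
    if "a \<in> Hom C W X" "b \<in> Hom C W Y" "f \<cdot> a = g \<cdot> b" for W a b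
    using lift[OF that] uniq by metis
  have D: "Dom C f = X" "Dom C g = Y" "Dom C f' = V" using H by (auto simp: Hom_def)
  have side: "{f, g, f', g'} \<subseteq> Arr C" "Cod C f = Cod C g" "Cod C g' = X" "Cod C f' = Y" "V = Dom C g'"
    using H by (auto simp: Hom_def)
  show ?thesis unfolding is_pullback_def D using side H(5) ex by blast
qed

text \<open>Unique existence is split into existence and joint cancellation, the two forms in which
  it is applied.\<close>

lemma pullbackE:
  assumes pb: "is_pullback C f g f' g'" and H: "f \<in> Hom C X Z" "g \<in> Hom C Y Z"
  obtains V where "f' \<in> Hom C V Y" "g' \<in> Hom C V X" "f \<cdot> g' = g \<cdot> f'"
    "\<And>W a b. a \<in> Hom C W X \<Longrightarrow> b \<in> Hom C W Y \<Longrightarrow> f \<cdot> a = g \<cdot> b \<Longrightarrow> \<exists>u \<in> Hom C W V. g' \<cdot> u = a \<and> f' \<cdot> u = b"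
    "\<And>W u v. u \<in> Hom C W V \<Longrightarrow> v \<in> Hom C W V \<Longrightarrow> g' \<cdot> u = g' \<cdot> v \<Longrightarrow> f' \<cdot> u = f' \<cdot> v \<Longrightarrow> u = v"
proof -
  define V where "V = Dom C f'"
  have D: "Dom C f = X" "Dom C g = Y" using H by (auto simp: Hom_def)
  have 1: "f' \<in> Hom C V Y" "g' \<in> Hom C V X" and 2: "f \<cdot> g' = g \<cdot> f'"
    using pb H unfolding is_pullback_def V_def by (auto simp: Hom_def)
  have ex: "\<exists>!u. u \<in> Hom C W V \<and> g' \<cdot> u = a \<and> f' \<cdot> u = b"
    if "a \<in> Hom C W X" "b \<in> Hom C W Y" "f \<cdot> a = g \<cdot> b" for W a b
    using pb that Hom_Obj[OF that(1)] unfolding is_pullback_def V_def D by blast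
  have "u = v" if "u \<in> Hom C W V" "v \<in> Hom C W V" "g' \<cdot> u = g' \<cdot> v" "f' \<cdot> u = f' \<cdot> v" for W u v
  proof -
    have "f \<cdot> (g' \<cdot> u) = g \<cdot> (f' \<cdot> u)" using comp_assoc[OF that(1) 1(2) H(1)] comp_assoc[OF that(1) 1(1) H(2)] 2 by simp
    from ex[OF comp_in[OF that(1) 1(2)] comp_in[OF that(1) 1(1)] this] show ?thesis using that by metis
  qed
  with that 1 2 ex show ?thesis by blast
qed

lemma pushoutE:
  assumes po: "is_pushout C f g f' g'" and H: "f \<in> Hom C X Y" "g \<in> Hom C X Z"
  obtains V where "f' \<in> Hom C Z V" "g' \<in> Hom C Y V" "g' \<cdot> f = f' \<cdot> g"
    "\<And>W a b. a \<in> Hom C Y W \<Longrightarrow> b \<in> Hom C Z W \<Longrightarrow> a \<cdot> f = b \<cdot> g \<Longrightarrow> \<exists>u \<in> Hom C V W. u \<cdot> g' = a \<and> u \<cdot> f' = b"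
    "\<And>W u v. u \<in> Hom C V W \<Longrightarrow> v \<in> Hom C V W \<Longrightarrow> u \<cdot> g' = v \<cdot> g' \<Longrightarrow> u \<cdot> f' = v \<cdot> f' \<Longrightarrow> u = v"
proof -
  define V where "V = Cod C f'"
  have D: "Cod C f = Y" "Cod C g = Z" using H by (auto simp: Hom_def)
  have 1: "f' \<in> Hom C Z V" "g' \<in> Hom C Y V" and 2: "g' \<cdot> f = f' \<cdot> g"
    using po H unfolding is_pushout_def V_def by (auto simp: Hom_def)
  have ex: "\<exists>!u. u \<in> Hom C V W \<and> u \<cdot> g' = a \<and> u \<cdot> f' = b"
    if "a \<in> Hom C Y W" "b \<in> Hom C Z W" "a \<cdot> f = b \<cdot> g" for W a b
    using po that Hom_Obj[OF that(1)] unfolding is_pushout_def V_def D by blast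
  have "u = v" if "u \<in> Hom C V W" "v \<in> Hom C V W" "u \<cdot> g' = v \<cdot> g'" "u \<cdot> f' = v \<cdot> f'" for W u v
  proof -
    have "(u \<cdot> g') \<cdot> f = (u \<cdot> f') \<cdot> g" using comp_assoc[OF H(1) 1(2) that(1)] comp_assoc[OF H(2) 1(1) that(1)] 2 by simp
    from ex[OF comp_in[OF 1(2) that(1)] comp_in[OF 1(1) that(1)] this] show ?thesis using that by metis
  qed
  with that 1 2 ex show ?thesis by blast
qed

lemma zero_object_Hom:
  assumes "Id C Z = Zero C Z Z"
  shows "u \<in> Hom C W Z \<Longrightarrow> u = Zero C W Z" "u \<in> Hom C Z W \<Longrightarrow> u = Zero C Z W"
  using assms Id_comp[of u W Z] comp_Id[of u Z W] Zero_comp[of u W Z Z] comp_Zero[of u Z W Z] Hom_Obj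
  by metis+

end

section \<open>Conflations: completion of an arrow, isomorphisms, pushouts, cancellation\<close>

context exact_category
begin

lemma conflE:
  assumes "(i, d) \<in> Confl E"
  obtains X Y Z where "i \<in> Hom E X Y" "d \<in> Hom E Y Z" "is_kernel E i d" "is_cokernel E i d"
    "inflation E i" "deflation E d"
proof -
  have "i \<in> Hom E (Dom E i) (Cod E i)" "d \<in> Hom E (Cod E i) (Cod E d)"
    using confl_kernel[OF assms] unfolding is_kernel_def Hom_def by auto
  then show ?thesis
    using that confl_kernel[OF assms] confl_cokernel[OF assms] assms unfolding inflation_def deflation_def by blast
qed

lemma deflationE:
  assumes "deflation E d" "d \<in> Hom E Y Z"
  obtains i X where "i \<in> Hom E X Y" "(i, d) \<in> Confl E" "is_kernel E i d" "is_cokernel E i d" "inflation E i"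
proof -
  obtain i where i: "(i, d) \<in> Confl E" using assms unfolding deflation_def by blast
  then obtain X Y' Z' where "i \<in> Hom E X Y'" "d \<in> Hom E Y' Z'" "is_kernel E i d" "is_cokernel E i d"
    "inflation E i" by (rule conflE)
  moreover then have "Y' = Y" using assms(2) by (auto simp: Hom_def)
  ultimately show ?thesis using that i by blast
qed

lemma inflationE:
  assumes "inflation E i" "i \<in> Hom E X Y"
  obtains d Z where "d \<in> Hom E Y Z" "(i, d) \<in> Confl E" "is_kernel E i d" "is_cokernel E i d" "deflation E d"
proof -
  obtain d where d: "(i, d) \<in> Confl E" using assms unfolding inflation_def by blast
  then obtain X' Y' Z where "i \<in> Hom E X' Y'" "d \<in> Hom E Y' Z" "is_kernel E i d" "is_cokernel E i d"
    "deflation E d" by (rule conflE)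
  moreover then have "Y' = Y" using assms(2) by (auto simp: Hom_def)
  ultimately show ?thesis using that d by blast
qed

lemma deflation_epi:
  "\<lbrakk>deflation E d; d \<in> Hom E Y Z; u \<in> Hom E Z W; v \<in> Hom E Z W; u \<cdot> d = v \<cdot> d\<rbrakk> \<Longrightarrow> u = v"
  by (meson deflationE cokernel_epi)

lemma inflation_mono:
  "\<lbrakk>inflation E i; i \<in> Hom E X Y; u \<in> Hom E W X; v \<in> Hom E W X; i \<cdot> u = i \<cdot> v\<rbrakk> \<Longrightarrow> u = v"
  by (meson inflationE kernel_mono)

text \<open>Kernels are unique up to isomorphism and conflations are closed under isomorphism, so
  every kernel of a deflation completes it.\<close>

lemma confl_of_deflation_kernel:
  assumes "deflation E d" "is_kernel E i d"
  shows "(i, d) \<in> Confl E"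
proof -
  obtain X Y Z where H: "i \<in> Hom E X Y" "d \<in> Hom E Y Z"
    using assms(2) unfolding is_kernel_def Hom_def by auto
  obtain k K where k: "k \<in> Hom E K Y" "(k, d) \<in> Confl E" "is_kernel E k d" using deflationE[OF assms(1) H(2)] by metis
  obtain a where a: "a \<in> Hom E K X" "is_iso E a" "i \<cdot> a = k"
    using kernel_unique[OF assms(2) k(3) H(1) k(1)] by blast
  have ob: "Y \<in> Obj E" "Z \<in> Obj E" using Hom_Obj[OF H(2)] by auto
  show ?thesis
    by (rule confl_iso[OF k(2), where a = a and b = "Id E Y" and c = "Id E Z"])
      (use H k(1) a ob is_iso_Id in \<open>auto simp: add_simps\<close>)
qed

lemma confl_of_inflation_cokernel:
  assumes "inflation E i" "is_cokernel E i d"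
  shows "(i, d) \<in> Confl E"
proof -
  obtain X Y Z where H: "i \<in> Hom E X Y" "d \<in> Hom E Y Z"
    using assms(2) unfolding is_cokernel_def Hom_def by auto
  obtain c Z' where c: "c \<in> Hom E Y Z'" "(i, c) \<in> Confl E" "is_cokernel E i c" using inflationE[OF assms(1) H(1)] by metis
  obtain a where a: "a \<in> Hom E Z' Z" "is_iso E a" "a \<cdot> c = d"
    using cokernel_unique[OF c(3) assms(2) c(1) H(2)] by blast
  have ob: "X \<in> Obj E" "Y \<in> Obj E" using Hom_Obj[OF H(1)] by auto
  show ?thesis
    by (rule confl_iso[OF c(2), where a = "Id E X" and b = "Id E Y" and c = a])
      (use H c(1) a ob is_iso_Id in \<open>auto simp: add_simps\<close>)
qed

text \<open>Transport a conflation ending in \<open>Id E X\<close> along identities on its first two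
  terms and \<open>a\<close> on the last.\<close>

lemma iso_deflation:
  assumes "is_iso E a"
  shows "deflation E a"
proof -
  obtain X Y where a: "a \<in> Hom E X Y" using assms unfolding is_iso_def Hom_def by auto
  have ob: "X \<in> Obj E" "Y \<in> Obj E" using Hom_Obj[OF a] by auto
  obtain k K where k: "k \<in> Hom E K X" "(k, Id E X) \<in> Confl E" using deflationE[OF Id_deflation Id_in] ob by metis
  have "(k, a) \<in> Confl E"
    by (rule confl_iso[OF k(2), where a = "Id E K" and b = "Id E X" and c = a])
      (use a k(1) ob assms is_iso_Id Hom_Obj[OF k(1)] in \<open>auto simp: add_simps\<close>)
  then show ?thesis unfolding deflation_def by blast
qed

lemma iso_inflation:
  assumes "is_iso E a"
  shows "inflation E a"
proof -
  obtain X Y where a: "a \<in> Hom E X Y" using assms unfolding is_iso_def Hom_def by auto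
  have ob: "X \<in> Obj E" "Y \<in> Obj E" using Hom_Obj[OF a] by auto
  obtain b where b: "b \<in> Hom E Y X" "is_iso E b" "b \<cdot> a = Id E X" "a \<cdot> b = Id E Y" using is_isoE[OF assms a] by metis
  obtain k K where k: "k \<in> Hom E Y K" "(Id E Y, k) \<in> Confl E" using inflationE[OF Id_inflation Id_in] ob by metis
  have "(a, k) \<in> Confl E"
    by (rule confl_iso[OF k(2), where a = b and b = "Id E Y" and c = "Id E K"])
      (use a b k(1) ob assms is_iso_Id Hom_Obj[OF k(1)] in \<open>auto simp: add_simps\<close>)
  then show ?thesis unfolding inflation_def by blast
qed

text \<open>The kernel of \<open>d\<close> is zero, so the identity of \<open>Y\<close> factors
  through \<open>d\<close>, the cokernel of that kernel; this gives a left inverse, and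
  \<open>d\<close> is epic.\<close>

lemma deflation_mono_iso:
  assumes "deflation E d" "d \<in> Hom E Y Z"
    and mono: "\<And>W u. u \<in> Hom E W Y \<Longrightarrow> d \<cdot> u = Zero E W Z \<Longrightarrow> u = Zero E W Y"
  shows "is_iso E d"
proof -
  obtain i X where i: "i \<in> Hom E X Y" "is_kernel E i d" "is_cokernel E i d" using deflationE[OF assms(1,2)] by metis
  have ob: "X \<in> Obj E" "Y \<in> Obj E" "Z \<in> Obj E" using Hom_Obj i(1) assms(2) by blast+
  have "i = Zero E X Y" using mono[OF i(1)] kernel_zero[OF i(2,1) assms(2)] by simp
  then have "Id E Y \<cdot> i = Zero E X Y" using Id_comp[OF i(1)] by simp
  then obtain u where u: "u \<in> Hom E Z Y" "u \<cdot> d = Id E Y"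
    using cokernel_lift[OF i(3,1) assms(2)] Id_in ob by blast
  have "(d \<cdot> u) \<cdot> d = Id E Z \<cdot> d" using comp_assoc[OF assms(2) u(1) assms(2)] u(2) comp_Id Id_comp assms(2) by simp
  then have "d \<cdot> u = Id E Z" using deflation_epi[OF assms(1,2)] comp_in[OF u(1) assms(2)] Id_in ob by blast
  then show ?thesis using is_isoI assms(2) u by blast
qed

text \<open>The axiom provides one pullback whose side is a deflation; any other differs from it by
  an isomorphism, which is itself a deflation.\<close>

lemma pullback_deflation:
  assumes pb: "is_pullback E d f d' f'" and d: "deflation E d"
  shows "deflation E d'"
proof -
  obtain X Y Z where H: "d \<in> Hom E X Z" "f \<in> Hom E Y Z"
    using pb unfolding is_pullback_def Hom_def by auto
  then obtain d1 f1 where 1: "is_pullback E d f d1 f1" "deflation E d1"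
    using deflation_pullback[OF d, of f] by (auto simp: Hom_def)
  obtain V where V: "d' \<in> Hom E V Y" "f' \<in> Hom E V X" "d \<cdot> f' = f \<cdot> d'"
    "\<And>W a b. a \<in> Hom E W X \<Longrightarrow> b \<in> Hom E W Y \<Longrightarrow> d \<cdot> a = f \<cdot> b \<Longrightarrow> \<exists>u \<in> Hom E W V. f' \<cdot> u = a \<and> d' \<cdot> u = b"
    "\<And>W u v. u \<in> Hom E W V \<Longrightarrow> v \<in> Hom E W V \<Longrightarrow> f' \<cdot> u = f' \<cdot> v \<Longrightarrow> d' \<cdot> u = d' \<cdot> v \<Longrightarrow> u = v"
    by (rule pullbackE[OF pb H]) blast
  obtain V1 where V1: "d1 \<in> Hom E V1 Y" "f1 \<in> Hom E V1 X" "d \<cdot> f1 = f \<cdot> d1"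
    "\<And>W a b. a \<in> Hom E W X \<Longrightarrow> b \<in> Hom E W Y \<Longrightarrow> d \<cdot> a = f \<cdot> b \<Longrightarrow> \<exists>u \<in> Hom E W V1. f1 \<cdot> u = a \<and> d1 \<cdot> u = b"
    "\<And>W u v. u \<in> Hom E W V1 \<Longrightarrow> v \<in> Hom E W V1 \<Longrightarrow> f1 \<cdot> u = f1 \<cdot> v \<Longrightarrow> d1 \<cdot> u = d1 \<cdot> v \<Longrightarrow> u = v"
    by (rule pullbackE[OF 1(1) H]) blast
  obtain u where u: "u \<in> Hom E V V1" "f1 \<cdot> u = f'" "d1 \<cdot> u = d'" using V1(4)[OF V(2,1,3)] by blast
  obtain v where v: "v \<in> Hom E V1 V" "f' \<cdot> v = f1" "d' \<cdot> v = d1" using V(4)[OF V1(2,1,3)] by blast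
  have "f1 \<cdot> (u \<cdot> v) = f1 \<cdot> Id E V1" "d1 \<cdot> (u \<cdot> v) = d1 \<cdot> Id E V1"
    using u v V1(1,2) by (simp_all add: comp_Id flip: comp_assoc[OF v(1) u(1)])
  then have 2: "u \<cdot> v = Id E V1" using V1(5) comp_in[OF v(1) u(1)] Id_in Hom_Obj[OF u(1)] by blast
  have "f' \<cdot> (v \<cdot> u) = f' \<cdot> Id E V" "d' \<cdot> (v \<cdot> u) = d' \<cdot> Id E V"
    using u v V(1,2) by (simp_all add: comp_Id flip: comp_assoc[OF u(1) v(1)])
  then have 3: "v \<cdot> u = Id E V" using V(5) comp_in[OF u(1) v(1)] Id_in Hom_Obj[OF u(1)] by blast
  have "deflation E u" using iso_deflation is_isoI[OF u(1) v(1) 3 2] by blast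
  then show ?thesis using deflation_comp[OF _ 1(2)] u V1(1) by (auto simp: Hom_def)
qed

text \<open>The arrow to a zero object is the cokernel of \<open>Id E X\<close>, an
  inflation.\<close>

lemma zero_deflation:
  assumes "Id E Z = Zero E Z Z" "Z \<in> Obj E" "X \<in> Obj E"
  shows "deflation E (Zero E X Z)"
proof -
  note X = Id_in[OF assms(3)] and 0 = Zero_in[OF assms(3,2)]
  have "is_cokernel E (Id E X) (Zero E X Z)"
  proof (rule cokernelI[OF X 0])
    show "Zero E X Z \<cdot> Id E X = Zero E X Z" using comp_Id[OF 0] .
  next
    fix W h assume h: "h \<in> Hom E X W" "h \<cdot> Id E X = Zero E X W"
    then have "h = Zero E X W" using comp_Id by simp
    then show "\<exists>u\<in>Hom E Z W. u \<cdot> Zero E X Z = h"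
      using Zero_in comp_Zero assms Hom_Obj[OF h(1)] by metis
  next
    fix W u assume "u \<in> Hom E Z W"
    then show "u = Zero E Z W" using zero_object_Hom[OF assms(1)] by blast
  qed
  then show ?thesis using confl_of_inflation_cokernel Id_inflation assms unfolding deflation_def by blast
qed

lemma zero_inflation:
  assumes "Id E Z = Zero E Z Z" "Z \<in> Obj E" "X \<in> Obj E"
  shows "inflation E (Zero E Z X)"
proof -
  note X = Id_in[OF assms(3)] and 0 = Zero_in[OF assms(2,3)]
  have "is_kernel E (Zero E Z X) (Id E X)"
  proof (rule kernelI[OF 0 X])
    show "Id E X \<cdot> Zero E Z X = Zero E Z X" using Id_comp[OF 0] .
  next
    fix W h assume h: "h \<in> Hom E W X" "Id E X \<cdot> h = Zero E W X"
    then have "h = Zero E W X" using Id_comp by simp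
    then show "\<exists>u\<in>Hom E W Z. Zero E Z X \<cdot> u = h"
      using Zero_in comp_Zero[OF 0] assms Hom_Obj[OF h(1)] by metis
  next
    fix W u assume "u \<in> Hom E W Z"
    then show "u = Zero E W Z" using zero_object_Hom[OF assms(1)] by blast
  qed
  then show ?thesis using confl_of_deflation_kernel Id_deflation assms unfolding inflation_def by blast
qed

text \<open>A biproduct is a pullback over a zero object, so \<open>p2\<close> is a pullback of the
  deflation from \<open>X\<close> to zero.\<close>

lemma biproduct_confl:
  assumes b: "biproduct X Y B i1 i2 p1 p2"
  shows "(i1, p2) \<in> Confl E"
proof -
  note H = biproductD[OF b]
  have ob: "X \<in> Obj E" "Y \<in> Obj E" "B \<in> Obj E" using H Hom_Obj by blast+
  obtain Z where Z: "Z \<in> Obj E" "Id E Z = Zero E Z Z" using zero_object_exists by blast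
  have "is_pullback E (Zero E X Z) (Zero E Y Z) p2 p1"
  proof (rule pullbackI[OF Zero_in[OF ob(1) Z(1)] Zero_in[OF ob(2) Z(1)] H(4,3)])
    show "Zero E X Z \<cdot> p1 = Zero E Y Z \<cdot> p2" using Zero_comp H(3,4) Z(1) by simp
  qed (use biproduct_pair[OF b] biproduct_joint_mono[OF b] in blast)+
  then have "deflation E p2" using pullback_deflation zero_deflation Z ob by blast
  then show ?thesis using confl_of_deflation_kernel biproduct_kernel(1)[OF b] by blast
qed

text \<open>A pushout keeps the cokernel: \<open>d'\<close> is induced by \<open>d\<close> on
  \<open>Y\<close> and by zero on \<open>X'\<close>.\<close>

lemma pushout_confl:
  assumes c: "(i, d) \<in> Confl E" and H: "i \<in> Hom E X Y" "f \<in> Hom E X X'"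
    and po: "is_pushout E i f i' f'" "inflation E i'"
  shows "\<exists>d'. (i', d') \<in> Confl E \<and> d' \<cdot> f' = d"
proof -
  obtain X0 Y0 Z where "i \<in> Hom E X0 Y0" "d \<in> Hom E Y0 Z" using conflE[OF c] by metis
  then have d: "d \<in> Hom E Y Z" using H by (auto simp: Hom_def)
  note co = confl_cokernel[OF c]
  obtain V where V: "i' \<in> Hom E X' V" "f' \<in> Hom E Y V" "f' \<cdot> i = i' \<cdot> f"
    "\<And>W a b. a \<in> Hom E Y W \<Longrightarrow> b \<in> Hom E X' W \<Longrightarrow> a \<cdot> i = b \<cdot> f \<Longrightarrow> \<exists>u \<in> Hom E V W. u \<cdot> f' = a \<and> u \<cdot> i' = b"
    "\<And>W u v. u \<in> Hom E V W \<Longrightarrow> v \<in> Hom E V W \<Longrightarrow> u \<cdot> f' = v \<cdot> f' \<Longrightarrow> u \<cdot> i' = v \<cdot> i' \<Longrightarrow> u = v"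
    by (rule pushoutE[OF po(1) H]) blast
  have ob: "Z \<in> Obj E" "X' \<in> Obj E" using d H Hom_Obj by blast+
  obtain d' where d': "d' \<in> Hom E V Z" "d' \<cdot> f' = d" "d' \<cdot> i' = Zero E X' Z"
    using V(4)[OF d, of "Zero E X' Z"] Zero_in[OF ob(2,1)] cokernel_zero[OF co H(1) d] Zero_comp[OF H(2) ob(1)] by metis
  have "is_cokernel E i' d'"
  proof (rule cokernelI[OF V(1) d'(1,3)])
    fix W h assume h: "h \<in> Hom E V W" "h \<cdot> i' = Zero E X' W"
    have W: "W \<in> Obj E" using Hom_Obj h by blast
    have "(h \<cdot> f') \<cdot> i = h \<cdot> (f' \<cdot> i)" using comp_assoc H V(2) h(1) by blast
    also have "\<dots> = (h \<cdot> i') \<cdot> f" unfolding V(3) using comp_assoc[OF H(2) V(1) h(1)] by simp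
    also have "\<dots> = Zero E X W" unfolding h(2) using Zero_comp H(2) W by blast
    finally obtain u where u: "u \<in> Hom E Z W" "u \<cdot> d = h \<cdot> f'"
      using cokernel_lift[OF co H(1) d] comp_in[OF V(2) h(1)] by blast
    have "(u \<cdot> d') \<cdot> f' = h \<cdot> f'" using comp_assoc[OF V(2) d'(1) u(1)] d'(2) u(2) by simp
    moreover have "(u \<cdot> d') \<cdot> i' = h \<cdot> i'"
      using comp_assoc[OF V(1) d'(1) u(1)] d'(3) h(2) comp_Zero[OF u(1) ob(2)] by simp
    ultimately have "u \<cdot> d' = h" using V(5) comp_in[OF d'(1) u(1)] h(1) by blast
    then show "\<exists>u \<in> Hom E Z W. u \<cdot> d' = h" using u(1) by blast
  next
    fix W u assume u: "u \<in> Hom E Z W" "u \<cdot> d' = Zero E V W"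
    have "u \<cdot> d = (u \<cdot> d') \<cdot> f'" using comp_assoc[OF V(2) d'(1) u(1)] d'(2) by simp
    also have "\<dots> = Zero E Y W" unfolding u(2) using Zero_comp[OF V(2)] Hom_Obj[OF u(1)] by blast
    finally show "u = Zero E Z W"
      using cokernel_epi[OF co d u(1)] Zero_in Zero_comp[OF d] Hom_Obj[OF u(1)] by metis
  qed
  then show ?thesis using confl_of_inflation_cokernel po(2) d'(2) by blast
qed

text \<open>Since \<open>e\<close> is the cokernel of \<open>m\<close>, the pushout of
  \<open>e\<close> along \<open>v\<close> has the universal property of the cokernel of
  \<open>v \<cdot> m\<close>, and this composite is an inflation. Thus deflations are stable under
  pushout along inflations, which is not among the axioms.\<close>

lemma pushout_deflation:
  assumes c: "(m, e) \<in> Confl E" and H: "m \<in> Hom E M L" "e \<in> Hom E L K" "v \<in> Hom E L A" "inflation E v"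
    and po: "is_pushout E v e v' e'"
  shows "(v \<cdot> m, e') \<in> Confl E"
proof -
  note co = confl_cokernel[OF c]
  have "inflation E m" using c unfolding inflation_def by blast
  from inflation_comp[OF this H(4)] have inf: "inflation E (v \<cdot> m)" using H by (simp add: Hom_def)
  have def: "deflation E e" using c unfolding deflation_def by blast
  obtain V where V: "v' \<in> Hom E K V" "e' \<in> Hom E A V" "e' \<cdot> v = v' \<cdot> e"
    "\<And>W a b. a \<in> Hom E A W \<Longrightarrow> b \<in> Hom E K W \<Longrightarrow> a \<cdot> v = b \<cdot> e \<Longrightarrow> \<exists>u \<in> Hom E V W. u \<cdot> e' = a \<and> u \<cdot> v' = b"
    "\<And>W u w. u \<in> Hom E V W \<Longrightarrow> w \<in> Hom E V W \<Longrightarrow> u \<cdot> e' = w \<cdot> e' \<Longrightarrow> u \<cdot> v' = w \<cdot> v' \<Longrightarrow> u = w"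
    by (rule pushoutE[OF po H(3,2)]) blast
  have M: "M \<in> Obj E" using Hom_Obj H by blast
  have "e' \<cdot> (v \<cdot> m) = v' \<cdot> (e \<cdot> m)" using comp_assoc[OF H(1,3) V(2)] comp_assoc[OF H(1,2) V(1)] V(3) by simp
  also have "\<dots> = Zero E M V" using cokernel_zero[OF co H(1,2)] comp_Zero[OF V(1) M] by simp
  finally have z: "e' \<cdot> (v \<cdot> m) = Zero E M V" .
  have "is_cokernel E (v \<cdot> m) e'"
  proof (rule cokernelI[OF comp_in[OF H(1,3)] V(2) z])
    fix W h assume h: "h \<in> Hom E A W" "h \<cdot> (v \<cdot> m) = Zero E M W"
    then have "(h \<cdot> v) \<cdot> m = Zero E M W" using comp_assoc[OF H(1,3) h(1)] by simp
    then obtain k where "k \<in> Hom E K W" "k \<cdot> e = h \<cdot> v"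
      using cokernel_lift[OF co H(1,2)] comp_in[OF H(3) h(1)] by blast
    then show "\<exists>u \<in> Hom E V W. u \<cdot> e' = h" using V(4) h(1) by metis
  next
    fix W u assume u: "u \<in> Hom E V W" "u \<cdot> e' = Zero E A W"
    have W: "W \<in> Obj E" "V \<in> Obj E" using Hom_Obj u(1) by blast+
    have "(u \<cdot> v') \<cdot> e = (u \<cdot> e') \<cdot> v" using comp_assoc[OF H(2) V(1) u(1)] comp_assoc[OF H(3) V(2) u(1)] V(3) by simp
    also have "\<dots> = Zero E K W \<cdot> e" unfolding u(2) using Zero_comp H(2,3) W(1) by simp
    finally have "u \<cdot> v' = Zero E K W"
      using deflation_epi[OF def H(2)] comp_in[OF V(1) u(1)] Zero_in W(1) Hom_Obj[OF H(2)] by blast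
    then show "u = Zero E V W" using V(5)[OF u(1) Zero_in[OF W(2,1)]] u(2) Zero_comp V(1,2) W by simp
  qed
  then show ?thesis using confl_of_inflation_cokernel inf by blast
qed

text \<open>Weak idempotent completeness supplies the kernel of \<open>g\<close>: the pullback of \<open>g \<cdot> f\<close> along \<open>g\<close>
  projects to \<open>A\<close> as a split epimorphism, and \<open>g\<close> has the same kernel as that projection.\<close>

lemma deflation_cancel:
  assumes wic: "weakly_idempotent_complete E" and H: "f \<in> Hom E A B" "g \<in> Hom E B D"
    and df: "deflation E f" and dgf: "deflation E (g \<cdot> f)"
  shows "deflation E g"
proof -
  have gf: "g \<cdot> f \<in> Hom E A D" using comp_in H by blast
  have ob: "A \<in> Obj E" "B \<in> Obj E" "D \<in> Obj E" using Hom_Obj H by blast+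
  obtain y x where pb: "is_pullback E (g \<cdot> f) g y x"
    using deflation_pullback[OF dgf, of g] H gf by (auto simp: Hom_def)
  obtain V where V: "y \<in> Hom E V B" "x \<in> Hom E V A" "(g \<cdot> f) \<cdot> x = g \<cdot> y"
    "\<And>W a b. a \<in> Hom E W A \<Longrightarrow> b \<in> Hom E W B \<Longrightarrow> (g \<cdot> f) \<cdot> a = g \<cdot> b \<Longrightarrow> \<exists>u \<in> Hom E W V. x \<cdot> u = a \<and> y \<cdot> u = b"
    "\<And>W u v. u \<in> Hom E W V \<Longrightarrow> v \<in> Hom E W V \<Longrightarrow> x \<cdot> u = x \<cdot> v \<Longrightarrow> y \<cdot> u = y \<cdot> v \<Longrightarrow> u = v"
    by (rule pullbackE[OF pb gf H(2)]) blast
  \<comment> \<open>The pair of \<open>Id E A\<close> and \<open>f\<close> lies in the pullback and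
    splits \<open>x\<close>.\<close>
  obtain s where s: "s \<in> Hom E A V" "x \<cdot> s = Id E A" "y \<cdot> s = f"
    using V(4)[OF Id_in[OF ob(1)] H(1)] comp_Id[OF gf] by blast
  obtain K t c where b: "biproduct A K V s t x c" using retract_biproduct[OF wic s(1) V(2) s(2)] by blast
  have t: "t \<in> Hom E K V" using biproductD[OF b] by blast
  have kt: "is_kernel E t x" using biproduct_kernel(1)[OF biproduct_commute[OF b]] .
  have xt: "x \<cdot> t = Zero E K A" using kernel_zero[OF kt t V(2)] .
  define k where "k = y \<cdot> t"
  have k: "k \<in> Hom E K B" unfolding k_def using comp_in t V by blast
  have K: "K \<in> Obj E" using Hom_Obj k by blast
  have "g \<cdot> k = (g \<cdot> y) \<cdot> t" unfolding k_def using comp_assoc[OF t V(1) H(2)] by simp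
  also have "\<dots> = (g \<cdot> f) \<cdot> (x \<cdot> t)" unfolding V(3)[symmetric] using comp_assoc[OF t V(2) gf] by simp
  also have "\<dots> = Zero E K D" unfolding xt using comp_Zero gf K by simp
  finally have gk: "g \<cdot> k = Zero E K D" .
  have kg: "is_kernel E k g"
  proof (rule kernelI[OF k H(2) gk])
    fix W h assume h: "h \<in> Hom E W B" "g \<cdot> h = Zero E W D"
    have W: "W \<in> Obj E" using Hom_Obj h by blast
    obtain u where u: "u \<in> Hom E W V" "x \<cdot> u = Zero E W A" "y \<cdot> u = h"
      using V(4)[OF Zero_in[OF W ob(1)] h(1)] h(2) comp_Zero[OF gf W] by auto
    obtain w where w: "w \<in> Hom E W K" "t \<cdot> w = u" using kernel_lift[OF kt t V(2) u(1,2)] by blast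
    have "k \<cdot> w = h" unfolding k_def using comp_assoc[OF w(1) t V(1)] w(2) u(3) by simp
    then show "\<exists>u \<in> Hom E W K. k \<cdot> u = h" using w(1) by blast
  next
    fix W u assume u: "u \<in> Hom E W K" "k \<cdot> u = Zero E W B"
    have W: "W \<in> Obj E" "V \<in> Obj E" using Hom_Obj u V by blast+
    have "x \<cdot> (t \<cdot> u) = Zero E W A" using comp_assoc[OF u(1) t V(2)] xt Zero_comp[OF u(1) ob(1)] by simp
    moreover have "y \<cdot> (t \<cdot> u) = Zero E W B" using u(2) comp_assoc[OF u(1) t V(1)] unfolding k_def by simp
    ultimately have "t \<cdot> u = Zero E W V"
      using V(5)[OF comp_in[OF u(1) t] Zero_in[OF W]] comp_Zero[OF V(1) W(1)] comp_Zero[OF V(2) W(1)] by simp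
    then show "u = Zero E W K" using kernel_mono[OF kt t u(1)] Zero_in[OF W(1) K] comp_Zero[OF t W(1)] by simp
  qed
  \<comment> \<open>It remains to see that \<open>k\<close> is an inflation with cokernel
    \<open>g\<close>. The pullback of \<open>f\<close> along \<open>k\<close> turns out to be the
    kernel of the deflation \<open>g \<cdot> f\<close>, so its leg \<open>l\<close> is an
    inflation.\<close>
  obtain e l where pb': "is_pullback E f k e l" and e_def: "deflation E e"
    using deflation_pullback[OF df, of k] H k by (auto simp: Hom_def)
  obtain L where L: "e \<in> Hom E L K" "l \<in> Hom E L A" "f \<cdot> l = k \<cdot> e"
    "\<And>W a b. a \<in> Hom E W A \<Longrightarrow> b \<in> Hom E W K \<Longrightarrow> f \<cdot> a = k \<cdot> b \<Longrightarrow> \<exists>u \<in> Hom E W L. l \<cdot> u = a \<and> e \<cdot> u = b"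
    "\<And>W u v. u \<in> Hom E W L \<Longrightarrow> v \<in> Hom E W L \<Longrightarrow> l \<cdot> u = l \<cdot> v \<Longrightarrow> e \<cdot> u = e \<cdot> v \<Longrightarrow> u = v"
    by (rule pullbackE[OF pb' H(1) k]) blast
  have Lo: "L \<in> Obj E" using Hom_Obj L by blast
  have "(g \<cdot> f) \<cdot> l = (g \<cdot> k) \<cdot> e" using comp_assoc[OF L(2) H] comp_assoc[OF L(1) k H(2)] L(3) by simp
  also have "\<dots> = Zero E L D" unfolding gk using Zero_comp[OF L(1) ob(3)] .
  finally have gfl: "(g \<cdot> f) \<cdot> l = Zero E L D" .
  have mono_l: "u = Zero E W L" if u: "u \<in> Hom E W L" "l \<cdot> u = Zero E W A" for W u
  proof -
    have W: "W \<in> Obj E" using Hom_Obj u by blast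
    have eu: "e \<cdot> u \<in> Hom E W K" using comp_in u L by blast
    have "k \<cdot> (e \<cdot> u) = f \<cdot> (l \<cdot> u)" using comp_assoc[OF u(1) L(1) k] comp_assoc[OF u(1) L(2) H(1)] L(3) by simp
    also have "\<dots> = k \<cdot> Zero E W K" unfolding u(2) using comp_Zero H(1) k W by metis
    finally have "e \<cdot> u = Zero E W K" using kernel_mono[OF kg k eu] Zero_in[OF W K] by blast
    then show ?thesis using L(5)[OF u(1) Zero_in[OF W Lo]] u(2) comp_Zero[OF L(1) W] comp_Zero[OF L(2) W] by simp
  qed
  have kl: "is_kernel E l (g \<cdot> f)"
  proof (rule kernelI[OF L(2) gf gfl _ mono_l])
    fix W h assume h: "h \<in> Hom E W A" "(g \<cdot> f) \<cdot> h = Zero E W D"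
    then have "g \<cdot> (f \<cdot> h) = Zero E W D" using comp_assoc[OF h(1) H] by simp
    then obtain w where "w \<in> Hom E W K" "k \<cdot> w = f \<cdot> h"
      using kernel_lift[OF kg k H(2)] comp_in[OF h(1) H(1)] by blast
    then show "\<exists>u \<in> Hom E W L. l \<cdot> u = h" using L(4)[OF h(1)] by metis
  qed
  have l_inf: "inflation E l" using confl_of_deflation_kernel[OF dgf kl] unfolding inflation_def by blast
  obtain m M where m: "m \<in> Hom E M L" "(m, e) \<in> Confl E" "is_kernel E m e" "is_cokernel E m e" "inflation E m"
    using deflationE[OF e_def L(1)] by metis
  have M: "M \<in> Obj E" using Hom_Obj m by blast
  have "f \<cdot> (l \<cdot> m) = k \<cdot> (e \<cdot> m)" using comp_assoc[OF m(1) L(2) H(1)] comp_assoc[OF m(1) L(1) k] L(3) by simp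
  then have flm: "f \<cdot> (l \<cdot> m) = Zero E M B" using kernel_zero[OF m(3,1) L(1)] comp_Zero[OF k M] by simp
  have "is_kernel E (l \<cdot> m) f"
  proof (rule kernelI[OF comp_in[OF m(1) L(2)] H(1) flm])
    fix W h assume h: "h \<in> Hom E W A" "f \<cdot> h = Zero E W B"
    have W: "W \<in> Obj E" using Hom_Obj h by blast
    obtain u where u: "u \<in> Hom E W L" "l \<cdot> u = h" "e \<cdot> u = Zero E W K"
      using L(4)[OF h(1) Zero_in[OF W K]] h(2) comp_Zero[OF k W] by auto
    obtain w where w: "w \<in> Hom E W M" "m \<cdot> w = u" using kernel_lift[OF m(3,1) L(1) u(1,3)] by blast
    have "(l \<cdot> m) \<cdot> w = h" using comp_assoc[OF w(1) m(1) L(2)] w(2) u(2) by simp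
    then show "\<exists>u \<in> Hom E W M. (l \<cdot> m) \<cdot> u = h" using w(1) by blast
  next
    fix W u assume u: "u \<in> Hom E W M" "(l \<cdot> m) \<cdot> u = Zero E W A"
    then have "m \<cdot> u = Zero E W L" using mono_l[OF comp_in[OF u(1) m(1)]] comp_assoc[OF u(1) m(1) L(2)] by simp
    then show "u = Zero E W M"
      using kernel_mono[OF m(3,1) u(1)] Zero_in comp_Zero[OF m(1)] Hom_Obj[OF u(1)] by metis
  qed
  then have cf: "is_cokernel E (l \<cdot> m) f" using confl_of_deflation_kernel[OF df] confl_cokernel by blast
  \<comment> \<open>The pullback square is also a pushout: both \<open>f\<close> and the leg
    \<open>e'\<close> are cokernels of \<open>l \<cdot> m\<close>. Hence \<open>k\<close> is, up to
    an isomorphism, a pushout of the inflation \<open>l\<close>.\<close>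
  obtain l' e' where po: "is_pushout E l e l' e'" "inflation E l'"
    using inflation_pushout[OF l_inf, of e] L by (auto simp: Hom_def)
  obtain Z where Z: "l' \<in> Hom E K Z" "e' \<in> Hom E A Z" "e' \<cdot> l = l' \<cdot> e"
    by (rule pushoutE[OF po(1) L(2,1)]) blast
  have ce: "is_cokernel E (l \<cdot> m) e'" using pushout_deflation[OF m(2,1) L(1,2) l_inf po(1)] confl_cokernel by blast
  obtain a where a: "a \<in> Hom E Z B" "is_iso E a" "a \<cdot> e' = f" using cokernel_unique[OF ce cf Z(2) H(1)] by blast
  have "(a \<cdot> l') \<cdot> e = (a \<cdot> e') \<cdot> l" using comp_assoc[OF L(1) Z(1) a(1)] comp_assoc[OF L(2) Z(2) a(1)] Z(3) by simp
  then have "(a \<cdot> l') \<cdot> e = k \<cdot> e" using a(3) L(3) by simp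
  then have "a \<cdot> l' = k" using deflation_epi[OF e_def L(1)] comp_in[OF Z(1) a(1)] k by blast
  then have k_inf: "inflation E k" using inflation_comp[OF po(2) iso_inflation[OF a(2)]] Z a by (auto simp: Hom_def)
  have cgf: "is_cokernel E l (g \<cdot> f)" using confl_cokernel confl_of_deflation_kernel[OF dgf kl] by blast
  have "is_cokernel E k g"
  proof (rule cokernelI[OF k H(2) gk])
    fix W h assume h: "h \<in> Hom E B W" "h \<cdot> k = Zero E K W"
    have W: "W \<in> Obj E" using Hom_Obj h by blast
    have "(h \<cdot> f) \<cdot> l = (h \<cdot> k) \<cdot> e" using comp_assoc[OF L(2) H(1) h(1)] comp_assoc[OF L(1) k h(1)] L(3) by simp
    then have "(h \<cdot> f) \<cdot> l = Zero E L W" unfolding h(2) using Zero_comp[OF L(1) W] by simp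
    then obtain u where u: "u \<in> Hom E D W" "u \<cdot> (g \<cdot> f) = h \<cdot> f"
      using cokernel_lift[OF cgf L(2) gf] comp_in[OF H(1) h(1)] by blast
    then have "(u \<cdot> g) \<cdot> f = h \<cdot> f" using comp_assoc[OF H u(1)] by simp
    then have "u \<cdot> g = h" using deflation_epi[OF df H(1)] comp_in[OF H(2) u(1)] h(1) by blast
    then show "\<exists>u \<in> Hom E D W. u \<cdot> g = h" using u(1) by blast
  next
    fix W u assume u: "u \<in> Hom E D W" "u \<cdot> g = Zero E B W"
    have W: "W \<in> Obj E" using Hom_Obj u by blast
    have "u \<cdot> (g \<cdot> f) = Zero E A W" using comp_assoc[OF H u(1)] u(2) Zero_comp[OF H(1) W] by simp
    then show "u = Zero E D W"
      using deflation_epi[OF dgf gf u(1)] Zero_in[OF ob(3) W] Zero_comp[OF gf W] by simp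
  qed
  then show ?thesis using confl_of_inflation_cokernel[OF k_inf] unfolding deflation_def by blast
qed

section \<open>Splitting of conflations\<close>

lemma section_imp_retraction:
  assumes c: "(i, d) \<in> Confl E" and H: "i \<in> Hom E X Y" "d \<in> Hom E Y Z" and s: "s \<in> Hom E Z Y" "d \<cdot> s = Id E Z"
  shows "\<exists>r \<in> Hom E Y X. r \<cdot> i = Id E X"
proof -
  note k = confl_kernel[OF c]
  have ob: "X \<in> Obj E" "Y \<in> Obj E" "Z \<in> Obj E" using Hom_Obj H by blast+
  have di: "d \<cdot> i = Zero E X Z" using kernel_zero[OF k H] .
  \<comment> \<open>\<open>h\<close> stands for \<open>Id - s \<cdot> d\<close>. It is killed by
    \<open>d\<close>, and its factorisation through the kernel \<open>i\<close> is the
    retraction.\<close>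
  obtain h where h: "h \<in> Hom E Y Y" "Id E Y = Plus E (s \<cdot> d) h"
    using diff_exists[OF Id_in[OF ob(2)] comp_in[OF H(2) s(1)]] by blast
  have "d = d \<cdot> Plus E (s \<cdot> d) h" using comp_Id[OF H(2)] h(2) by simp
  also have "\<dots> = Plus E d (d \<cdot> h)" using comp_eq_assoc[OF s(2,1) H(2), of d] s(1) H h(1) by (simp add: add_simps)
  finally have "d \<cdot> h = Zero E Y Z" using Plus_cancel_Zero[OF H(2)] comp_in[OF h(1) H(2)] by metis
  then obtain r where r: "r \<in> Hom E Y X" "i \<cdot> r = h" using kernel_lift[OF k H h(1)] by blast
  have "i = Plus E (s \<cdot> d) h \<cdot> i" using Id_comp[OF H(1)] h(2) by simp
  also have "\<dots> = Plus E (s \<cdot> (d \<cdot> i)) (h \<cdot> i)" using s(1) H h(1) by (simp add: add_simps)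
  also have "\<dots> = h \<cdot> i" unfolding di using s(1) H h(1) ob by (simp add: add_simps)
  finally have "i \<cdot> (r \<cdot> i) = i \<cdot> Id E X" using comp_assoc[OF H(1) r(1) H(1)] r(2) comp_Id[OF H(1)] by simp
  then have "r \<cdot> i = Id E X" using kernel_mono[OF k H(1)] comp_in[OF H(1) r(1)] Id_in[OF ob(1)] by blast
  then show ?thesis using r(1) by blast
qed

lemma retraction_imp_section:
  assumes c: "(i, d) \<in> Confl E" and H: "i \<in> Hom E X Y" "d \<in> Hom E Y Z" and r: "r \<in> Hom E Y X" "r \<cdot> i = Id E X"
  shows "\<exists>s \<in> Hom E Z Y. d \<cdot> s = Id E Z"
proof -
  note k = confl_cokernel[OF c]
  have ob: "X \<in> Obj E" "Y \<in> Obj E" "Z \<in> Obj E" using Hom_Obj H by blast+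
  have di: "d \<cdot> i = Zero E X Z" using cokernel_zero[OF k H] .
  \<comment> \<open>\<open>h\<close> stands for \<open>Id - i \<cdot> r\<close>. It kills
    \<open>i\<close>, and its factorisation through the cokernel \<open>d\<close> is the
    section.\<close>
  obtain h where h: "h \<in> Hom E Y Y" "Id E Y = Plus E (i \<cdot> r) h"
    using diff_exists[OF Id_in[OF ob(2)] comp_in[OF r(1) H(1)]] by blast
  have "i = Plus E (i \<cdot> r) h \<cdot> i" using Id_comp[OF H(1)] h(2) by simp
  also have "\<dots> = Plus E i (h \<cdot> i)" using r H h(1) by (simp add: add_simps)
  finally have "h \<cdot> i = Zero E X Y" using Plus_cancel_Zero[OF H(1)] comp_in[OF H(1) h(1)] by metis
  then obtain s where s: "s \<in> Hom E Z Y" "s \<cdot> d = h" using cokernel_lift[OF k H h(1)] by blast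
  have "d = d \<cdot> Plus E (i \<cdot> r) h" using comp_Id[OF H(2)] h(2) by simp
  also have "\<dots> = Plus E (d \<cdot> (i \<cdot> r)) (d \<cdot> h)" using r(1) H h(1) by (simp add: add_simps)
  also have "\<dots> = d \<cdot> h" using comp_eq_assoc[OF di H, of r] r(1) H h(1) ob by (simp add: add_simps)
  finally have "(d \<cdot> s) \<cdot> d = Id E Z \<cdot> d" using comp_assoc[OF H(2) s(1) H(2)] s(2) Id_comp[OF H(2)] by simp
  then have "d \<cdot> s = Id E Z" using cokernel_epi[OF k H(2)] comp_in[OF s(1) H(2)] Id_in[OF ob(3)] by blast
  then show ?thesis using s(1) by blast
qed

text \<open>The elementary form of \<open>Ext^1(U, X) = 0\<close>, free of equivalence classes;
  \<open>Ext_zero_one_iff\<close> identifies the two.\<close>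

definition all_split :: "'o \<Rightarrow> 'o \<Rightarrow> bool" where
  "all_split U X \<longleftrightarrow> (\<forall>(i, d) \<in> Confl E. Dom E i = X \<and> Cod E d = U \<longrightarrow> (\<exists>r \<in> Hom E (Cod E i) X. r \<cdot> i = Id E X))"

text \<open>The obstruction to extending \<open>v\<close> is the pushout of the conflation along
  \<open>v\<close>. It starts at \<open>X\<close> and still ends at \<open>U\<close>, hence splits,
  and its retraction composed with \<open>M -> V\<close> extends \<open>v\<close>.\<close>

lemma all_split_extend:
  assumes sp: "all_split U X" and c: "(j, h) \<in> Confl E" and H: "j \<in> Hom E D M" "h \<in> Hom E M U" "v \<in> Hom E D X"
  shows "\<exists>x \<in> Hom E M X. x \<cdot> j = v"
proof -
  have j: "inflation E j" using c unfolding inflation_def by blast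
  obtain j' v' where po: "is_pushout E j v j' v'" "inflation E j'"
    using inflation_pushout[OF j, of v] H by (auto simp: Hom_def)
  obtain V where V: "j' \<in> Hom E X V" "v' \<in> Hom E M V" "v' \<cdot> j = j' \<cdot> v"
    by (rule pushoutE[OF po(1) H(1,3)]) blast
  obtain d' where d': "(j', d') \<in> Confl E" "d' \<cdot> v' = h" using pushout_confl[OF c H(1,3) po] by blast
  obtain A B where AB: "j' \<in> Hom E A B" "d' \<in> Hom E B (Cod E d')" using conflE[OF d'(1)] by (auto simp: Hom_def)
  have "Cod E (d' \<cdot> v') = Cod E d'" using AB V by (auto simp: Hom_def Cod_comp)
  then have "Cod E d' = U" using d'(2) H(2) by (simp add: Hom_def)
  then obtain r where r: "r \<in> Hom E V X" "r \<cdot> j' = Id E X"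
    using sp d'(1) V(1) unfolding all_split_def by (fastforce simp: Hom_def)
  have "(r \<cdot> v') \<cdot> j = (r \<cdot> j') \<cdot> v" using comp_assoc[OF H(1) V(2) r(1)] comp_assoc[OF H(3) V(1) r(1)] V(3) by simp
  then show ?thesis using r(2) Id_comp[OF H(3)] comp_in[OF V(2) r(1)] by auto
qed

end

section \<open>First extension groups\<close>

text \<open>Nonemptiness has to be recorded because the quotient of the empty set is not a
  singleton; later a split extension supplies it.\<close>

lemma Ext_zero_iff:
  "Ext_zero E n X Y \<longleftrightarrow> extensions E n X Y \<noteq> {} \<and>
    (\<forall>\<xi> \<in> extensions E n X Y. \<forall>\<eta> \<in> extensions E n X Y. equivclp (extension_morphism E n X Y) \<xi> \<eta>)"
    (is "_ \<longleftrightarrow> ?A \<noteq> {} \<and> (\<forall>\<xi> \<in> ?A. \<forall>\<eta> \<in> ?A. ?r \<xi> \<eta>)")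
proof -
  let ?R = "{(\<xi>, \<eta>). \<xi> \<in> ?A \<and> \<eta> \<in> ?A \<and> ?r \<xi> \<eta>}"
  have eq: "equiv ?A ?R"
  proof (rule equivI)
    show "sym ?R" by (auto simp: sym_def intro: equivclp_sym)
    show "trans ?R" by (auto simp: trans_def intro: equivclp_trans)
  qed (auto simp: refl_on_def intro: equivclp_refl)
  define R where "R = ?R"
  define A where "A = ?A"
  have eq': "equiv A R" using eq unfolding A_def R_def .
  have "is_singleton (A // R) \<longleftrightarrow> A \<noteq> {} \<and> (\<forall>\<xi> \<in> A. \<forall>\<eta> \<in> A. (\<xi>, \<eta>) \<in> R)"
  proof
    assume "is_singleton (A // R)"
    then obtain c where c: "A // R = {c}" unfolding is_singleton_def by blast
    then have ne: "A \<noteq> {}" by (auto simp: quotient_def)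
    have "(\<xi>, \<eta>) \<in> R" if that: "\<xi> \<in> A" "\<eta> \<in> A" for \<xi> \<eta>
    proof -
      have "R `` {\<xi>} = R `` {\<eta>}" using c quotientI[OF that(1), of R] quotientI[OF that(2), of R] by simp
      then show ?thesis using eq_equiv_class[OF _ eq' that(2)] by blast
    qed
    then show "A \<noteq> {} \<and> (\<forall>\<xi> \<in> A. \<forall>\<eta> \<in> A. (\<xi>, \<eta>) \<in> R)" using ne by blast
  next
    assume h: "A \<noteq> {} \<and> (\<forall>\<xi> \<in> A. \<forall>\<eta> \<in> A. (\<xi>, \<eta>) \<in> R)"
    have "R `` {\<xi>} = A" if "\<xi> \<in> A" for \<xi> using h that unfolding R_def A_def by auto
    then have "A // R = {A}" using h by (auto simp: quotient_def)
    then show "is_singleton (A // R)" by (auto simp: is_singleton_def)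
  qed
  then show ?thesis unfolding Ext_zero_def Ext_def A_def R_def by simp
qed

text \<open>Unlike the indexed form, \<open>successively\<close> decomposes along \<open>@\<close>,
  which is how the end of an extension gets exchanged.\<close>

lemma exact_seq_successively:
  "exact_seq E fs \<longleftrightarrow> (\<forall>f \<in> set fs. admissible E f) \<and> successively (\<lambda>f g. Cod E f = Dom E g \<and> exact_at E f g) fs"
  unfolding exact_seq_def successively_conv_nth by blast

section \<open>Admissible arrows and exactness at one object\<close>

context exact_category
begin

lemma inflation_Arr: "inflation E i \<Longrightarrow> i \<in> Arr E"
  and deflation_Arr: "deflation E d \<Longrightarrow> d \<in> Arr E"
  unfolding inflation_def deflation_def using conflE by (metis (no_types, lifting) Hom_def mem_Collect_eq)+

lemma inflation_admissible:
  assumes "inflation E i"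
  shows "admissible E i"
proof -
  have i: "i \<in> Arr E" using inflation_Arr[OF assms] .
  then have "i = i \<cdot> Id E (Dom E i)" "Cod E (Id E (Dom E i)) = Dom E i" by (simp_all add: add_simps)
  then show ?thesis unfolding admissible_def using assms Id_deflation[of "Dom E i"] Dom_in[OF i] by blast
qed

lemma deflation_admissible:
  assumes "deflation E d"
  shows "admissible E d"
proof -
  have d: "d \<in> Arr E" using deflation_Arr[OF assms] .
  then have "d = Id E (Cod E d) \<cdot> d" "Dom E (Id E (Cod E d)) = Cod E d" by (simp_all add: add_simps)
  then show ?thesis unfolding admissible_def using assms Id_inflation[of "Cod E d"] Cod_in[OF d] by metis
qed

lemma zero_deflation_inflation:
  assumes "X \<in> Obj E" "Y \<in> Obj E"
  obtains Z where "deflation E (Zero E X Z)" "inflation E (Zero E Z Y)" "Zero E X Z \<in> Hom E X Z"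
    "Zero E Z Y \<in> Hom E Z Y" "Zero E Z Y \<cdot> Zero E X Z = Zero E X Y" "Id E Z = Zero E Z Z" "Z \<in> Obj E"
proof -
  obtain Z where Z: "Z \<in> Obj E" "Id E Z = Zero E Z Z" using zero_object_exists by blast
  then show ?thesis
    using that zero_deflation zero_inflation Zero_in assms Zero_comp[OF Zero_in[OF assms(1) Z(1)] assms(2)] by blast
qed

lemma zero_admissible: "X \<in> Obj E \<Longrightarrow> Y \<in> Obj E \<Longrightarrow> admissible E (Zero E X Y)"
  using zero_deflation_inflation[of X Y] unfolding admissible_def by (smt (verit) Cod_Zero Dom_Zero)

lemma exact_atI:
  "\<lbrakk>deflation E d; inflation E i; d \<in> Hom E X Y; i \<in> Hom E Y Z; i \<cdot> d = f; is_kernel E i g\<rbrakk>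
    \<Longrightarrow> exact_at E f g"
  unfolding exact_at_def by (rule exI[of _ i], rule exI[of _ d]) (auto simp: Hom_def)

lemma admissibleI:
  "\<lbrakk>deflation E d; inflation E i; d \<in> Hom E X Y; i \<in> Hom E Y Z; i \<cdot> d = f\<rbrakk> \<Longrightarrow> admissible E f"
  unfolding admissible_def by (rule exI[of _ i], rule exI[of _ d]) (auto simp: Hom_def)

lemma exact_at_deflation_zero:
  assumes "deflation E e" "e \<in> Hom E X Y" "W \<in> Obj E"
  shows "exact_at E e (Zero E Y W)"
proof -
  have Y: "Y \<in> Obj E" using Hom_Obj assms by blast
  have 0: "Zero E Y W \<in> Hom E Y W" using Zero_in Y assms by blast
  have "is_kernel E (Id E Y) (Zero E Y W)"
  proof (rule kernelI[OF Id_in[OF Y] 0 comp_Id[OF 0]])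
    fix V h assume "h \<in> Hom E V Y"
    then show "\<exists>u\<in>Hom E V Y. Id E Y \<cdot> u = h" using Id_comp by blast
  qed (use Id_comp in metis)
  then show ?thesis
    by (rule exact_atI[OF assms(1) Id_inflation[OF Y] assms(2) Id_in[OF Y] Id_comp[OF assms(2)]])
qed

text \<open>The image of a zero arrow is a zero object, which is also the kernel of an
  identity.\<close>

lemma exact_at_zero_Id:
  assumes "X \<in> Obj E" "Y \<in> Obj E"
  shows "exact_at E (Zero E X Y) (Id E Y)"
proof -
  obtain Z where Z: "deflation E (Zero E X Z)" "inflation E (Zero E Z Y)" "Zero E X Z \<in> Hom E X Z"
    "Zero E Z Y \<in> Hom E Z Y" "Zero E Z Y \<cdot> Zero E X Z = Zero E X Y" "Id E Z = Zero E Z Z" "Z \<in> Obj E"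
    using zero_deflation_inflation assms by blast
  have "is_kernel E (Zero E Z Y) (Id E Y)"
  proof (rule kernelI[OF Z(4) Id_in[OF assms(2)] Id_comp[OF Z(4)]])
    fix W h assume h: "h \<in> Hom E W Y" "Id E Y \<cdot> h = Zero E W Y"
    then show "\<exists>u\<in>Hom E W Z. Zero E Z Y \<cdot> u = h"
      using Id_comp[OF h(1)] comp_Zero[OF Z(4)] Zero_in Z(7) Hom_Obj[OF h(1)] by metis
  qed (use zero_object_Hom[OF Z(6)] in blast)
  then show ?thesis by (rule exact_atI[OF Z(1-5)])
qed

text \<open>\<open>exact_at\<close> provides some factorisation \<open>f = i \<cdot> d\<close>. As
  \<open>f\<close> is monic, so is the deflation \<open>d\<close>; it is then an isomorphism, and
  \<open>f\<close> inherits the kernel property of \<open>i\<close>.\<close>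

lemma exact_at_inflation_kernel:
  assumes "exact_at E f g" "inflation E f"
  shows "is_kernel E f g"
proof -
  obtain i d where id: "deflation E d" "inflation E i" "Cod E d = Dom E i" "f = i \<cdot> d" "is_kernel E i g"
    using assms unfolding exact_at_def by blast
  obtain X Y Z where H: "d \<in> Hom E X Y" "i \<in> Hom E Y Z"
    using id deflation_Arr inflation_Arr by (auto simp: Hom_def)
  have f: "f \<in> Hom E X Z" using comp_in H id by blast
  obtain W where g: "g \<in> Hom E Z W" using id(5) H unfolding is_kernel_def by (auto simp: Hom_def)
  have ob: "X \<in> Obj E" "Y \<in> Obj E" "W \<in> Obj E" using Hom_Obj H g by blast+
  have "is_iso E d"
  proof (rule deflation_mono_iso[OF id(1) H(1)])
    fix V u assume u: "u \<in> Hom E V X" "d \<cdot> u = Zero E V Y"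
    then have V: "V \<in> Obj E" using Hom_Obj by blast
    have "f \<cdot> u = f \<cdot> Zero E V X" unfolding id(4) using comp_assoc u H comp_Zero V f id(4) by metis
    then show "u = Zero E V X" using inflation_mono[OF assms(2) f u(1)] Zero_in V ob by blast
  qed
  then obtain b where b: "b \<in> Hom E Y X" "d \<cdot> b = Id E Y" using is_isoE[OF _ H(1)] by metis
  have "g \<cdot> f = Zero E X W" unfolding id(4) using comp_assoc[OF H g] kernel_zero[OF id(5) H(2) g] Zero_comp[OF H(1) ob(3)] by simp
  then show ?thesis
  proof (rule kernelI[OF f g])
    fix V h assume h: "h \<in> Hom E V Z" "g \<cdot> h = Zero E V W"
    then obtain u where u: "u \<in> Hom E V Y" "i \<cdot> u = h" using kernel_lift[OF id(5) H(2) g] by blast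
    have "d \<cdot> (b \<cdot> u) = u" using comp_assoc[OF u(1) b(1) H(1)] b(2) Id_comp[OF u(1)] by simp
    then have "f \<cdot> (b \<cdot> u) = h" unfolding id(4) using comp_assoc[OF comp_in[OF u(1) b(1)] H] u(2) by simp
    then show "\<exists>u\<in>Hom E V X. f \<cdot> u = h" using comp_in[OF u(1) b(1)] by blast
  next
    fix V u assume u: "u \<in> Hom E V X" "f \<cdot> u = Zero E V Z"
    then show "u = Zero E V X"
      using inflation_mono[OF assms(2) f u(1)] Zero_in comp_Zero[OF f] Hom_Obj[OF u(1)] by metis
  qed
qed

lemma kernel_comp_mono:
  assumes H: "e \<in> Hom E X Y" "m \<in> Hom E Y Z" and m: "inflation E m"
  shows "is_kernel E i (m \<cdot> e) \<longleftrightarrow> is_kernel E i e"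
\<comment> \<open>An arrow \<open>i\<close> with another target is a kernel of neither side; only
  for target \<open>X\<close> is there something to compare.\<close>
proof (cases "i \<in> Arr E \<and> Cod E i = X")
  case True
  then obtain K where i: "i \<in> Hom E K X" by (auto simp: Hom_def)
  have ob: "Y \<in> Obj E" using Hom_Obj H by blast
  have z: "(m \<cdot> e) \<cdot> u = Zero E W Z \<longleftrightarrow> e \<cdot> u = Zero E W Y" if u: "u \<in> Hom E W X" for W u
    using inflation_mono[OF m H(2) comp_in[OF u H(1)], of "Zero E W Y"] comp_assoc[OF u H] comp_Zero[OF H(2)]
      Zero_in[OF _ ob] Hom_Obj[OF u] by metis
  have me: "m \<cdot> e \<in> Hom E X Z" using comp_in H by blast
  have D: "Dom E (m \<cdot> e) = X" "Cod E (m \<cdot> e) = Z" "Dom E e = X" "Cod E e = Y" "Dom E i = K" "Cod E i = X" "m \<cdot> e \<in> Arr E" "e \<in> Arr E" "i \<in> Arr E"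
    using me H i by (auto simp: Hom_def)
  show ?thesis unfolding is_kernel_def D by (simp add: z z[OF i] D(7,8) cong: ball_cong)
next
  case False
  have "Dom E (m \<cdot> e) = X" "Dom E e = X" using H by (auto simp: Hom_def Dom_comp)
  then show ?thesis using False unfolding is_kernel_def by auto
qed

text \<open>Exactness before an admissible arrow depends on its deflation part alone, so its
  inflation part may be exchanged or dropped inside an extension.\<close>

lemma exact_at_comp_mono:
  assumes "e \<in> Hom E X Y" "m \<in> Hom E Y Z" "inflation E m"
  shows "exact_at E p (m \<cdot> e) \<longleftrightarrow> exact_at E p e"
  unfolding exact_at_def using kernel_comp_mono[OF assms] by blast

section \<open>Extensions of length one\<close>

lemma extensions_one:
  "[i, d] \<in> extensions E 1 U X \<longleftrightarrow> (i, d) \<in> Confl E \<and> Dom E i = X \<and> Cod E d = U"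
proof
  assume "[i, d] \<in> extensions E 1 U X"
  then have h: "exact_at E i d" "inflation E i" "deflation E d" "Dom E i = X" "Cod E d = U"
    unfolding extensions_def exact_seq_successively by auto
  then show "(i, d) \<in> Confl E \<and> Dom E i = X \<and> Cod E d = U"
    using confl_of_deflation_kernel exact_at_inflation_kernel by blast
next
  assume h: "(i, d) \<in> Confl E \<and> Dom E i = X \<and> Cod E d = U"
  then obtain Y where H: "i \<in> Hom E X Y" "d \<in> Hom E Y U" "is_kernel E i d" "inflation E i" "deflation E d"
    using conflE[of i d] by (auto simp: Hom_def)
  have X: "X \<in> Obj E" using Hom_Obj[OF H(1)] by blast
  have "exact_at E i d" by (rule exact_atI[OF Id_deflation[OF X] H(4) Id_in[OF X] H(1) comp_Id[OF H(1)] H(3)])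
  then show "[i, d] \<in> extensions E 1 U X"
    using H inflation_admissible deflation_admissible
    unfolding extensions_def exact_seq_successively by (auto simp: Hom_def)
qed

lemma extensions_oneE:
  assumes "fs \<in> extensions E 1 U X"
  obtains i d M where "fs = [i, d]" "(i, d) \<in> Confl E" "i \<in> Hom E X M" "d \<in> Hom E M U"
proof -
  have "length fs = 2" using assms unfolding extensions_def by simp
  then obtain i d where fs: "fs = [i, d]"
    by (metis (no_types, opaque_lifting) One_nat_def Suc_1 length_0_conv length_Suc_conv)
  have c: "(i, d) \<in> Confl E \<and> Dom E i = X \<and> Cod E d = U" using assms extensions_one unfolding fs by blast
  then show ?thesis using that fs conflE[of i d] by (auto simp: Hom_def)
qed

lemma extension_morphism_one:
  assumes "[i, d] \<in> extensions E 1 U X" "[j, e] \<in> extensions E 1 U X"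
    and H: "i \<in> Hom E X M" "j \<in> Hom E X N" "d \<in> Hom E M U" "e \<in> Hom E N U"
  shows "extension_morphism E 1 U X [i, d] [j, e] \<longleftrightarrow> (\<exists>a \<in> Hom E M N. a \<cdot> i = j \<and> e \<cdot> a = d)"
proof
  assume "extension_morphism E 1 U X [i, d] [j, e]"
  then obtain a where a: "a 0 = Id E X" "a (Suc 1) = Id E U"
     "\<forall>k\<le>1. a k \<in> Hom E (Dom E ([i, d] ! k)) (Dom E ([j, e] ! k))"
     "\<forall>k\<le>1. ([j, e] ! k) \<cdot> a k = a (Suc k) \<cdot> ([i, d] ! k)"
    unfolding extension_morphism_def by blast
  have "a 1 \<in> Hom E M N" using a(3)[rule_format, of 1] H by (auto simp: Hom_def)
  moreover have "a 1 \<cdot> i = j" using a(4)[rule_format, of 0] a(1) comp_Id[OF H(2)] by simp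
  moreover have "e \<cdot> a 1 = d" using a(4)[rule_format, of 1] a(2) Id_comp[OF H(3)] by simp
  ultimately show "\<exists>a \<in> Hom E M N. a \<cdot> i = j \<and> e \<cdot> a = d" by blast
next
  assume "\<exists>a \<in> Hom E M N. a \<cdot> i = j \<and> e \<cdot> a = d"
  then obtain a where a: "a \<in> Hom E M N" "a \<cdot> i = j" "e \<cdot> a = d" by blast
  let ?a = "\<lambda>k::nat. if k = 0 then Id E X else if k = 1 then a else Id E U"
  have X: "X \<in> Obj E" using Hom_Obj H by blast
  have "\<forall>k\<le>1. ?a k \<in> Hom E (Dom E ([i, d] ! k)) (Dom E ([j, e] ! k))"
    using a H Id_in[OF X] by (auto simp: le_Suc_eq Hom_def)
  moreover have "\<forall>k\<le>1. ([j, e] ! k) \<cdot> ?a k = ?a (Suc k) \<cdot> ([i, d] ! k)"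
    using a comp_Id[OF H(2)] Id_comp[OF H(3)] by (auto simp: le_Suc_eq)
  moreover have "?a 0 = Id E X" "?a (Suc 1) = Id E U" by auto
  ultimately show "extension_morphism E 1 U X [i, d] [j, e]"
    unfolding extension_morphism_def using assms(1,2) by (intro conjI exI[of _ ?a])
qed

text \<open>Being split is invariant along zigzags, and the biproduct extension is split.
  Conversely, a split extension maps to the biproduct by the pair of its retraction and its
  deflation.\<close>

lemma Ext_zero_one_iff:
  assumes ob: "U \<in> Obj E" "X \<in> Obj E"
  shows "Ext_zero E 1 U X \<longleftrightarrow> all_split U X"
proof -
  obtain B i1 i2 p1 p2 where b: "biproduct X U B i1 i2 p1 p2" using biproduct_exists[OF ob(2,1)] by blast
  note B = biproductD[OF b]
  have triv: "[i1, p2] \<in> extensions E 1 U X"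
    using extensions_one biproduct_confl[OF b] B by (auto simp: Hom_def)
  define sp where "sp fs \<longleftrightarrow> (\<exists>r \<in> Hom E (Cod E (hd fs)) X. r \<cdot> hd fs = Id E X)" for fs
  have sp_mor: "sp \<xi> \<longleftrightarrow> sp \<eta>" if m: "extension_morphism E 1 U X \<xi> \<eta>" for \<xi> \<eta>
  proof -
    have ext: "\<xi> \<in> extensions E 1 U X" "\<eta> \<in> extensions E 1 U X" using m unfolding extension_morphism_def by auto
    obtain i d M where x: "\<xi> = [i, d]" "(i, d) \<in> Confl E" "i \<in> Hom E X M" "d \<in> Hom E M U" using extensions_oneE[OF ext(1)] by blast
    obtain j e N where y: "\<eta> = [j, e]" "(j, e) \<in> Confl E" "j \<in> Hom E X N" "e \<in> Hom E N U" using extensions_oneE[OF ext(2)] by blast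
    obtain a where a: "a \<in> Hom E M N" "a \<cdot> i = j" "e \<cdot> a = d"
      using m extension_morphism_one[of i d U X j e M N] ext x y by blast
    have C: "Cod E i = M" "Cod E j = N" using x y by (auto simp: Hom_def)
    show ?thesis
    proof
      \<comment> \<open>A retraction cannot be pushed forward along \<open>a\<close> but a section
        can, hence the passage through \<open>s\<close>.\<close>
      assume "sp \<xi>"
      then obtain r where "r \<in> Hom E M X" "r \<cdot> i = Id E X" unfolding sp_def x(1) using C by auto
      then obtain s where s: "s \<in> Hom E U M" "d \<cdot> s = Id E U" using retraction_imp_section[OF x(2-4)] by blast
      have "e \<cdot> (a \<cdot> s) = Id E U" using comp_assoc[OF s(1) a(1) y(4)] a(3) s(2) by simp
      then show "sp \<eta>" using section_imp_retraction[OF y(2-4) comp_in[OF s(1) a(1)]] unfolding sp_def y(1) by (simp add: C)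
    next
      assume "sp \<eta>"
      then obtain r where r: "r \<in> Hom E N X" "r \<cdot> j = Id E X" unfolding sp_def y(1) using C by auto
      have "(r \<cdot> a) \<cdot> i = Id E X" using comp_assoc[OF x(3) a(1) r(1)] a(2) r(2) by simp
      then show "sp \<xi>" using comp_in[OF a(1) r(1)] unfolding sp_def x(1) by (auto simp: C)
    qed
  qed
  have sp_triv: "sp [i1, p2]" unfolding sp_def using B by (auto simp: Hom_def)
  show ?thesis
  proof
    assume "Ext_zero E 1 U X"
    then have eqv: "equivclp (extension_morphism E 1 U X) [i1, p2] \<eta>" if "\<eta> \<in> extensions E 1 U X" for \<eta>
      unfolding Ext_zero_iff using triv that by blast
    have all: "sp \<eta>" if "equivclp (extension_morphism E 1 U X) [i1, p2] \<eta>" for \<eta>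
      using that
    proof (induction rule: equivclp_induct)
      case base show ?case using sp_triv .
    next
      case (step y z) then show ?case using sp_mor by blast
    qed
    show "all_split U X" unfolding all_split_def
    proof (clarify)
      fix i d assume c: "(i, d) \<in> Confl E" "X = Dom E i" "U = Cod E d"
      then have "[i, d] \<in> extensions E 1 U X" using extensions_one by blast
      from all[OF eqv[OF this]] show "\<exists>r\<in>Hom E (Cod E i) (Dom E i). r \<cdot> i = Id E (Dom E i)" unfolding sp_def c(2) by simp
    qed
  next
    assume sp: "all_split U X"
    have tomor: "extension_morphism E 1 U X \<eta> [i1, p2]" if ext: "\<eta> \<in> extensions E 1 U X" for \<eta>
    proof -
      obtain j e N where y: "\<eta> = [j, e]" "(j, e) \<in> Confl E" "j \<in> Hom E X N" "e \<in> Hom E N U" using extensions_oneE[OF ext] by blast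
      then obtain r where r: "r \<in> Hom E N X" "r \<cdot> j = Id E X" using sp unfolding all_split_def by (fastforce simp: Hom_def)
      obtain a where a: "a \<in> Hom E N B" "p1 \<cdot> a = r" "p2 \<cdot> a = e" using biproduct_pair[OF b r(1) y(4)] by blast
      have ej: "e \<cdot> j = Zero E X U" using kernel_zero[OF confl_kernel[OF y(2)] y(3,4)] .
      \<comment> \<open>\<open>h\<close> is the difference of \<open>a \<cdot> j\<close> and
        \<open>i1\<close>; both projections kill it.\<close>
      obtain h where h: "h \<in> Hom E X B" "a \<cdot> j = Plus E i1 h" using diff_exists[OF comp_in[OF y(3) a(1)] B(1)] by blast
      have "Plus E (p1 \<cdot> i1) (p1 \<cdot> h) = r \<cdot> j" using comp_Plus[OF B(1) h(1) B(3)] h(2) comp_assoc[OF y(3) a(1) B(3)] a(2) by simp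
      then have "p1 \<cdot> h = Zero E X X" using r(2) B(5) Plus_cancel_Zero[OF Id_in[OF ob(2)] comp_in[OF h(1) B(3)]] by simp
      moreover have "Plus E (p2 \<cdot> i1) (p2 \<cdot> h) = e \<cdot> j" using comp_Plus[OF B(1) h(1) B(4)] h(2) comp_assoc[OF y(3) a(1) B(4)] a(3) by simp
      then have "p2 \<cdot> h = Zero E X U" unfolding ej B(8) using Zero_Plus[OF comp_in[OF h(1) B(4)]] by simp
      ultimately have "h = Zero E X B" using biproduct_joint_mono[OF b h(1)] by blast
      then have "a \<cdot> j = i1" using h(2) Plus_Zero[OF B(1)] by simp
      then show ?thesis using extension_morphism_one[OF _ triv y(3) B(1) y(4) B(4)] ext a unfolding y(1) by blast
    qed
    show "Ext_zero E 1 U X" unfolding Ext_zero_iff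
    proof (intro conjI ballI)
      show "extensions E 1 U X \<noteq> {}" using triv by blast
      have eqv: "equivclp (extension_morphism E 1 U X) \<eta> [i1, p2]" if "\<eta> \<in> extensions E 1 U X" for \<eta>
        using r_into_equivclp tomor[OF that] by metis
      fix \<xi> \<eta> assume "\<xi> \<in> extensions E 1 U X" "\<eta> \<in> extensions E 1 U X"
      then show "equivclp (extension_morphism E 1 U X) \<xi> \<eta>"
        by (meson eqv equivclp_sym equivclp_trans)
    qed
  qed
qed

section \<open>Extensions of length at least two\<close>

text \<open>The prefix \<open>ps\<close> and the source of \<open>f\<close> stay fixed. Exactness
  before \<open>f\<close> and being an inflation are only transferred from \<open>f\<close> to
  \<open>f'\<close>, because the first matters for nonempty \<open>ps\<close> and the second for
  empty \<open>ps\<close>.\<close>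

lemma extension_replace_tail:
  assumes ext: "ps @ [f, g, h] \<in> extensions E n U Y"
    and H: "f' \<in> Hom E A B'" "g' \<in> Hom E B' D'" "h' \<in> Hom E D' U" "Dom E f = A"
    and adm: "admissible E f'" "admissible E g'" "deflation E h'"
    and ex: "\<And>p. exact_at E p f \<Longrightarrow> exact_at E p f'" "exact_at E f' g'" "exact_at E g' h'"
    and inf: "inflation E f \<Longrightarrow> inflation E f'"
  shows "ps @ [f', g', h'] \<in> extensions E n U Y"
proof -
  let ?P = "\<lambda>f g. Cod E f = Dom E g \<and> exact_at E f g"
  have e: "\<forall>f \<in> set (ps @ [f, g, h]). admissible E f" "successively ?P (ps @ [f, g, h])"
    "length (ps @ [f, g, h]) = Suc n" "inflation E (hd (ps @ [f, g, h]))" "Dom E (hd (ps @ [f, g, h])) = Y"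
    using ext unfolding extensions_def exact_seq_successively by auto
  have "successively ?P (ps @ [f', g', h'])"
    using e(2) ex H unfolding successively_append_iff by (auto simp: Hom_def)
  moreover have "\<forall>f \<in> set (ps @ [f', g', h']). admissible E f"
    using e(1) adm deflation_admissible by auto
  moreover have "inflation E (hd (ps @ [f', g', h'])) \<and> Dom E (hd (ps @ [f', g', h'])) = Y"
    using e(4,5) H inf by (cases ps) (auto simp: Hom_def)
  moreover have "length (ps @ [f', g', h']) = Suc n" using e(3) by simp
  moreover have "deflation E (last (ps @ [f', g', h'])) \<and> Cod E (last (ps @ [f', g', h'])) = U"
    using adm(3) H(3) by (simp add: Hom_def)
  ultimately show ?thesis unfolding extensions_def exact_seq_successively by blast
qed

lemma extension_morphism_tail:
  assumes ext: "ps @ [f, g, h] \<in> extensions E n U Y" "ps @ [f', g', h'] \<in> extensions E n U Y"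
    and H: "f \<in> Hom E A B" "g \<in> Hom E B D" "h \<in> Hom E D U"
    and H': "f' \<in> Hom E A B'" "g' \<in> Hom E B' D'" "h' \<in> Hom E D' U"
    and ab: "\<alpha> \<in> Hom E B B'" "\<beta> \<in> Hom E D D'" "\<alpha> \<cdot> f = f'" "\<beta> \<cdot> g = g' \<cdot> \<alpha>" "h' \<cdot> \<beta> = h"
  shows "extension_morphism E n U Y (ps @ [f, g, h]) (ps @ [f', g', h'])"
proof -
  define fs where "fs = ps @ [f, g, h]"
  define gs where "gs = ps @ [f', g', h']"
  define p where "p = length ps"
  have n: "n = Suc (Suc p)" using ext(1) unfolding extensions_def p_def by simp
  have fs_nth: "fs ! p = f" "fs ! Suc p = g" "fs ! Suc (Suc p) = h" "k < p \<Longrightarrow> fs ! k = ps ! k" for k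
    unfolding fs_def p_def by (auto simp: nth_append)
  have gs_nth: "gs ! p = f'" "gs ! Suc p = g'" "gs ! Suc (Suc p) = h'" "k < p \<Longrightarrow> gs ! k = ps ! k" for k
    unfolding gs_def p_def by (auto simp: nth_append)
  \<comment> \<open>Position \<open>p\<close> is the source of \<open>f\<close> and still belongs to
    the common part, so identities run up to and including \<open>p\<close>; the last position is
    \<open>p + 3 = Suc n\<close>, which carries the identity of \<open>U\<close>.\<close>
  define a where "a k = (if k \<le> p then Id E (Dom E (fs ! k)) else if k = Suc p then \<alpha>
      else if k = Suc (Suc p) then \<beta> else Id E U)" for k
  have seq: "Cod E (fs ! k) = Dom E (fs ! Suc k)" if "Suc k < length fs" for k
    using ext(1) that unfolding extensions_def exact_seq_def fs_def by blast
  have adm: "fs ! k \<in> Arr E" if "k < length fs" for k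
  proof -
    have "fs \<in> extensions E n U Y" "fs ! k \<in> set fs" using ext(1) nth_mem[OF that] unfolding fs_def by blast+
    then have "admissible E (fs ! k)" unfolding extensions_def exact_seq_def by blast
    then show ?thesis unfolding admissible_def using Arr_comp inflation_Arr deflation_Arr by auto
  qed
  have len: "length fs = Suc (Suc (Suc p))" unfolding fs_def p_def by simp
  have "Dom E (fs ! 0) = Y" using ext(1) unfolding extensions_def fs_def[symmetric] by (auto simp: hd_conv_nth fs_def)
  then have a0: "a 0 = Id E Y" unfolding a_def by simp
  have aU: "a (Suc n) = Id E U" unfolding a_def n by simp
  have a1: "a k \<in> Hom E (Dom E (fs ! k)) (Dom E (gs ! k))" if "k \<le> n" for k
  proof -
    consider "k < p" | "k = p" | "k = Suc p" | "k = Suc (Suc p)" using \<open>k \<le> n\<close> unfolding n by linarith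
    then show ?thesis
    proof cases
      case 1
      then have "fs ! k \<in> Arr E" using adm len by simp
      then show ?thesis using 1 fs_nth gs_nth Id_in[OF Dom_in] unfolding a_def by simp
    next
      case 2 then show ?thesis using fs_nth gs_nth Id_in Hom_Obj[OF H(1)] H(1) H'(1) unfolding a_def by (simp add: Hom_def)
    next
      case 3 then show ?thesis using fs_nth gs_nth ab(1) H(2) H'(2) unfolding a_def by (simp add: Hom_def)
    next
      case 4 then show ?thesis using fs_nth gs_nth ab(2) H(3) H'(3) unfolding a_def by (simp add: Hom_def)
    qed
  qed
  have a2: "(gs ! k) \<cdot> a k = a (Suc k) \<cdot> (fs ! k)" if "k \<le> n" for k
  proof -
    consider "k < p" | "k = p" | "k = Suc p" | "k = Suc (Suc p)" using \<open>k \<le> n\<close> unfolding n by linarith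
    then show ?thesis
    proof cases
      case 1
      then have "fs ! k \<in> Arr E" "Cod E (fs ! k) = Dom E (fs ! Suc k)" using adm seq len by simp_all
      then show ?thesis using 1 fs_nth gs_nth Arr_comp_Id[of "ps ! k"] Arr_Id_comp[of "ps ! k"] unfolding a_def by simp
    next
      case 2 then show ?thesis using fs_nth gs_nth H(1) ab(3) comp_Id[OF H'(1)] unfolding a_def by (simp add: Hom_def)
    next
      case 3 then show ?thesis using fs_nth gs_nth ab(4) unfolding a_def by simp
    next
      case 4 then show ?thesis using fs_nth gs_nth ab(5) Id_comp[OF H(3)] unfolding a_def by simp
    qed
  qed
  have "\<exists>a. a 0 = Id E Y \<and> a (Suc n) = Id E U \<and> (\<forall>k\<le>n. a k \<in> Hom E (Dom E (fs ! k)) (Dom E (gs ! k))) \<and>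
      (\<forall>k\<le>n. (gs ! k) \<cdot> a k = a (Suc k) \<cdot> (fs ! k))"
    using a0 aU a1 a2 by (intro exI[of _ a]) simp
  then show ?thesis using ext unfolding extension_morphism_def fs_def gs_def by simp
qed

text \<open>Positions run from \<open>0\<close> to \<open>n + 1\<close> as in
  \<open>extension_morphism\<close>. For \<open>n = 2\<close> the zero object does not occur, and
  the middle arrow of the extension is the zero arrow from \<open>Y\<close> to
  \<open>U\<close>.\<close>

definition trivial_obj :: "nat \<Rightarrow> 'o \<Rightarrow> 'o \<Rightarrow> 'o \<Rightarrow> nat \<Rightarrow> 'o" where
  "trivial_obj n U Y Z k = (if k \<le> 1 then Y else if n \<le> k then U else Z)"

text \<open>The list \<open>Y = Y \<rightarrow> 0 \<rightarrow> \<dots> \<rightarrow> 0 \<rightarrow> U = U\<close>, for \<open>n \<ge> 2\<close> and a zero object \<open>Z\<close>.\<close>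

definition trivial_extension :: "nat \<Rightarrow> 'o \<Rightarrow> 'o \<Rightarrow> 'o \<Rightarrow> 'm list" where
  "trivial_extension n U Y Z = map (\<lambda>k. if k = 0 then Id E Y else if k = n then Id E U
     else Zero E (trivial_obj n U Y Z k) (trivial_obj n U Y Z (Suc k))) [0..<Suc n]"

lemma trivial_extension_in:
  assumes n: "n \<ge> 2" and ob: "U \<in> Obj E" "Y \<in> Obj E" "Z \<in> Obj E" and Z: "Id E Z = Zero E Z Z"
  shows "trivial_extension n U Y Z \<in> extensions E n U Y"
proof -
  define o' where "o' = trivial_obj n U Y Z"
  have o'_in: "o' k \<in> Obj E" for k unfolding o'_def trivial_obj_def using ob by simp
  define t where "t k = trivial_extension n U Y Z ! k" for k
  have t: "t 0 = Id E Y" "t n = Id E U" "\<lbrakk>0 < k; k < n\<rbrakk> \<Longrightarrow> t k = Zero E (o' k) (o' (Suc k))" for k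
    unfolding t_def trivial_extension_def o'_def using n by (auto simp del: upt_Suc)
  have len: "length (trivial_extension n U Y Z) = Suc n" unfolding trivial_extension_def by simp
  have t_in: "t k \<in> Hom E (o' k) (o' (Suc k)) \<and> admissible E (t k)" if "k \<le> n" for k
  proof -
    consider "k = 0" | "k = n" | "0 < k" "k < n" using \<open>k \<le> n\<close> by linarith
    then show ?thesis
    proof cases
      case 1 then show ?thesis
        using t Id_in[OF ob(2)] deflation_admissible[OF Id_deflation[OF ob(2)]] unfolding o'_def trivial_obj_def by simp
    next
      case 2 then show ?thesis using n
        using t Id_in[OF ob(1)] deflation_admissible[OF Id_deflation[OF ob(1)]] unfolding o'_def trivial_obj_def by simp
    next
      case 3 then show ?thesis using t Zero_in o'_in zero_admissible by simp
    qed
  qed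
  have ex: "exact_at E (t k) (t (Suc k))" if k: "k < n" for k
  proof -
    consider "k = 0" | "0 < k" "Suc k < n" | "0 < k" "Suc k = n" using k by linarith
    then show ?thesis
    proof cases
      case 1
      then have "t (Suc k) = Zero E Y (o' 2)" using t(3)[of "Suc k"] n unfolding o'_def trivial_obj_def by (simp add: numeral_2_eq_2)
      then show ?thesis using 1 t exact_at_deflation_zero[OF Id_deflation Id_in o'_in] ob by simp
    next
      case 2
      then have "o' (Suc k) = Z" unfolding o'_def trivial_obj_def by simp
      then show ?thesis using 2 t exact_at_deflation_zero[OF zero_deflation[OF Z ob(3) o'_in] Zero_in[OF o'_in ob(3)] o'_in] by simp
    next
      case 3
      then have "o' (Suc k) = U" using n unfolding o'_def trivial_obj_def by simp
      then have "t k = Zero E (o' k) U" using t(3)[of k] 3 by simp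
      then show ?thesis using 3 t exact_at_zero_Id[OF o'_in ob(1)] by simp
    qed
  qed
  let ?T = "trivial_extension n U Y Z"
  have ne: "?T \<noteq> []" using len by auto
  have hdlast: "hd ?T = Id E Y" "last ?T = Id E U"
    using t(1,2) len ne unfolding t_def by (simp_all add: hd_conv_nth last_conv_nth)
  have "exact_seq E ?T" unfolding exact_seq_def
  proof (intro conjI ballI allI impI)
    fix f assume "f \<in> set ?T"
    then obtain k where "k \<le> n" "f = t k" unfolding t_def in_set_conv_nth len by (auto simp: less_Suc_eq_le)
    then show "admissible E f" using t_in by blast
  next
    fix k assume "Suc k < length ?T"
    then have k: "k < n" using len by simp
    show "exact_at E (?T ! k) (?T ! Suc k)" using ex[OF k] unfolding t_def .
    have "t k \<in> Hom E (o' k) (o' (Suc k))" "t (Suc k) \<in> Hom E (o' (Suc k)) (o' (Suc (Suc k)))" using t_in k by auto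
    then show "Cod E (?T ! k) = Dom E (?T ! Suc k)" unfolding t_def by (simp add: Hom_def)
  qed
  then show ?thesis unfolding extensions_def
    using len hdlast Id_inflation Id_deflation ob Dom_Id Cod_Id by simp
qed

lemma exact_at_comp_zero:
  assumes "exact_at E f g" "f \<in> Hom E X Y" "g \<in> Hom E Y Z"
  shows "g \<cdot> f = Zero E X Z"
proof -
  obtain i d where id: "deflation E d" "inflation E i" "Cod E d = Dom E i" "f = i \<cdot> d" "is_kernel E i g"
    using assms unfolding exact_at_def by blast
  have d: "d \<in> Arr E" "i \<in> Arr E" using id deflation_Arr inflation_Arr by auto
  obtain K where H: "d \<in> Hom E X K" "i \<in> Hom E K Y"
    using id(3,4) d assms(2) by (auto simp: Hom_def Dom_comp Cod_comp)
  show ?thesis unfolding id(4)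
    using comp_assoc[OF H assms(3)] kernel_zero[OF id(5) H(2) assms(3)] Zero_comp[OF H(1)] Hom_Obj[OF assms(3)] by simp
qed

lemma trivial_extension_morphism:
  assumes n: "n \<ge> 2" and ob: "U \<in> Obj E" "Y \<in> Obj E" "Z \<in> Obj E" and Z: "Id E Z = Zero E Z Z"
    and ext: "gs \<in> extensions E n U Y" and last: "gs ! n = Id E U"
  shows "extension_morphism E n U Y (trivial_extension n U Y Z) gs"
proof -
  define o' where "o' = trivial_obj n U Y Z"
  have o'_in: "o' k \<in> Obj E" for k unfolding o'_def trivial_obj_def using ob by simp
  let ?T = "trivial_extension n U Y Z"
  have t: "?T ! 0 = Id E Y" "?T ! n = Id E U" "\<lbrakk>0 < k; k < n\<rbrakk> \<Longrightarrow> ?T ! k = Zero E (o' k) (o' (Suc k))" for k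
    unfolding trivial_extension_def o'_def using n by (auto simp del: upt_Suc)
  define q where "q k = (if k = Suc n then U else Dom E (gs ! k))" for k
  have len: "length gs = Suc n" using ext unfolding extensions_def by simp
  have g: "gs ! k \<in> Hom E (q k) (q (Suc k))" if "k \<le> n" for k
  proof -
    have "gs ! k \<in> set gs" using that len by simp
    then have "admissible E (gs ! k)" using ext unfolding extensions_def exact_seq_def by auto
    then have "gs ! k \<in> Arr E" unfolding admissible_def using Arr_comp inflation_Arr deflation_Arr by auto
    moreover have "Cod E (gs ! k) = q (Suc k)"
      using ext that len last Cod_Id[OF ob(1)] unfolding extensions_def exact_seq_def q_def
      by (cases "k = n") auto
    ultimately show ?thesis using that unfolding q_def by (auto simp: Hom_def)
  qed
  have q_in: "q k \<in> Obj E" if "k \<le> n" for k using Hom_Obj[OF g[OF that]] by blast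
  have "gs \<noteq> []" using len by auto
  then have q0: "q 0 = Y" using ext unfolding extensions_def q_def by (simp add: hd_conv_nth)
  have qn: "q n = U" "q (Suc n) = U" unfolding q_def using last Dom_Id[OF ob(1)] by auto
  \<comment> \<open>The square at the start forces \<open>gs ! 0\<close> at position 1. Since
    \<open>gs\<close> ends in an identity, \<open>Id E U\<close> is possible at position
    \<open>n\<close>, and zero arrows fill the gap; the square at position 1 commutes because
    consecutive arrows of \<open>gs\<close> compose to zero.\<close>
  define a where "a k = (if k = 0 then Id E Y else if k = 1 then gs ! 0 else if n \<le> k then Id E U else Zero E (o' k) (q k))" for k
  have o'_simps: "o' 0 = Y" "o' 1 = Y" "n \<le> k \<Longrightarrow> o' k = U" for k unfolding o'_def trivial_obj_def using n by auto
  have a1: "a k \<in> Hom E (o' k) (q k)" if k: "k \<le> n" for k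
  proof -
    consider "k = 0" | "k = 1" | "k = n" "k > 1" | "1 < k" "k < n" using k by linarith
    then show ?thesis
    proof cases
      case 1 then show ?thesis unfolding a_def using Id_in[OF ob(2)] o'_simps(1) q0 by simp
    next
      case 2 then show ?thesis unfolding a_def using g[of 0] o'_simps(2) q0 by simp
    next
      case 3 then show ?thesis unfolding a_def using Id_in[OF ob(1)] o'_simps(3) qn(1) by simp
    next
      case 4 then show ?thesis unfolding a_def using Zero_in o'_in q_in by simp
    qed
  qed
  have a2: "(gs ! k) \<cdot> a k = a (Suc k) \<cdot> (?T ! k)" if k: "k \<le> n" for k
  proof -
    consider "k = 0" | "k = 1" | "k = n" "k > 1" | "1 < k" "k < n" using k by linarith
    then show ?thesis
    proof cases
      case 1 then show ?thesis unfolding a_def using t(1) by simp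
    next
      case 2
      have H: "gs ! 0 \<in> Hom E Y (q 1)" "gs ! 1 \<in> Hom E (q 1) (q 2)" using g[of 0] g[of 1] n q0 by (auto simp: numeral_2_eq_2)
      have "exact_at E (gs ! 0) (gs ! 1)" using ext n len unfolding extensions_def exact_seq_def by simp
      then have l: "(gs ! 1) \<cdot> (gs ! 0) = Zero E Y (q 2)" using exact_at_comp_zero H by blast
      have "a 2 \<in> Hom E (o' 2) (q 2)" using a1 n by blast
      moreover have "?T ! 1 = Zero E Y (o' 2)" using t(3)[of 1] n o'_simps(2) by (simp add: numeral_2_eq_2)
      ultimately have "a 2 \<cdot> (?T ! 1) = Zero E Y (q 2)" using comp_Zero ob(2) by simp
      moreover have "a 1 = gs ! 0" unfolding a_def by simp
      ultimately show ?thesis using l 2 by (simp add: numeral_2_eq_2)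
    next
      case 3 then show ?thesis unfolding a_def using last t(2) by simp
    next
      case 4
      then have "a k = Zero E (o' k) (q k)" unfolding a_def by simp
      then have "(gs ! k) \<cdot> a k = Zero E (o' k) (q (Suc k))" using comp_Zero[OF g[OF k] o'_in] by simp
      moreover have "a (Suc k) \<cdot> (?T ! k) = Zero E (o' k) (q (Suc k))"
        using t(3)[of k] 4 comp_Zero[OF a1[of "Suc k"] o'_in] by simp
      ultimately show ?thesis by simp
    qed
  qed
  have "Dom E (?T ! k) = o' k" if k: "k \<le> n" for k
  proof -
    consider "k = 0" | "k = n" | "0 < k" "k < n" using k by linarith
    then show ?thesis by cases (use t o'_simps ob Dom_Id Dom_Zero o'_in n in auto)
  qed
  then have a1': "a k \<in> Hom E (Dom E (?T ! k)) (Dom E (gs ! k))" if "k \<le> n" for k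
    using a1[OF that] that unfolding q_def by simp
  have "a 0 = Id E Y" "a (Suc n) = Id E U" unfolding a_def using n by auto
  then have "\<exists>a. a 0 = Id E Y \<and> a (Suc n) = Id E U \<and> (\<forall>k\<le>n. a k \<in> Hom E (Dom E (?T ! k)) (Dom E (gs ! k))) \<and>
      (\<forall>k\<le>n. (gs ! k) \<cdot> a k = a (Suc k) \<cdot> (?T ! k))"
    using a1' a2 by (intro exI[of _ a]) simp
  then show ?thesis using ext trivial_extension_in[OF n ob Z] unfolding extension_morphism_def by simp
qed

text \<open>The pushout \<open>V'\<close> of \<open>v\<close> along \<open>B \<rightarrow> Im g\<close> is a quotient of \<open>V\<close>, so \<open>Im g \<rightarrow> V'\<close> extends
  to \<open>M\<close>; \<open>W\<close> is the pullback of \<open>V \<rightarrow> V'\<close> along this extension.\<close>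

lemma extension_filling:
  assumes H: "g \<in> Hom E B M" "h \<in> Hom E M U" and m: "m \<in> Hom E Y B" "is_kernel E m g"
    and ex: "exact_at E g h" and h: "deflation E h"
    and v: "v \<in> Hom E B V" "inflation E v"
    and quot: "\<And>V' d. d \<in> Hom E V V' \<Longrightarrow> deflation E d \<Longrightarrow> all_split U V'"
  shows "\<exists>W b \<omega>. b \<in> Hom E B W \<and> \<omega> \<in> Hom E W M \<and> \<omega> \<cdot> b = g \<and> (b, h \<cdot> \<omega>) \<in> Confl E"
proof -
  obtain j e where je: "deflation E e" "inflation E j" "Cod E e = Dom E j" "g = j \<cdot> e" "is_kernel E j h"
    using ex unfolding exact_at_def by blast
  have ar: "e \<in> Arr E" "j \<in> Arr E" using je deflation_Arr inflation_Arr by auto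
  obtain D where D: "e \<in> Hom E B D" "j \<in> Hom E D M"
    using je(3,4) ar H(1) by (auto simp: Hom_def Dom_comp Cod_comp)
  have jh: "(j, h) \<in> Confl E" using confl_of_deflation_kernel[OF h je(5)] .
  have me: "(m, e) \<in> Confl E"
    using m(2) kernel_comp_mono[OF D je(2)] confl_of_deflation_kernel[OF je(1)] unfolding je(4) by blast
  obtain v' e' where po: "is_pushout E v e v' e'" "inflation E v'"
    using inflation_pushout[OF v(2), of e] D v by (auto simp: Hom_def)
  obtain V' where V': "v' \<in> Hom E D V'" "e' \<in> Hom E V V'" "e' \<cdot> v = v' \<cdot> e"
    by (rule pushoutE[OF po(1) v(1) D(1)]) blast
  have e': "deflation E e'"
    using pushout_deflation[OF me m(1) D(1) v po(1)] unfolding deflation_def by blast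
  obtain w F where w: "w \<in> Hom E V F" "is_kernel E v w" using inflationE[OF v(2,1)] by metis
  have ob: "B \<in> Obj E" "F \<in> Obj E" "D \<in> Obj E" "M \<in> Obj E" "V \<in> Obj E" using Hom_Obj w v D by blast+
  \<comment> \<open>The cokernel \<open>w\<close> of \<open>v\<close> descends to the pushout.
    Below, \<open>w'\<close> shows that an arrow into \<open>V\<close> whose image in
    \<open>V'\<close> comes from \<open>D\<close> factors through \<open>v\<close>.\<close>
  obtain w' where w': "w' \<in> Hom E V' F" "w' \<cdot> e' = w" "w' \<cdot> v' = Zero E D F"
  proof (rule pushoutE[OF po(1) v(1) D(1)])
    fix V2
    assume 1: "v' \<in> Hom E D V2" and
      2: "\<And>W a b. a \<in> Hom E V W \<Longrightarrow> b \<in> Hom E D W \<Longrightarrow> a \<cdot> v = b \<cdot> e \<Longrightarrow> \<exists>u \<in> Hom E V2 W. u \<cdot> e' = a \<and> u \<cdot> v' = b"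
    have "V2 = V'" using 1 V'(1) by (simp add: Hom_def)
    moreover have "w \<cdot> v = Zero E D F \<cdot> e" using kernel_zero[OF w(2) v(1) w(1)] Zero_comp[OF D(1) ob(2)] by simp
    ultimately show ?thesis using that 2[OF w(1) Zero_in[OF ob(3,2)]] by blast
  qed
  obtain x where x: "x \<in> Hom E M V'" "x \<cdot> j = v'"
    using all_split_extend[OF quot[OF V'(2) e'] jh D(2) H(2) V'(1)] by blast
  obtain \<omega> y where pb: "is_pullback E e' x \<omega> y" "deflation E \<omega>"
    using deflation_pullback[OF e', of x] V' x by (auto simp: Hom_def)
  obtain W where W: "\<omega> \<in> Hom E W M" "y \<in> Hom E W V" "e' \<cdot> y = x \<cdot> \<omega>"
    "\<And>Q a b. a \<in> Hom E Q V \<Longrightarrow> b \<in> Hom E Q M \<Longrightarrow> e' \<cdot> a = x \<cdot> b \<Longrightarrow> \<exists>u \<in> Hom E Q W. y \<cdot> u = a \<and> \<omega> \<cdot> u = b"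
    "\<And>Q u v. u \<in> Hom E Q W \<Longrightarrow> v \<in> Hom E Q W \<Longrightarrow> y \<cdot> u = y \<cdot> v \<Longrightarrow> \<omega> \<cdot> u = \<omega> \<cdot> v \<Longrightarrow> u = v"
    by (rule pullbackE[OF pb(1) V'(2) x(1)]) blast
  have "x \<cdot> g = v' \<cdot> e" unfolding je(4) using comp_assoc[OF D x(1)] x(2) by simp
  then obtain b where b: "b \<in> Hom E B W" "y \<cdot> b = v" "\<omega> \<cdot> b = g"
    using W(4)[OF v(1) H(1)] V'(3) by auto
  have h\<omega>: "h \<cdot> \<omega> \<in> Hom E W U" "deflation E (h \<cdot> \<omega>)"
    using comp_in[OF W(1) H(2)] deflation_comp[OF pb(2) h] W(1) H(2) by (auto simp: Hom_def)
  have hg: "h \<cdot> g = Zero E B U" using exact_at_comp_zero[OF ex H] .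
  have "is_kernel E b (h \<cdot> \<omega>)"
  proof (rule kernelI[OF b(1) h\<omega>(1)])
    show "(h \<cdot> \<omega>) \<cdot> b = Zero E B U" using comp_assoc[OF b(1) W(1) H(2)] b(3) hg by simp
  next
    fix Q q assume q: "q \<in> Hom E Q W" "(h \<cdot> \<omega>) \<cdot> q = Zero E Q U"
    have Q: "Q \<in> Obj E" using Hom_Obj q by blast
    have \<omega>q: "\<omega> \<cdot> q \<in> Hom E Q M" and yq: "y \<cdot> q \<in> Hom E Q V" using comp_in q W by blast+
    have "h \<cdot> (\<omega> \<cdot> q) = Zero E Q U" using comp_assoc[OF q(1) W(1) H(2)] q(2) by simp
    \<comment> \<open>The component of \<open>q\<close> in \<open>M\<close> factors through the
      image of \<open>g\<close> by \<open>c\<close>, and the component in \<open>V\<close> will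
      factor through \<open>B\<close> by \<open>\<beta>\<close>; the two are compatible because
      \<open>v'\<close> is monic.\<close>
    then obtain c where c: "c \<in> Hom E Q D" "j \<cdot> c = \<omega> \<cdot> q" using kernel_lift[OF je(5) D(2) H(2) \<omega>q] by blast
    have "e' \<cdot> (y \<cdot> q) = x \<cdot> (\<omega> \<cdot> q)" using comp_assoc[OF q(1) W(2) V'(2)] comp_assoc[OF q(1) W(1) x(1)] W(3) by simp
    also have "\<dots> = v' \<cdot> c" using comp_assoc[OF c(1) D(2) x(1)] x(2) c(2) by simp
    finally have eyq: "e' \<cdot> (y \<cdot> q) = v' \<cdot> c" .
    have "w \<cdot> (y \<cdot> q) = w' \<cdot> (v' \<cdot> c)" using comp_assoc[OF yq V'(2) w'(1)] w'(2) eyq by simp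
    also have "\<dots> = Zero E Q F" using comp_assoc[OF c(1) V'(1) w'(1)] w'(3) Zero_comp[OF c(1) ob(2)] by simp
    finally obtain \<beta> where \<beta>: "\<beta> \<in> Hom E Q B" "v \<cdot> \<beta> = y \<cdot> q" using kernel_lift[OF w(2) v(1) w(1) yq] by blast
    have "v' \<cdot> (e \<cdot> \<beta>) = e' \<cdot> (v \<cdot> \<beta>)" using comp_assoc[OF \<beta>(1) D(1) V'(1)] comp_assoc[OF \<beta>(1) v(1) V'(2)] V'(3) by simp
    also have "\<dots> = v' \<cdot> c" unfolding \<beta>(2) using eyq .
    finally have "e \<cdot> \<beta> = c" using inflation_mono[OF po(2) V'(1) comp_in[OF \<beta>(1) D(1)] c(1)] by blast
    then have "\<omega> \<cdot> (b \<cdot> \<beta>) = \<omega> \<cdot> q"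
      using comp_assoc[OF \<beta>(1) b(1) W(1)] b(3) comp_assoc[OF \<beta>(1) D] je(4) c(2) by simp
    moreover have "y \<cdot> (b \<cdot> \<beta>) = y \<cdot> q" using comp_assoc[OF \<beta>(1) b(1) W(2)] b(2) \<beta>(2) by simp
    ultimately have "b \<cdot> \<beta> = q" using W(5)[OF comp_in[OF \<beta>(1) b(1)] q(1)] by blast
    then show "\<exists>u \<in> Hom E Q B. b \<cdot> u = q" using \<beta>(1) by blast
  next
    fix Q u assume u: "u \<in> Hom E Q B" "b \<cdot> u = Zero E Q W"
    have Q: "Q \<in> Obj E" using Hom_Obj u by blast
    have "v \<cdot> u = v \<cdot> Zero E Q B" using comp_assoc[OF u(1) b(1) W(2)] b(2) u(2) comp_Zero[OF W(2) Q] comp_Zero[OF v(1) Q] by simp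
    then show "u = Zero E Q B" using inflation_mono[OF v(2,1) u(1)] Zero_in[OF Q ob(1)] by blast
  qed
  then have "(b, h \<cdot> \<omega>) \<in> Confl E" using confl_of_deflation_kernel h\<omega>(2) by blast
  then show ?thesis using b(1,3) W(1) by blast
qed

text \<open>With \<open>W\<close> filling in the last three maps \<open>m \<cdot> e\<close>, \<open>g\<close>, \<open>h\<close> of an extension, the
  extension ending in \<open>Y' \<oplus> B \<rightarrow> W \<rightarrow> U\<close> maps both to the given one and, forgetting \<open>B\<close>, to one
  ending in a zero map and the identity of \<open>U\<close>.\<close>

theorem Ext_zero_ge_two:
  assumes n: "n \<ge> 2" and ob: "U \<in> Obj E" "Y \<in> Obj E"
    and embed: "\<And>B. B \<in> Obj E \<Longrightarrow> \<exists>V \<in> S. \<exists>v \<in> Hom E B V. inflation E v"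
    and quot: "\<And>V V' d. V \<in> S \<Longrightarrow> d \<in> Hom E V V' \<Longrightarrow> deflation E d \<Longrightarrow> V' \<in> S"
    and split: "\<And>V. V \<in> S \<Longrightarrow> all_split U V"
  shows "Ext_zero E n U Y"
proof -
  obtain Z where Z: "Z \<in> Obj E" "Id E Z = Zero E Z Z" using zero_object_exists by blast
  let ?T = "trivial_extension n U Y Z"
  let ?r = "extension_morphism E n U Y"
  have T: "?T \<in> extensions E n U Y" using trivial_extension_in n ob Z by blast
  have main: "equivclp ?r \<xi> ?T" if ext: "\<xi> \<in> extensions E n U Y" for \<xi>
  proof -
    \<comment> \<open>For \<open>n \<ge> 2\<close> there are at least three arrows;
      \<open>ps\<close> holds all but the last three and is empty exactly for
      \<open>n = 2\<close>.\<close>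
    obtain n' where n': "n = Suc (Suc n')" using n by (metis add_2_eq_Suc less_eqE)
    have len: "length \<xi> = Suc (Suc (Suc n'))" using ext n' unfolding extensions_def by simp
    define ps where "ps = take n' \<xi>"
    have "length (drop n' \<xi>) = Suc (Suc (Suc 0))" using len by simp
    then obtain f g h where fgh: "drop n' \<xi> = [f, g, h]"
      by (metis length_Suc_conv length_0_conv)
    have \<xi>: "\<xi> = ps @ [f, g, h]" unfolding ps_def using fgh by (metis append_take_drop_id)
    have e: "\<forall>f \<in> set \<xi>. admissible E f" "successively (\<lambda>f g. Cod E f = Dom E g \<and> exact_at E f g) \<xi>"
      "deflation E h" "Cod E h = U" "ps = [] \<Longrightarrow> inflation E f"
      using ext unfolding extensions_def exact_seq_successively unfolding \<xi> by auto
    have s: "Cod E f = Dom E g" "exact_at E f g" "Cod E g = Dom E h" "exact_at E g h"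
      using e(2) unfolding \<xi> successively_append_iff by auto
    have ar: "f \<in> Arr E" "g \<in> Arr E" "h \<in> Arr E"
      using e(1) inflation_Arr deflation_Arr Arr_comp unfolding \<xi> admissible_def by auto
    obtain A B M where H: "f \<in> Hom E A B" "g \<in> Hom E B M" "h \<in> Hom E M U"
      using s ar e(4) by (auto simp: Hom_def)
    obtain m e0 where me: "deflation E e0" "inflation E m" "Cod E e0 = Dom E m" "f = m \<cdot> e0" "is_kernel E m g"
      using s(2) unfolding exact_at_def by blast
    have ar': "e0 \<in> Arr E" "m \<in> Arr E" using me deflation_Arr inflation_Arr by auto
    obtain Y' where Y': "e0 \<in> Hom E A Y'" "m \<in> Hom E Y' B"
      using me(3,4) ar' H(1) by (auto simp: Hom_def Dom_comp Cod_comp)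
    have ob': "A \<in> Obj E" "B \<in> Obj E" "Y' \<in> Obj E" "M \<in> Obj E" using Hom_Obj Y' H by blast+
    obtain V v where v: "V \<in> S" "v \<in> Hom E B V" "inflation E v" using embed ob' by blast
    obtain W b \<omega> where W: "b \<in> Hom E B W" "\<omega> \<in> Hom E W M" "\<omega> \<cdot> b = g" "(b, h \<cdot> \<omega>) \<in> Confl E"
      using extension_filling[OF H(2,3) Y'(2) me(5) s(4) e(3) v(2,3)] split quot[OF v(1)] by blast
    have h\<omega>: "h \<cdot> \<omega> \<in> Hom E W U" "deflation E (h \<cdot> \<omega>)" "inflation E b"
      using comp_in[OF W(2) H(3)] W(4) unfolding deflation_def inflation_def by auto
    have bh: "(h \<cdot> \<omega>) \<cdot> b = Zero E B U" using kernel_zero[OF confl_kernel[OF W(4)] W(1) h\<omega>(1)] .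
    obtain P i1 i2 p1 p2 where bp: "biproduct Y' B P i1 i2 p1 p2" using biproduct_exists ob' by blast
    note P = biproductD[OF bp]
    have p2: "deflation E p2" and i1: "inflation E i1"
      using biproduct_confl[OF bp] unfolding deflation_def inflation_def by auto
    have dH: "i1 \<cdot> e0 \<in> Hom E A P" "b \<cdot> p2 \<in> Hom E P W" using comp_in Y' P W by blast+
    have adm1: "admissible E (i1 \<cdot> e0)" "admissible E (b \<cdot> p2)"
      using admissibleI[OF me(1) i1 Y'(1) P(1) refl] admissibleI[OF p2 h\<omega>(3) P(4) W(1) refl] by blast+
    have ki1: "is_kernel E i1 (b \<cdot> p2)" using kernel_comp_mono[OF P(4) W(1) h\<omega>(3)] biproduct_kernel(1)[OF bp] by blast
    have ex1: "exact_at E (i1 \<cdot> e0) (b \<cdot> p2)" by (rule exact_atI[OF me(1) i1 Y'(1) P(1) refl ki1])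
    have ex2: "exact_at E (b \<cdot> p2) (h \<cdot> \<omega>)" by (rule exact_atI[OF p2 h\<omega>(3) P(4) W(1) refl confl_kernel[OF W(4)]])
    \<comment> \<open>When \<open>ps\<close> is empty, \<open>f\<close> is the initial inflation,
      and the arrows put in its place must be inflations too. This holds because the deflation part
      \<open>e0\<close> of a monic \<open>f\<close> is an isomorphism.\<close>
    have infl: "is_iso E e0" if f: "inflation E f"
    proof (rule deflation_mono_iso[OF me(1) Y'(1)])
      fix Q u assume u: "u \<in> Hom E Q A" "e0 \<cdot> u = Zero E Q Y'"
      have Q: "Q \<in> Obj E" using Hom_Obj u by blast
      have "f \<cdot> u = f \<cdot> Zero E Q A" unfolding me(4)
        using comp_assoc[OF u(1) Y'] comp_assoc[OF Zero_in[OF Q ob'(1)] Y'] u(2) comp_Zero[OF Y'(1) Q] by simp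
      then show "u = Zero E Q A" using inflation_mono[OF f H(1) u(1)] Zero_in[OF Q ob'(1)] by blast
    qed
    have inf1: "inflation E (i1 \<cdot> e0)" if "inflation E f"
      using inflation_comp[OF iso_inflation[OF infl[OF that]] i1] Y'(1) P(1) by (simp add: Hom_def)
    have inf2: "inflation E e0" if "inflation E f" using iso_inflation[OF infl[OF that]] .
    have DA: "Dom E f = A" using H by (simp add: Hom_def)
    let ?\<eta> = "ps @ [i1 \<cdot> e0, b \<cdot> p2, h \<cdot> \<omega>]"
    have \<eta>: "?\<eta> \<in> extensions E n U Y"
      by (rule extension_replace_tail[OF ext[unfolded \<xi>] dH h\<omega>(1) DA adm1 h\<omega>(2) _ ex1 ex2 inf1])
        (use exact_at_comp_mono[OF Y' me(2)] exact_at_comp_mono[OF Y'(1) P(1) i1] me(4) in simp)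
    have zU: "Zero E Y' U \<in> Hom E Y' U" using Zero_in ob ob' by blast
    let ?\<zeta> = "ps @ [e0, Zero E Y' U, Id E U]"
    have \<zeta>: "?\<zeta> \<in> extensions E n U Y"
      by (rule extension_replace_tail[OF ext[unfolded \<xi>] Y'(1) zU Id_in[OF ob(1)] DA deflation_admissible[OF me(1)]
            zero_admissible[OF ob'(3) ob(1)] Id_deflation[OF ob(1)] _
            exact_at_deflation_zero[OF me(1) Y'(1) ob(1)] exact_at_zero_Id[OF ob'(3) ob(1)] inf2])
        (use exact_at_comp_mono[OF Y' me(2)] me(4) in simp)
    \<comment> \<open>\<open>m\<close> on \<open>Y'\<close> and the identity on \<open>B\<close>:
      this recovers \<open>f\<close> from \<open>i1 \<cdot> e0\<close>, and \<open>g\<close> kills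
      the contribution of \<open>m\<close>.\<close>
    define \<alpha> where "\<alpha> = Plus E (m \<cdot> p1) p2"
    have mp1: "m \<cdot> p1 \<in> Hom E P B" using comp_in P(3) Y'(2) by blast
    have \<alpha>: "\<alpha> \<in> Hom E P B" unfolding \<alpha>_def using Plus_in mp1 P(4) by blast
    have \<alpha>i: "\<alpha> \<cdot> i1 = m"
      using Plus_comp[OF P(1) mp1 P(4)] comp_assoc[OF P(1,3) Y'(2)] P(5,8) comp_Id[OF Y'(2)] Plus_Zero[OF Y'(2)]
      unfolding \<alpha>_def by simp
    have "g \<cdot> (m \<cdot> p1) = Zero E P M" using comp_assoc[OF P(3) Y'(2) H(2)] kernel_zero[OF me(5) Y'(2) H(2)] Zero_comp[OF P(3) ob'(4)] by simp
    then have "g \<cdot> \<alpha> = g \<cdot> p2"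
      using comp_Plus[OF mp1 P(4) H(2)] Zero_Plus[OF comp_in[OF P(4) H(2)]] unfolding \<alpha>_def by simp
    then have g\<alpha>: "\<omega> \<cdot> (b \<cdot> p2) = g \<cdot> \<alpha>" using comp_assoc[OF P(4) W(1,2)] W(3) by simp
    have "?r ?\<eta> \<xi>" unfolding \<xi>
      by (rule extension_morphism_tail[OF \<eta> ext[unfolded \<xi>] dH h\<omega>(1) H \<alpha> W(2) _ g\<alpha> refl])
        (use comp_assoc[OF Y'(1) P(1) \<alpha>] \<alpha>i me(4) in simp)
    moreover have "?r ?\<eta> ?\<zeta>"
    proof (rule extension_morphism_tail[OF \<eta> \<zeta> dH h\<omega>(1) Y'(1) zU Id_in[OF ob(1)] P(3) h\<omega>(1)])
      show "p1 \<cdot> (i1 \<cdot> e0) = e0" using comp_assoc[OF Y'(1) P(1,3)] P(5) Id_comp[OF Y'(1)] by simp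
      show "(h \<cdot> \<omega>) \<cdot> (b \<cdot> p2) = Zero E Y' U \<cdot> p1"
        using comp_assoc[OF P(4) W(1) h\<omega>(1)] bh Zero_comp[OF P(4) ob(1)] Zero_comp[OF P(3) ob(1)] by simp
      show "Id E U \<cdot> (h \<cdot> \<omega>) = h \<cdot> \<omega>" using Id_comp[OF h\<omega>(1)] .
    qed
    moreover have "?\<zeta> ! n = Id E U" unfolding n' ps_def using len by (simp add: nth_append)
    then have "?r ?T ?\<zeta>" using trivial_extension_morphism[OF n ob Z(1,2) \<zeta>] by blast
    \<comment> \<open>The zigzag is \<open>\<xi> <- \<eta> -> \<zeta> <- T\<close>, with
      \<open>T\<close> the trivial extension.\<close>
    ultimately show "equivclp ?r \<xi> ?T" by (meson equivclp_sym equivclp_trans r_into_equivclp)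
  qed
  show ?thesis unfolding Ext_zero_iff
  proof (intro conjI ballI)
    show "extensions E n U Y \<noteq> {}" using T by blast
    fix \<xi> \<eta> assume "\<xi> \<in> extensions E n U Y" "\<eta> \<in> extensions E n U Y"
    then show "equivclp ?r \<xi> \<eta>" by (meson main equivclp_sym equivclp_trans)
  qed
qed

end

section \<open>The exact category of a subcategory\<close>

lemma E_sub_simps:
  "Obj (E_sub E T) = A_sub E T"
  "Arr (E_sub E T) = {f \<in> Arr E. Dom E f \<in> A_sub E T \<and> Cod E f \<in> A_sub E T}"
  "Dom (E_sub E T) = Dom E" "Cod (E_sub E T) = Cod E" "Id (E_sub E T) = Id E" "Comp (E_sub E T) = Comp E"
  "Zero (E_sub E T) = Zero E" "Plus (E_sub E T) = Plus E"
  "Confl (E_sub E T) = {(i, d) \<in> Confl E. Dom E i \<in> A_sub E T \<and> Cod E i \<in> A_sub E T \<and> Cod E d \<in> A_sub E T}"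
  unfolding E_sub_def by simp_all

lemma Hom_E_sub: "f \<in> Hom (E_sub E T) X Y \<longleftrightarrow> f \<in> Hom E X Y \<and> X \<in> A_sub E T \<and> Y \<in> A_sub E T"
  unfolding Hom_def E_sub_simps by auto

lemma A_sub_Obj: "X \<in> A_sub E T \<Longrightarrow> X \<in> Obj E"
  unfolding A_sub_def by simp

lemma hom_group_E_sub: "X \<in> A_sub E T \<Longrightarrow> Y \<in> A_sub E T \<Longrightarrow> hom_group (E_sub E T) X Y = hom_group E X Y"
  unfolding hom_group_def E_sub_simps using Hom_E_sub[of _ E T X Y] by auto

lemma is_direct_sum_E_sub:
  "is_direct_sum (E_sub E T) n X B \<iota> \<pi> \<longleftrightarrow>
    is_direct_sum E n X B \<iota> \<pi> \<and> B \<in> A_sub E T \<and> (\<forall>k<n. X k \<in> A_sub E T)"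
proof (cases "B \<in> A_sub E T \<and> (\<forall>k<n. X k \<in> A_sub E T)")
  case True
  then show ?thesis unfolding is_direct_sum_def Hom_E_sub
    using hom_group_E_sub[of B E T B] by (auto simp: E_sub_simps A_sub_Obj)
next
  case False
  then show ?thesis unfolding is_direct_sum_def by (auto simp: E_sub_simps)
qed

text \<open>By fullness the factorisations stay in the subcategory, and there are only fewer objects
  to test; the same argument serves cokernels, pullbacks and pushouts.\<close>

lemma is_kernel_E_sub:
  assumes "is_kernel E i g" "i \<in> Arr (E_sub E T)" "g \<in> Arr (E_sub E T)"
  shows "is_kernel (E_sub E T) i g"
proof -
  have A: "Dom E i \<in> A_sub E T" "Dom E g \<in> A_sub E T" using assms by (auto simp: E_sub_simps)
  show ?thesis unfolding is_kernel_def E_sub_simps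
  proof (intro conjI ballI impI)
    fix W h
    assume h: "W \<in> A_sub E T" "h \<in> Hom (E_sub E T) W (Dom E g)" "g \<cdot>\<^bsub>E\<^esub> h = Zero E W (Cod E g)"
    then have "\<exists>!u. u \<in> Hom E W (Dom E i) \<and> i \<cdot>\<^bsub>E\<^esub> u = h"
      using assms(1) A_sub_Obj[OF h(1)] unfolding is_kernel_def Hom_E_sub by blast
    then show "\<exists>!u. u \<in> Hom (E_sub E T) W (Dom E i) \<and> i \<cdot>\<^bsub>E\<^esub> u = h"
      using h(1) A by (simp add: Hom_E_sub)
  qed (use assms in \<open>auto simp: is_kernel_def E_sub_simps\<close>)
qed

lemma is_cokernel_E_sub:
  assumes "is_cokernel E f d" "f \<in> Arr (E_sub E T)" "d \<in> Arr (E_sub E T)"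
  shows "is_cokernel (E_sub E T) f d"
proof -
  have A: "Cod E f \<in> A_sub E T" "Cod E d \<in> A_sub E T" using assms by (auto simp: E_sub_simps)
  show ?thesis unfolding is_cokernel_def E_sub_simps
  proof (intro conjI ballI impI)
    fix W h
    assume h: "W \<in> A_sub E T" "h \<in> Hom (E_sub E T) (Cod E f) W" "h \<cdot>\<^bsub>E\<^esub> f = Zero E (Dom E f) W"
    then have "\<exists>!u. u \<in> Hom E (Cod E d) W \<and> u \<cdot>\<^bsub>E\<^esub> d = h"
      using assms(1) A_sub_Obj[OF h(1)] unfolding is_cokernel_def Hom_E_sub by blast
    then show "\<exists>!u. u \<in> Hom (E_sub E T) (Cod E d) W \<and> u \<cdot>\<^bsub>E\<^esub> d = h"
      using h(1) A by (simp add: Hom_E_sub)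
  qed (use assms in \<open>auto simp: is_cokernel_def E_sub_simps\<close>)
qed

lemma is_pullback_E_sub:
  assumes "is_pullback E f g f' g'" "{f, g, f', g'} \<subseteq> Arr (E_sub E T)"
  shows "is_pullback (E_sub E T) f g f' g'"
proof -
  have A: "Dom E f \<in> A_sub E T" "Dom E g \<in> A_sub E T" "Dom E f' \<in> A_sub E T" using assms by (auto simp: E_sub_simps)
  show ?thesis unfolding is_pullback_def E_sub_simps
  proof (intro conjI ballI impI)
    fix W a b
    assume h: "W \<in> A_sub E T" "a \<in> Hom (E_sub E T) W (Dom E f)" "b \<in> Hom (E_sub E T) W (Dom E g)" "f \<cdot>\<^bsub>E\<^esub> a = g \<cdot>\<^bsub>E\<^esub> b"
    then have "\<exists>!u. u \<in> Hom E W (Dom E f') \<and> g' \<cdot>\<^bsub>E\<^esub> u = a \<and> f' \<cdot>\<^bsub>E\<^esub> u = b"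
      using assms(1) A_sub_Obj[OF h(1)] unfolding is_pullback_def Hom_E_sub by blast
    then show "\<exists>!u. u \<in> Hom (E_sub E T) W (Dom E f') \<and> g' \<cdot>\<^bsub>E\<^esub> u = a \<and> f' \<cdot>\<^bsub>E\<^esub> u = b"
      using h(1) A by (simp add: Hom_E_sub)
  qed (use assms in \<open>auto simp: is_pullback_def E_sub_simps\<close>)
qed

lemma is_pushout_E_sub:
  assumes "is_pushout E f g f' g'" "{f, g, f', g'} \<subseteq> Arr (E_sub E T)"
  shows "is_pushout (E_sub E T) f g f' g'"
proof -
  have A: "Cod E f \<in> A_sub E T" "Cod E g \<in> A_sub E T" "Cod E f' \<in> A_sub E T" using assms by (auto simp: E_sub_simps)
  show ?thesis unfolding is_pushout_def E_sub_simps
  proof (intro conjI ballI impI)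
    fix W a b
    assume h: "W \<in> A_sub E T" "a \<in> Hom (E_sub E T) (Cod E f) W" "b \<in> Hom (E_sub E T) (Cod E g) W" "a \<cdot>\<^bsub>E\<^esub> f = b \<cdot>\<^bsub>E\<^esub> g"
    then have "\<exists>!u. u \<in> Hom E (Cod E f') W \<and> u \<cdot>\<^bsub>E\<^esub> g' = a \<and> u \<cdot>\<^bsub>E\<^esub> f' = b"
      using assms(1) A_sub_Obj[OF h(1)] unfolding is_pushout_def Hom_E_sub by blast
    then show "\<exists>!u. u \<in> Hom (E_sub E T) (Cod E f') W \<and> u \<cdot>\<^bsub>E\<^esub> g' = a \<and> u \<cdot>\<^bsub>E\<^esub> f' = b"
      using h(1) A by (simp add: Hom_E_sub)
  qed (use assms in \<open>auto simp: is_pushout_def E_sub_simps\<close>)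
qed

lemma is_iso_E_sub: "is_iso (E_sub E T) f \<Longrightarrow> is_iso E f"
  unfolding is_iso_def by (auto simp: E_sub_simps Hom_E_sub)

section \<open>Closure properties of \<open>A_sub\<close>\<close>

context exact_category
begin

lemma T_subset_A_sub: "T \<subseteq> Obj E \<Longrightarrow> T \<subseteq> A_sub E T"
  unfolding A_sub_def annihilator_ideal_def by auto

lemma A_sub_kills:
  assumes "X \<in> A_sub E T" "f \<in> annihilator_ideal E T" "f \<in> Hom E P Q" "h \<in> Hom E Q X"
  shows "h \<cdot> f = Zero E P X"
  using assms unfolding A_sub_def by (auto simp: Hom_def)

text \<open>A composite \<open>h \<cdot> f\<close> with \<open>f\<close> in the ideal dies in every
  object of \<open>A_sub E T\<close>, so it vanishes when these objects detect zero arrows.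
  Subobjects, direct sums and pullbacks are all covered by this.\<close>

lemma A_sub_cogenerated:
  assumes X: "X \<in> Obj E"
    and cog: "\<And>W u. u \<in> Hom E W X \<Longrightarrow> (\<And>Y p. Y \<in> A_sub E T \<Longrightarrow> p \<in> Hom E X Y \<Longrightarrow> p \<cdot> u = Zero E W Y) \<Longrightarrow> u = Zero E W X"
  shows "X \<in> A_sub E T"
  unfolding A_sub_def
proof (intro CollectI conjI ballI X)
  fix f h assume f: "f \<in> annihilator_ideal E T" and h: "h \<in> Hom E (Cod E f) X"
  have fH: "f \<in> Hom E (Dom E f) (Cod E f)" using f unfolding annihilator_ideal_def Hom_def by simp
  show "h \<cdot> f = Zero E (Dom E f) X"
  proof (rule cog[OF comp_in[OF fH h]])
    fix Y p assume p: "Y \<in> A_sub E T" "p \<in> Hom E X Y"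
    then show "p \<cdot> (h \<cdot> f) = Zero E (Dom E f) Y"
      using comp_assoc[OF fH h p(2)] A_sub_kills[OF p(1) f fH comp_in[OF h p(2)]] by simp
  qed
qed

lemma A_sub_mono:
  assumes i: "i \<in> Hom E X Y" "Y \<in> A_sub E T" and mono: "\<And>W u. u \<in> Hom E W X \<Longrightarrow> i \<cdot> u = Zero E W Y \<Longrightarrow> u = Zero E W X"
  shows "X \<in> A_sub E T"
  using A_sub_cogenerated[of X T] mono i Hom_Obj[OF i(1)] by blast

lemma A_sub_inflation:
  assumes i: "i \<in> Hom E X Y" "inflation E i" "Y \<in> A_sub E T"
  shows "X \<in> A_sub E T"
proof (rule A_sub_mono[OF i(1,3)])
  fix W u assume u: "u \<in> Hom E W X" "i \<cdot> u = Zero E W Y"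
  then show "u = Zero E W X" using inflation_mono[OF i(2,1) u(1)] Zero_in comp_Zero[OF i(1)] Hom_Obj by metis
qed

lemma projective_lift:
  assumes "P \<in> projectives E" "deflation E d" "d \<in> Hom E X Y" "f \<in> Hom E P Y"
  shows "\<exists>g \<in> Hom E P X. d \<cdot> g = f"
proof -
  have "f \<in> Hom E P (Cod E d)" "Dom E d = X" using assms by (auto simp: Hom_def)
  then show ?thesis using assms(1,2) unfolding projectives_def by blast
qed

text \<open>The target of an arrow of the ideal is projective, so arrows from it to \<open>Z\<close>
  lift along \<open>d\<close> to \<open>Y\<close>.\<close>

lemma A_sub_deflation:
  assumes d: "d \<in> Hom E Y Z" "deflation E d" "Y \<in> A_sub E T"
  shows "Z \<in> A_sub E T"
  unfolding A_sub_def
proof (intro CollectI conjI ballI)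
  show Z: "Z \<in> Obj E" using Hom_Obj d by blast
  fix f h assume f: "f \<in> annihilator_ideal E T" and h: "h \<in> Hom E (Cod E f) Z"
  have fH: "f \<in> Hom E (Dom E f) (Cod E f)" and P: "Cod E f \<in> projectives E"
    using f unfolding annihilator_ideal_def Hom_def by simp_all
  obtain h' where h': "h' \<in> Hom E (Cod E f) Y" "d \<cdot> h' = h" using projective_lift[OF P d(2,1) h] by blast
  have "h \<cdot> f = d \<cdot> (h' \<cdot> f)" using comp_assoc[OF fH h'(1) d(1)] h'(2) by simp
  then show "h \<cdot> f = Zero E (Dom E f) Z" using A_sub_kills[OF d(3) f fH h'(1)] comp_Zero[OF d(1)] Hom_Obj[OF fH] by simp
qed

lemma A_sub_direct_sum:
  assumes ds: "is_direct_sum E n X B \<iota> \<pi>" and A: "\<And>k. k < n \<Longrightarrow> X k \<in> A_sub E T"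
  shows "B \<in> A_sub E T"
proof (rule A_sub_cogenerated)
  show "B \<in> Obj E" using ds unfolding is_direct_sum_def by blast
  fix W u assume u: "u \<in> Hom E W B" "\<And>Y p. Y \<in> A_sub E T \<Longrightarrow> p \<in> Hom E B Y \<Longrightarrow> p \<cdot> u = Zero E W Y"
  show "u = Zero E W B"
    by (rule direct_sum_joint_mono[OF ds u(1)]) (use u(2) A ds in \<open>auto simp: is_direct_sum_def\<close>)
qed

lemma A_sub_pullback:
  assumes pb: "is_pullback E f g f' g'" and H: "f \<in> Hom E X Z" "g \<in> Hom E Y Z" and A: "X \<in> A_sub E T" "Y \<in> A_sub E T"
  shows "Dom E f' \<in> A_sub E T"
proof -
  obtain V where V: "f' \<in> Hom E V Y" "g' \<in> Hom E V X" "f \<cdot> g' = g \<cdot> f'"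
    "\<And>W u v. u \<in> Hom E W V \<Longrightarrow> v \<in> Hom E W V \<Longrightarrow> g' \<cdot> u = g' \<cdot> v \<Longrightarrow> f' \<cdot> u = f' \<cdot> v \<Longrightarrow> u = v"
    by (rule pullbackE[OF pb H]) blast
  have Vo: "V \<in> Obj E" using Hom_Obj V by blast
  have "V \<in> A_sub E T"
  proof (rule A_sub_cogenerated[OF Vo])
    fix W u assume u: "u \<in> Hom E W V" "\<And>Y p. Y \<in> A_sub E T \<Longrightarrow> p \<in> Hom E V Y \<Longrightarrow> p \<cdot> u = Zero E W Y"
    have W: "W \<in> Obj E" using Hom_Obj u by blast
    show "u = Zero E W V"
      using V(4)[OF u(1) Zero_in[OF W Vo]] u(2)[OF A(1) V(2)] u(2)[OF A(2) V(1)] comp_Zero[OF V(1) W] comp_Zero[OF V(2) W]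
      by simp
  qed
  then show ?thesis using V(1) by (simp add: Hom_def)
qed

text \<open>The pushout is an extension of \<open>Z\<close> by \<open>X'\<close>, but closure under
  extensions is not at hand. Instead, every arrow from a projective to the pushout is a sum
  \<open>f' \<cdot> h' + i' \<cdot> h''\<close>, and both terms vanish on the ideal because
  \<open>Y\<close> and \<open>X'\<close> lie in \<open>A_sub E T\<close>.\<close>

lemma A_sub_pushout:
  assumes po: "is_pushout E i f i' f'" "inflation E i" "inflation E i'"
    and H: "i \<in> Hom E X Y" "f \<in> Hom E X X'" and A: "Y \<in> A_sub E T" "X' \<in> A_sub E T"
  shows "Cod E i' \<in> A_sub E T"
proof -
  obtain V where V: "i' \<in> Hom E X' V" "f' \<in> Hom E Y V" by (rule pushoutE[OF po(1) H]) blast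
  obtain d Z where d: "d \<in> Hom E Y Z" "(i, d) \<in> Confl E" "deflation E d" using inflationE[OF po(2) H(1)] by metis
  obtain d' where d': "(i', d') \<in> Confl E" "d' \<cdot> f' = d" using pushout_confl[OF d(2) H po(1,3)] by blast
  have d'A: "d' \<in> Arr E" "Dom E d' = V" using d'(1) conflE[OF d'(1)] V(1) by (auto simp: Hom_def)
  then have d'H: "d' \<in> Hom E V Z" using d'(2) d(1) V(2) by (auto simp: Hom_def Cod_comp)
  have "V \<in> A_sub E T"
    unfolding A_sub_def
  proof (intro CollectI conjI ballI)
    show Vo: "V \<in> Obj E" using Hom_Obj V by blast
    fix k h assume k: "k \<in> annihilator_ideal E T" and h: "h \<in> Hom E (Cod E k) V"
    have kH: "k \<in> Hom E (Dom E k) (Cod E k)" and P: "Cod E k \<in> projectives E"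
      using k unfolding annihilator_ideal_def Hom_def by simp_all
    obtain h' where h': "h' \<in> Hom E (Cod E k) Y" "d \<cdot> h' = d' \<cdot> h"
      using projective_lift[OF P d(3,1) comp_in[OF h d'H]] by blast
    have fh: "f' \<cdot> h' \<in> Hom E (Cod E k) V" using comp_in h' V by blast
    \<comment> \<open>\<open>h\<close> and \<open>f' \<cdot> h'\<close> agree after
      \<open>d'\<close>, so their difference \<open>r\<close> comes from \<open>X'\<close>.\<close>
    obtain r where r: "r \<in> Hom E (Cod E k) V" "h = Plus E (f' \<cdot> h') r" using diff_exists[OF h fh] by blast
    have "Plus E (d' \<cdot> h) (d' \<cdot> r) = d' \<cdot> h"
      using comp_Plus[OF fh r(1) d'H] r(2) comp_assoc[OF h'(1) V(2) d'H] d'(2) h'(2) by simp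
    then have "d' \<cdot> r = Zero E (Cod E k) Z" using Plus_cancel_Zero comp_in h r(1) d'H by metis
    then obtain h'' where h'': "h'' \<in> Hom E (Cod E k) X'" "i' \<cdot> h'' = r"
      using kernel_lift[OF confl_kernel[OF d'(1)] V(1) d'H r(1)] by blast
    have "h \<cdot> k = Plus E ((f' \<cdot> h') \<cdot> k) (r \<cdot> k)" using r(2) Plus_comp[OF kH fh r(1)] by simp
    also have "(f' \<cdot> h') \<cdot> k = Zero E (Dom E k) V"
      using comp_assoc[OF kH h'(1) V(2)] A_sub_kills[OF A(1) k kH h'(1)] comp_Zero[OF V(2)] Hom_Obj[OF kH] by simp
    also have "r \<cdot> k = Zero E (Dom E k) V"
      using comp_assoc[OF kH h''(1) V(1)] h''(2) A_sub_kills[OF A(2) k kH h''(1)] comp_Zero[OF V(1)] Hom_Obj[OF kH] by simp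
    finally show "h \<cdot> k = Zero E (Dom E k) V" using Plus_Zero Zero_in Hom_Obj[OF kH] Vo by simp
  qed
  then show ?thesis using V(1) by (simp add: Hom_def)
qed

text \<open>The third term of the conflation is free of charge: it is an admissible quotient of an
  object of \<open>A_sub E T\<close>.\<close>

lemma inflation_E_sub: "inflation (E_sub E T) i \<longleftrightarrow> inflation E i \<and> i \<in> Arr (E_sub E T)"
proof
  assume "inflation (E_sub E T) i"
  then obtain d where d: "(i, d) \<in> Confl (E_sub E T)" unfolding inflation_def by blast
  then have "inflation E i" unfolding inflation_def E_sub_simps by blast
  then show "inflation E i \<and> i \<in> Arr (E_sub E T)" using d inflation_Arr by (auto simp: E_sub_simps)
next
  assume i: "inflation E i \<and> i \<in> Arr (E_sub E T)"
  then have iH: "i \<in> Hom E (Dom E i) (Cod E i)" by (auto simp: E_sub_simps Hom_def)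
  obtain d Z where d: "d \<in> Hom E (Cod E i) Z" "(i, d) \<in> Confl E" "deflation E d" using inflationE[OF conjunct1[OF i] iH] by metis
  then have "Cod E d \<in> A_sub E T" using A_sub_deflation[OF d(1,3), of T] i by (auto simp: Hom_def E_sub_simps)
  then show "inflation (E_sub E T) i" using d(2) i unfolding inflation_def E_sub_simps by blast
qed

lemma deflation_E_sub: "deflation (E_sub E T) d \<longleftrightarrow> deflation E d \<and> d \<in> Arr (E_sub E T)"
proof
  assume "deflation (E_sub E T) d"
  then obtain i where i: "(i, d) \<in> Confl (E_sub E T)" unfolding deflation_def by blast
  then have "deflation E d" unfolding deflation_def E_sub_simps by blast
  moreover have "Cod E i = Dom E d" using i confl_kernel[of i d] by (simp add: is_kernel_def E_sub_simps)
  ultimately show "deflation E d \<and> d \<in> Arr (E_sub E T)" using i deflation_Arr by (auto simp: E_sub_simps)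
next
  assume d: "deflation E d \<and> d \<in> Arr (E_sub E T)"
  then have dH: "d \<in> Hom E (Dom E d) (Cod E d)" by (auto simp: E_sub_simps Hom_def)
  obtain i X where i: "i \<in> Hom E X (Dom E d)" "(i, d) \<in> Confl E" "inflation E i" using deflationE[OF conjunct1[OF d] dH] by metis
  then have "Dom E i \<in> A_sub E T" "Cod E i = Dom E d" using A_sub_inflation[OF i(1,3), of T] d by (auto simp: Hom_def E_sub_simps)
  then show "deflation (E_sub E T) d" using i(2) d unfolding deflation_def by (auto simp: E_sub_simps)
qed

section \<open>The exact structure inherited by \<open>E_sub\<close>\<close>

lemma exact_category_E_sub: "exact_category (E_sub E T)"
proof -
  let ?F = "E_sub E T"
  have cat: "category ?F"
  proof
    fix f assume "f \<in> Arr ?F"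
    then show "Dom ?F f \<in> Obj ?F" "Cod ?F f \<in> Obj ?F" by (auto simp: E_sub_simps)
  next
    fix X assume "X \<in> Obj ?F"
    then show "Id ?F X \<in> Hom ?F X X" using Id_in[of X] A_sub_Obj[of X E T] by (simp add: Hom_E_sub E_sub_simps)
  next
    fix f g X Y Z assume "f \<in> Hom ?F X Y" "g \<in> Hom ?F Y Z"
    then show "g \<cdot>\<^bsub>?F\<^esub> f \<in> Hom ?F X Z" using comp_in by (auto simp: Hom_E_sub E_sub_simps)
  next
    fix f X Y assume "f \<in> Hom ?F X Y"
    then show "f \<cdot>\<^bsub>?F\<^esub> Id ?F X = f" "Id ?F Y \<cdot>\<^bsub>?F\<^esub> f = f" using comp_Id Id_comp by (auto simp: Hom_E_sub E_sub_simps)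
  next
    fix f g h W X Y Z assume "f \<in> Hom ?F W X" "g \<in> Hom ?F X Y" "h \<in> Hom ?F Y Z"
    then show "(h \<cdot>\<^bsub>?F\<^esub> g) \<cdot>\<^bsub>?F\<^esub> f = h \<cdot>\<^bsub>?F\<^esub> (g \<cdot>\<^bsub>?F\<^esub> f)" using comp_assoc by (auto simp: Hom_E_sub E_sub_simps)
  qed
  have pre: "preadditive_category ?F"
  proof (intro preadditive_category.intro cat preadditive_category_axioms.intro)
    fix X Y assume "X \<in> Obj ?F" "Y \<in> Obj ?F"
    then show "comm_group (hom_group ?F X Y)" using hom_comm_group A_sub_Obj[of X E T] A_sub_Obj[of Y E T]
      by (simp add: hom_group_E_sub E_sub_simps)
  next
    fix f g h X Y Z assume "f \<in> Hom ?F X Y" "g \<in> Hom ?F X Y" "h \<in> Hom ?F Y Z"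
    then show "h \<cdot>\<^bsub>?F\<^esub> Plus ?F f g = Plus ?F (h \<cdot>\<^bsub>?F\<^esub> f) (h \<cdot>\<^bsub>?F\<^esub> g)"
      using comp_Plus[of f X Y g h Z] by (simp add: Hom_E_sub E_sub_simps)
  next
    fix f g h X Y Z assume "f \<in> Hom ?F X Y" "g \<in> Hom ?F Y Z" "h \<in> Hom ?F Y Z"
    then show "Plus ?F g h \<cdot>\<^bsub>?F\<^esub> f = Plus ?F (g \<cdot>\<^bsub>?F\<^esub> f) (h \<cdot>\<^bsub>?F\<^esub> f)"
      using Plus_comp[of f X Y g Z h] by (simp add: Hom_E_sub E_sub_simps)
  qed
  have add: "additive_category ?F"
  proof (intro additive_category.intro pre additive_category_axioms.intro)
    fix n and X :: "nat \<Rightarrow> 'o" assume X: "\<And>k. k < n \<Longrightarrow> X k \<in> Obj ?F"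
    then have "\<exists>B \<iota> \<pi>. is_direct_sum E n X B \<iota> \<pi>" using A_sub_Obj[of _ E T] by (intro direct_sums) (auto simp: E_sub_simps)
    then obtain B \<iota> \<pi> where "is_direct_sum E n X B \<iota> \<pi>" by blast
    moreover then have "B \<in> A_sub E T" using A_sub_direct_sum X by (simp add: E_sub_simps)
    ultimately show "\<exists>B \<iota> \<pi>. is_direct_sum ?F n X B \<iota> \<pi>" using X unfolding is_direct_sum_E_sub by (auto simp: E_sub_simps)
  qed
  have confl_Arr: "i \<in> Arr ?F" "d \<in> Arr ?F" if "(i, d) \<in> Confl ?F" for i d
  proof -
    have "inflation ?F i" "deflation ?F d" using that unfolding inflation_def deflation_def by blast+
    then show "i \<in> Arr ?F" "d \<in> Arr ?F" using inflation_E_sub deflation_E_sub by blast+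
  qed
  show ?thesis
  proof (intro exact_category.intro add exact_category_axioms.intro)
    fix i d assume c: "(i, d) \<in> Confl ?F"
    then have c': "(i, d) \<in> Confl E" by (simp add: E_sub_simps)
    show "is_kernel ?F i d" by (rule is_kernel_E_sub[OF confl_kernel[OF c'] confl_Arr[OF c]])
    show "is_cokernel ?F i d" by (rule is_cokernel_E_sub[OF confl_cokernel[OF c'] confl_Arr[OF c]])
  next
    fix i d i' d' a b c
    assume h: "(i, d) \<in> Confl ?F" "i' \<in> Arr ?F" "d' \<in> Arr ?F" "Cod ?F i' = Dom ?F d'"
      "is_iso ?F a" "is_iso ?F b" "is_iso ?F c"
      "a \<in> Hom ?F (Dom ?F i) (Dom ?F i')" "b \<in> Hom ?F (Cod ?F i) (Cod ?F i')" "c \<in> Hom ?F (Cod ?F d) (Cod ?F d')"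
      "b \<cdot>\<^bsub>?F\<^esub> i = i' \<cdot>\<^bsub>?F\<^esub> a" "c \<cdot>\<^bsub>?F\<^esub> d = d' \<cdot>\<^bsub>?F\<^esub> b"
    then have "(i', d') \<in> Confl E"
      by (intro confl_iso[of i d i' d' a b c]) (auto simp: Hom_E_sub E_sub_simps intro: is_iso_E_sub)
    then show "(i', d') \<in> Confl ?F" using h(2,3) by (auto simp: E_sub_simps)
  next
    fix X assume "X \<in> Obj ?F"
    then show "inflation ?F (Id ?F X)" "deflation ?F (Id ?F X)"
      unfolding inflation_E_sub deflation_E_sub using Id_inflation Id_deflation Id_in[of X] A_sub_Obj[of X E T]
      by (auto simp: E_sub_simps Hom_def)
  next
    fix i j assume "inflation ?F i" "inflation ?F j" "Cod ?F i = Dom ?F j"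
    then show "inflation ?F (j \<cdot>\<^bsub>?F\<^esub> i)"
      unfolding inflation_E_sub using inflation_comp by (auto simp: E_sub_simps Arr_comp Dom_comp Cod_comp)
  next
    fix d e assume "deflation ?F d" "deflation ?F e" "Cod ?F d = Dom ?F e"
    then show "deflation ?F (e \<cdot>\<^bsub>?F\<^esub> d)"
      unfolding deflation_E_sub using deflation_comp by (auto simp: E_sub_simps Arr_comp Dom_comp Cod_comp)
  next
    fix i f assume h: "inflation ?F i" "f \<in> Arr ?F" "Dom ?F f = Dom ?F i"
    then have i: "inflation E i" "i \<in> Arr ?F" unfolding inflation_E_sub by auto
    have H: "i \<in> Hom E (Dom E i) (Cod E i)" "f \<in> Hom E (Dom E i) (Cod E f)" "Cod E i \<in> A_sub E T" "Cod E f \<in> A_sub E T"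
      using i(2) h(2,3) by (auto simp: E_sub_simps Hom_def)
    obtain i' f' where po: "is_pushout E i f i' f'" "inflation E i'"
      using inflation_pushout[OF i(1), of f] H by (auto simp: Hom_def)
    have V: "Cod E i' \<in> A_sub E T" using A_sub_pushout[OF po(1) i(1) po(2) H] .
    have ar: "{i, f, i', f'} \<subseteq> Arr ?F"
      using po(1) V i(2) h(2) H unfolding is_pushout_def by (auto simp: E_sub_simps)
    then show "\<exists>i' f'. is_pushout ?F i f i' f' \<and> inflation ?F i'"
      using is_pushout_E_sub[OF po(1) ar] po(2) unfolding inflation_E_sub by blast
  next
    fix d f assume h: "deflation ?F d" "f \<in> Arr ?F" "Cod ?F f = Cod ?F d"
    then have d: "deflation E d" "d \<in> Arr ?F" unfolding deflation_E_sub by auto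
    have H: "d \<in> Hom E (Dom E d) (Cod E d)" "f \<in> Hom E (Dom E f) (Cod E d)" "Dom E d \<in> A_sub E T" "Dom E f \<in> A_sub E T"
      using d(2) h(2,3) by (auto simp: E_sub_simps Hom_def)
    obtain d' f' where pb: "is_pullback E d f d' f'" "deflation E d'"
      using deflation_pullback[OF d(1), of f] H by (auto simp: Hom_def)
    have V: "Dom E d' \<in> A_sub E T" using A_sub_pullback[OF pb(1) H] .
    have ar: "{d, f, d', f'} \<subseteq> Arr ?F"
      using pb(1) V d(2) h(2) H unfolding is_pullback_def by (auto simp: E_sub_simps)
    then show "\<exists>d' f'. is_pullback ?F d f d' f' \<and> deflation ?F d'"
      using is_pullback_E_sub[OF pb(1) ar] pb(2) unfolding deflation_E_sub by blast
  qed
qed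

section \<open>Tilting\<close>

text \<open>A morphism into an object of \<open>E_sub E T\<close> kills the kernel of \<open>d\<close>: covered by a projective,
  this kernel maps to \<open>P\<close> by an element of the ideal.\<close>

lemma approximation_factor:
  assumes ep: "enough_projectives E" and P: "P \<in> projectives E"
    and d: "d \<in> Hom E P J" "deflation E d" and i: "i \<in> Hom E J U"
    and approx: "\<And>V g. V \<in> T \<Longrightarrow> g \<in> Hom E P V \<Longrightarrow> \<exists>h \<in> Hom E U V. g = h \<cdot> (i \<cdot> d)"
    and X: "X \<in> A_sub E T" "q \<in> Hom E P X"
  shows "\<exists>q' \<in> Hom E J X. q' \<cdot> d = q"
proof -
  obtain k K where k: "k \<in> Hom E K P" "is_kernel E k d" "is_cokernel E k d" using deflationE[OF d(2,1)] by metis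
  have ob: "K \<in> Obj E" "X \<in> Obj E" "P \<in> Obj E" using Hom_Obj k X by blast+
  obtain Q p where p: "Q \<in> projectives E" "p \<in> Hom E Q K" "deflation E p"
    using ep ob(1) unfolding enough_projectives_def by blast
  have Q: "Q \<in> Obj E" using Hom_Obj p by blast
  have kp: "k \<cdot> p \<in> Hom E Q P" using comp_in p k by blast
  \<comment> \<open>Arrows from \<open>P\<close> to \<open>T\<close> factor through
    \<open>d\<close>, hence vanish on its kernel; this puts \<open>k \<cdot> p\<close> in the
    ideal.\<close>
  have "h \<cdot> (k \<cdot> p) = Zero E Q V" if V: "V \<in> T" and h: "h \<in> Hom E P V" for V h
  proof -
    obtain h' where h': "h' \<in> Hom E U V" "h = h' \<cdot> (i \<cdot> d)" using approx[OF V h] by blast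
    have 1: "h' \<cdot> i \<in> Hom E J V" "h = (h' \<cdot> i) \<cdot> d" using h' comp_in[OF i h'(1)] comp_assoc[OF d(1) i h'(1)] by auto
    have "h \<cdot> (k \<cdot> p) = (h \<cdot> k) \<cdot> p" using comp_assoc[OF p(2) k(1) h] by simp
    also have "h \<cdot> k = Zero E K V"
      using comp_assoc[OF k(1) d(1) 1(1)] 1(2) kernel_zero[OF k(2,1) d(1)] comp_Zero[OF 1(1) ob(1)] by simp
    finally show ?thesis using Zero_comp[OF p(2)] Hom_Obj[OF h] by simp
  qed
  then have "k \<cdot> p \<in> annihilator_ideal E T"
    using kp P p(1) unfolding annihilator_ideal_def by (auto simp: Hom_def)
  then have "q \<cdot> (k \<cdot> p) = Zero E Q X" using A_sub_kills[OF X(1) _ kp X(2)] by blast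
  then have "(q \<cdot> k) \<cdot> p = Zero E K X \<cdot> p" using comp_assoc[OF p(2) k(1) X(2)] Zero_comp[OF p(2) ob(2)] by simp
  then have "q \<cdot> k = Zero E K X"
    using deflation_epi[OF p(3,2)] comp_in[OF k(1) X(2)] Zero_in[OF ob(1,2)] by blast
  then show ?thesis using cokernel_lift[OF k(3,1) d(1) X(2)] by blast
qed

section \<open>Additively closed classes of objects\<close>

lemma direct_sum_one:
  assumes Y: "Y \<in> Obj E"
  shows "is_direct_sum E 1 (\<lambda>_. Y) Y (\<lambda>_. Id E Y) (\<lambda>_. Id E Y)"
proof -
  interpret YY: comm_group "hom_group E Y Y" using hom_comm_group Y by blast
  have *: "{..<1::nat} = {0}" by auto
  have "finprod (hom_group E Y Y) (\<lambda>_. Id E Y \<cdot> Id E Y) {0::nat} = Id E Y"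
    using YY.finprod_insert[of "{}" "0::nat" "\<lambda>_. Id E Y \<cdot> Id E Y"] Id_in[OF Y] comp_Id[OF Id_in[OF Y]] Plus_Zero[OF Id_in[OF Y]]
    by (simp add: hom_group_simps)
  then show ?thesis unfolding is_direct_sum_def * using Y Id_in[OF Y] comp_Id[OF Id_in[OF Y]] by simp
qed

lemma additively_closedD:
  assumes "additively_closed E T" "is_direct_sum E n X B \<iota> \<pi>" "\<And>k. k < n \<Longrightarrow> X k \<in> T" "direct_summand E Y B"
  shows "Y \<in> T"
  using assms(1)[unfolded additively_closed_def, THEN conjunct2, rule_format, of n X B \<iota> \<pi> Y] assms(2-4) by simp

lemma additively_closed_summand:
  assumes "additively_closed E T" "Y \<in> T" "direct_summand E X Y"
  shows "X \<in> T"
proof -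
  have "Y \<in> Obj E" using assms unfolding additively_closed_def subcategory_def by blast
  from additively_closedD[OF assms(1) direct_sum_one[OF this] _ assms(3)] assms(2) show ?thesis by simp
qed

text \<open>The definition only speaks of summands of direct sums; \<open>B\<close> is a summand of
  itself, being a retract by its identity.\<close>

lemma additively_closed_direct_sum:
  assumes wic: "weakly_idempotent_complete E" and T: "additively_closed E T" "is_direct_sum E n X B \<iota> \<pi>" "\<And>k. k < n \<Longrightarrow> X k \<in> T"
  shows "B \<in> T"
proof -
  have "B \<in> Obj E" using T(2) unfolding is_direct_sum_def by blast
  from retract_direct_summand[OF wic Id_in[OF this] Id_in[OF this] comp_Id[OF Id_in[OF this]]]
  show ?thesis using additively_closedD[OF T] by blast
qed

text \<open>\<open>E_sub E T\<close> has fewer conflations than \<open>E\<close>, and by fullness a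
  retraction found in \<open>E\<close> belongs to it.\<close>

lemma all_split_E_sub:
  assumes "all_split U X" "X \<in> A_sub E T"
  shows "exact_category.all_split (E_sub E T) U X"
  unfolding exact_category.all_split_def[OF exact_category_E_sub]
proof (intro ballI, clarify)
  fix i d assume c: "(i, d) \<in> Confl (E_sub E T)" "X = Dom (E_sub E T) i" "U = Cod (E_sub E T) d"
  then have i: "(i, d) \<in> Confl E" "Cod E i \<in> A_sub E T" by (auto simp: E_sub_simps)
  then obtain r where "r \<in> Hom E (Cod E i) X" "r \<cdot> i = Id E X"
    using assms(1) c(2,3) unfolding all_split_def E_sub_simps by blast
  then show "\<exists>r \<in> Hom (E_sub E T) (Cod (E_sub E T) i) (Dom (E_sub E T) i).
      r \<cdot>\<^bsub>E_sub E T\<^esub> i = Id (E_sub E T) (Dom (E_sub E T) i)"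
    using i(2) assms(2) c(2) Hom_E_sub[of r E T "Cod E i" X] unfolding E_sub_simps by blast
qed

section \<open>Approximations, projectives of \<open>E_sub\<close> and the tilting
  conditions\<close>

lemma Fac_subset_A_sub:
  assumes "T \<subseteq> Obj E"
  shows "Fac E T \<subseteq> A_sub E T"
  using A_sub_deflation T_subset_A_sub[OF assms] unfolding Fac_def by blast

lemma admissible_approximation:
  assumes "left_approximation E T P f" "admissible E f"
  obtains d J i U where "d \<in> Hom E P J" "deflation E d" "i \<in> Hom E J U" "inflation E i" "U \<in> T" "f = i \<cdot> d"
    "\<And>V g. V \<in> T \<Longrightarrow> g \<in> Hom E P V \<Longrightarrow> \<exists>h \<in> Hom E U V. g = h \<cdot> (i \<cdot> d)"
proof -
  obtain i d where id: "deflation E d" "inflation E i" "Cod E d = Dom E i" "f = i \<cdot> d"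
    using assms(2) unfolding admissible_def by blast
  obtain U where U: "U \<in> T" "f \<in> Hom E P U" "\<forall>V \<in> T. \<forall>g \<in> Hom E P V. \<exists>h \<in> Hom E U V. g = h \<cdot> f"
    using assms(1) unfolding left_approximation_def by blast
  have "d \<in> Hom E P (Cod E d)" "i \<in> Hom E (Cod E d) U"
    using id deflation_Arr[OF id(1)] inflation_Arr[OF id(2)] U(2) by (auto simp: Hom_def Dom_comp Cod_comp)
  then show ?thesis using that id U by blast
qed

text \<open>Arrows from \<open>P\<close> to objects of \<open>A_sub E T\<close> descend along
  \<open>d\<close> by \<open>approximation_factor\<close>. Lifting problems for \<open>J\<close> are
  therefore solved on \<open>P\<close> and descended, and a deflation from \<open>P\<close> descends
  to an arrow from \<open>J\<close>.\<close>

lemma E_sub_cover: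
  assumes wic: "weakly_idempotent_complete E" and ep: "enough_projectives E" and T: "T \<subseteq> Obj E"
    and P: "P \<in> projectives E"
    and d: "d \<in> Hom E P J" "deflation E d" and i: "i \<in> Hom E J U" "inflation E i" "U \<in> T"
    and approx: "\<And>V g. V \<in> T \<Longrightarrow> g \<in> Hom E P V \<Longrightarrow> \<exists>h \<in> Hom E U V. g = h \<cdot> (i \<cdot> d)"
  shows "J \<in> projectives (E_sub E T)"
    and "X \<in> A_sub E T \<Longrightarrow> q \<in> Hom E P X \<Longrightarrow> deflation E q \<Longrightarrow> \<exists>q' \<in> Hom (E_sub E T) J X. deflation E q'"
proof -
  have J: "J \<in> A_sub E T" using A_sub_inflation[OF i(1,2)] T_subset_A_sub[OF T] i(3) by blast
  show "J \<in> projectives (E_sub E T)" unfolding projectives_def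
  proof (intro CollectI conjI allI impI ballI)
    show "J \<in> Obj (E_sub E T)" using J by (simp add: E_sub_simps)
    fix e g assume e: "deflation (E_sub E T) e" and g: "g \<in> Hom (E_sub E T) J (Cod (E_sub E T) e)"
    have e': "deflation E e" "e \<in> Hom E (Dom E e) (Cod E e)" "Dom E e \<in> A_sub E T"
      using e deflation_E_sub[of T e] by (auto simp: E_sub_simps Hom_def)
    have g': "g \<in> Hom E J (Cod E e)" using g by (simp add: Hom_E_sub E_sub_simps)
    obtain h where h: "h \<in> Hom E P (Dom E e)" "e \<cdot> h = g \<cdot> d" using projective_lift[OF P e'(1,2) comp_in[OF d(1) g']] by blast
    obtain h' where h': "h' \<in> Hom E J (Dom E e)" "h' \<cdot> d = h"
      using approximation_factor[OF ep P d i(1) approx e'(3) h(1)] by blast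
    have "(e \<cdot> h') \<cdot> d = g \<cdot> d" using comp_assoc[OF d(1) h'(1) e'(2)] h'(2) h(2) by simp
    then have "e \<cdot> h' = g" using deflation_epi[OF d(2,1) comp_in[OF h'(1) e'(2)] g'] by blast
    then show "\<exists>h \<in> Hom (E_sub E T) J (Dom (E_sub E T) e). e \<cdot>\<^bsub>E_sub E T\<^esub> h = g"
      using h'(1) J e'(3) by (auto simp: Hom_E_sub E_sub_simps)
  qed
  assume X: "X \<in> A_sub E T" and q: "q \<in> Hom E P X" "deflation E q"
  obtain q' where q': "q' \<in> Hom E J X" "q' \<cdot> d = q" using approximation_factor[OF ep P d i(1) approx X q(1)] by blast
  \<comment> \<open>Only the composite of \<open>q'\<close> with the deflation \<open>d\<close> is
    known to be a deflation.\<close>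
  have "deflation E q'" using deflation_cancel[OF wic d(1) q'(1) d(2)] q(2) q'(2) by simp
  then show "\<exists>q' \<in> Hom (E_sub E T) J X. deflation E q'" using q'(1) X J by (auto simp: Hom_E_sub)
qed

lemma tau_rigid_partial_tilting:
  assumes wic: "weakly_idempotent_complete E" and ep: "enough_projectives E" and T: "tau_rigid E T"
    and approx: "\<And>P. P \<in> projectives E \<Longrightarrow> \<exists>f. left_approximation E T P f \<and> admissible E f"
  shows "partial_tilting (E_sub E T) T"
proof -
  let ?F = "E_sub E T"
  interpret F: exact_category ?F by (rule exact_category_E_sub)
  have ac: "additively_closed E T" and rigid: "\<And>U X. U \<in> T \<Longrightarrow> X \<in> Fac E T \<Longrightarrow> Ext_zero E 1 U X"
    using T unfolding tau_rigid_def by blast+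
  then have TO: "T \<subseteq> Obj E" unfolding additively_closed_def subcategory_def by blast
  have TA: "T \<subseteq> A_sub E T" using T_subset_A_sub[OF TO] .
  have FA: "Fac E T \<subseteq> A_sub E T" using Fac_subset_A_sub[OF TO] .
  \<comment> \<open>Both sides of \<open>J\<close> are recorded: its projectivity and deflation onto
    \<open>X\<close> give enough projectives, and its inflation into \<open>U\<close> gives the
    embedding into \<open>Fac E T\<close> below.\<close>
  have cover: "\<exists>J d i U. J \<in> projectives ?F \<and> d \<in> Hom E J X \<and> deflation E d \<and> J \<in> A_sub E T \<and>
      i \<in> Hom E J U \<and> inflation E i \<and> U \<in> T" if X: "X \<in> A_sub E T" for X
  proof -
    obtain P q where P: "P \<in> projectives E" "q \<in> Hom E P X" "deflation E q"
      using ep A_sub_Obj[OF X] unfolding enough_projectives_def by blast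
    obtain f where f: "left_approximation E T P f" "admissible E f" using approx[OF P(1)] by blast
    obtain d J i U where h: "d \<in> Hom E P J" "deflation E d" "i \<in> Hom E J U" "inflation E i" "U \<in> T"
      "\<And>V g. V \<in> T \<Longrightarrow> g \<in> Hom E P V \<Longrightarrow> \<exists>h \<in> Hom E U V. g = h \<cdot> (i \<cdot> d)"
      using admissible_approximation[OF f] by metis
    note E_sub_cover[OF wic ep TO P(1) h]
    moreover obtain q' where "q' \<in> Hom ?F J X" "deflation E q'"
      using E_sub_cover(2)[OF wic ep TO P(1) h X P(2,3)] by blast
    ultimately show ?thesis using h(3-5) by (auto simp: Hom_E_sub)
  qed
  have enough: "enough_projectives ?F" unfolding enough_projectives_def
  proof
    fix X assume "X \<in> Obj ?F"
    then have X: "X \<in> A_sub E T" by (simp add: E_sub_simps)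
    obtain J d where J: "J \<in> projectives ?F" "d \<in> Hom E J X" "deflation E d" "J \<in> A_sub E T" using cover[OF X] by blast
    then have "d \<in> Hom ?F J X" "deflation ?F d" using X by (auto simp: Hom_E_sub deflation_E_sub E_sub_simps Hom_def)
    then show "\<exists>P \<in> projectives ?F. \<exists>d \<in> Hom ?F P X. deflation ?F d" using J(1) by blast
  qed
  have sub: "additive_subcategory ?F T" unfolding additive_subcategory_def
  proof (intro conjI allI impI)
    show "subcategory ?F T" unfolding subcategory_def
    proof (intro conjI allI impI)
      show "T \<subseteq> Obj ?F" using TA by (simp add: E_sub_simps)
      fix f assume "is_iso ?F f \<and> Dom ?F f \<in> T"
      then show "Cod ?F f \<in> T" using ac is_iso_E_sub[of E T f] unfolding additively_closed_def subcategory_def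
        by (simp add: E_sub_simps)
    qed
    fix n X B \<iota> \<pi> assume "(\<forall>k<n. X k \<in> T) \<and> is_direct_sum ?F n X B \<iota> \<pi>"
    then show "B \<in> T" using additively_closed_direct_sum[OF wic ac] unfolding is_direct_sum_E_sub by blast
  qed
  have summands: "closed_under_summands ?F T" unfolding closed_under_summands_def
  proof (intro allI impI)
    fix X Y assume "Y \<in> T \<and> direct_summand ?F X Y"
    then show "X \<in> T" using additively_closed_summand[OF ac, of Y X]
      unfolding direct_summand_def is_direct_sum_E_sub by blast
  qed
  have split: "F.all_split U V" if "U \<in> T" "V \<in> Fac E T" for U V
  proof -
    have o': "U \<in> A_sub E T" "V \<in> A_sub E T" using that TA FA by blast+
    then have "all_split U V" using rigid[OF that] Ext_zero_one_iff A_sub_Obj[of _ E T] by simp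
    then show ?thesis using all_split_E_sub o'(2) by blast
  qed
  have embed: "\<exists>V \<in> Fac E T. \<exists>v \<in> Hom ?F B V. inflation ?F v" if "B \<in> Obj ?F" for B
  proof -
    have B: "B \<in> A_sub E T" using that by (simp add: E_sub_simps)
    obtain J q i U where h: "q \<in> Hom E J B" "deflation E q" "i \<in> Hom E J U" "inflation E i" "U \<in> T"
      using cover[OF B] by blast
    obtain k K where k: "k \<in> Hom E K J" "(k, q) \<in> Confl E" using deflationE[OF h(2,1)] by metis
    obtain v e where po: "is_pushout E i q v e" "inflation E v"
      using inflation_pushout[OF h(4), of q] h by (auto simp: Hom_def)
    obtain V where V: "v \<in> Hom E B V" "e \<in> Hom E U V" by (rule pushoutE[OF po(1) h(3,1)]) blast
    \<comment> \<open>The leg opposite to the deflation \<open>q\<close> is a deflation from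
      \<open>U\<close>, so \<open>V\<close> is in \<open>Fac E T\<close>, while \<open>v\<close> is
      an inflation as a pushout of \<open>i\<close>.\<close>
    have "deflation E e" using pushout_deflation[OF k(2,1) h(1,3,4) po(1)] unfolding deflation_def by blast
    then have VF: "V \<in> Fac E T" using V(2) h(5) unfolding Fac_def by blast
    then have "v \<in> Hom ?F B V" using V(1) B FA by (auto simp: Hom_E_sub)
    moreover from this have "inflation ?F v" unfolding inflation_E_sub using po(2) by (simp add: Hom_def)
    ultimately show ?thesis using VF by blast
  qed
  have quot: "V' \<in> Fac E T" if V: "V \<in> Fac E T" "d \<in> Hom ?F V V'" "deflation ?F d" for V V' d
  proof -
    obtain U e where U: "U \<in> T" "e \<in> Hom E U V" "deflation E e" using V(1) unfolding Fac_def by blast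
    have d: "d \<in> Hom E V V'" "deflation E d" using V(2,3) deflation_E_sub by (auto simp: Hom_E_sub)
    have "deflation E (d \<cdot> e)" using deflation_comp[OF U(3) d(2)] U(2) d(1) by (simp add: Hom_def)
    then show ?thesis using U(1) comp_in[OF U(2) d(1)] unfolding Fac_def by blast
  qed
  \<comment> \<open>The class \<open>S\<close> of the vanishing theorem is \<open>Fac E T\<close>,
    taken inside \<open>E_sub E T\<close>.\<close>
  have ext2: "Ext_zero ?F n U Y" if "n \<ge> 2" "U \<in> T" "Y \<in> Obj ?F" for n U Y
    by (rule F.Ext_zero_ge_two[OF that(1) _ that(3) embed quot split[OF that(2)]])
      (use that(2) TA in \<open>auto simp: E_sub_simps\<close>)
  have TFac: "T \<subseteq> Fac E T" using TO Id_in Id_deflation unfolding Fac_def by blast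
  have ext1: "Ext_zero ?F 1 U V" if "U \<in> T" "V \<in> T" for U V
  proof -
    have "U \<in> Obj ?F" "V \<in> Obj ?F" "V \<in> Fac E T" using that TA TFac by (auto simp: E_sub_simps)
    then show ?thesis using F.Ext_zero_one_iff split[OF that(1)] by simp
  qed
  have "Ext_zero ?F n U V" if n: "n \<ge> 1" and UV: "U \<in> T" "V \<in> T" for n U V
  proof (cases "n = 1")
    case True then show ?thesis using ext1 UV by simp
  next
    case False
    then have "n \<ge> 2" using n by simp
    then show ?thesis using ext2 UV TA by (auto simp: E_sub_simps)
  qed
  then show ?thesis unfolding partial_tilting_def
    using F.exact_category_axioms enough sub summands ext2 by blast
qed

text \<open>With \<open>e = a \<cdot> q\<close> the idempotent of \<open>J\<close> that splits off \<open>P'\<close>, the endomorphism \<open>t\<close> of \<open>T0\<close>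
  extends \<open>i \<cdot> e\<close>; then \<open>Id - t\<close> kills \<open>i \<cdot> a\<close> and, for the cokernel \<open>p\<close> of \<open>i \<cdot> a\<close>,
  \<open>p \<cdot> t\<close> kills \<open>i\<close>, which presents the
  target of \<open>p\<close> as a retract of \<open>T0 \<oplus> T1\<close>.\<close>

lemma retract_tilting_sequence:
  assumes wic: "weakly_idempotent_complete E" and T: "additively_closed E T"
    and c: "(i, g) \<in> Confl E" "i \<in> Hom E J T0" "g \<in> Hom E T0 T1" "T0 \<in> T" "T1 \<in> T"
    and a: "a \<in> Hom E P' J" "q \<in> Hom E J P'" "q \<cdot> a = Id E P'"
    and t: "t \<in> Hom E T0 T0" "t \<cdot> i = i \<cdot> (a \<cdot> q)"
  shows "\<exists>j c. (j, c) \<in> Confl E \<and> j \<in> Hom E P' T0 \<and> Cod E c \<in> T"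
proof -
  \<comment> \<open>The section \<open>a\<close> has a complement, which makes it an inflation;
    hence so is \<open>i \<cdot> a\<close>.\<close>
  obtain K s' r' where "biproduct P' K J a s' q r'" using retract_biproduct[OF wic a] by blast
  then have a_inf: "inflation E a" using biproduct_confl unfolding inflation_def by blast
  have i_inf: "inflation E i" using c(1) unfolding inflation_def by blast
  define j where "j = i \<cdot> a"
  have j: "j \<in> Hom E P' T0" unfolding j_def using comp_in a c by blast
  have j_inf: "inflation E j" unfolding j_def using inflation_comp[OF a_inf i_inf] a(1) c(2) by (simp add: Hom_def)
  obtain p D where p: "p \<in> Hom E T0 D" "(j, p) \<in> Confl E" "is_cokernel E j p" "deflation E p" using inflationE[OF j_inf j] by metis
  have ob: "T0 \<in> Obj E" "T1 \<in> Obj E" "D \<in> Obj E" "P' \<in> Obj E" "J \<in> Obj E" using Hom_Obj c p a by blast+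
  have pj: "p \<cdot> j = Zero E P' D" using cokernel_zero[OF p(3) j p(1)] .
  have aqa: "(a \<cdot> q) \<cdot> a = a" using comp_assoc[OF a(1,2,1)] a(3) comp_Id[OF a(1)] by simp
  have tj: "t \<cdot> j = j"
    unfolding j_def using comp_assoc[OF a(1) c(2) t(1)] t(2) comp_assoc[OF a(1) comp_in[OF a(2,1)] c(2)] aqa by simp
  obtain h where h: "h \<in> Hom E T0 T0" "Id E T0 = Plus E t h" using diff_exists[OF Id_in[OF ob(1)] t(1)] by blast
  have "Plus E (t \<cdot> j) (h \<cdot> j) = t \<cdot> j" using Plus_comp[OF j t(1) h(1)] h(2) Id_comp[OF j] tj by simp
  then have "h \<cdot> j = Zero E P' T0" using Plus_cancel_Zero comp_in[OF j t(1)] comp_in[OF j h(1)] by blast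
  then obtain s where s: "s \<in> Hom E D T0" "s \<cdot> p = h" using cokernel_lift[OF p(3) j p(1) h(1)] by blast
  have pt: "p \<cdot> t \<in> Hom E T0 D" using comp_in t p by blast
  have "(p \<cdot> t) \<cdot> i = p \<cdot> (i \<cdot> (a \<cdot> q))" using comp_assoc[OF c(2) t(1) p(1)] t(2) by simp
  also have "i \<cdot> (a \<cdot> q) = j \<cdot> q" unfolding j_def using comp_assoc[OF a(2,1) c(2)] by simp
  also have "p \<cdot> (j \<cdot> q) = Zero E J D" using comp_assoc[OF a(2) j p(1)] pj Zero_comp[OF a(2) ob(3)] by simp
  finally obtain r where r: "r \<in> Hom E T1 D" "r \<cdot> g = p \<cdot> t"
    using cokernel_lift[OF confl_cokernel[OF c(1)] c(2,3) pt] by blast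
  have "g \<cdot> j = Zero E P' T1"
    unfolding j_def using comp_assoc[OF a(1) c(2,3)] kernel_zero[OF confl_kernel[OF c(1)] c(2,3)] Zero_comp[OF a(1) ob(2)] by simp
  then obtain v where v: "v \<in> Hom E D T1" "v \<cdot> p = g" using cokernel_lift[OF p(3) j p(1) c(3)] by blast
  obtain B i1 i2 p1 p2 where bp: "biproduct T0 T1 B i1 i2 p1 p2" using biproduct_exists ob by blast
  note B = biproductD[OF bp]
  \<comment> \<open>\<open>\<sigma>\<close> has components \<open>s\<close> and \<open>v\<close>,
    and \<open>\<rho>\<close> will have components \<open>p\<close> and \<open>r\<close>. Tested on
    the epimorphism \<open>p\<close>, their composite gives
    \<open>p \<cdot> (Id - t) + p \<cdot> t = p\<close>.\<close>
  obtain \<sigma> where \<sigma>: "\<sigma> \<in> Hom E D B" "p1 \<cdot> \<sigma> = s" "p2 \<cdot> \<sigma> = v" using biproduct_pair[OF bp s(1) v(1)] by blast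
  define \<rho> where "\<rho> = Plus E (p \<cdot> p1) (r \<cdot> p2)"
  have pr: "p \<cdot> p1 \<in> Hom E B D" "r \<cdot> p2 \<in> Hom E B D" using comp_in B(3,4) p(1) r(1) by blast+
  have \<rho>: "\<rho> \<in> Hom E B D" unfolding \<rho>_def using Plus_in pr by blast
  have ps: "p \<cdot> s \<in> Hom E D D" "r \<cdot> v \<in> Hom E D D" using comp_in p s r v by blast+
  have "\<rho> \<cdot> \<sigma> = Plus E (p \<cdot> s) (r \<cdot> v)"
    unfolding \<rho>_def using Plus_comp[OF \<sigma>(1) pr] comp_assoc[OF \<sigma>(1) B(3) p(1)] comp_assoc[OF \<sigma>(1) B(4) r(1)] \<sigma>(2,3) by simp
  then have "(\<rho> \<cdot> \<sigma>) \<cdot> p = Plus E (p \<cdot> h) (p \<cdot> t)"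
    using Plus_comp[OF p(1) ps] comp_assoc[OF p(1) s(1) p(1)] comp_assoc[OF p(1) v(1) r(1)] s(2) v(2) r(2) by simp
  also have "\<dots> = p \<cdot> Plus E t h" using comp_Plus[OF t(1) h(1) p(1)] Plus_commute[OF comp_in[OF h(1) p(1)] pt] by simp
  also have "\<dots> = Id E D \<cdot> p" using h(2) comp_Id[OF p(1)] Id_comp[OF p(1)] by simp
  finally have "\<rho> \<cdot> \<sigma> = Id E D" using deflation_epi[OF p(4,1) comp_in[OF \<sigma>(1) \<rho>] Id_in[OF ob(3)]] by blast
  then have "direct_summand E D B" using retract_direct_summand[OF wic \<sigma>(1) \<rho>] by blast
  moreover have "B \<in> T"
    using additively_closed_direct_sum[OF wic T biproduct_direct_sum[OF bp]] c(4,5) by simp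
  ultimately have "D \<in> T" using additively_closed_summand[OF T] by blast
  then show ?thesis using p(1,2) j by (auto simp: Hom_def)
qed

text \<open>A projective \<open>P'\<close> of \<open>E_sub E T\<close> need not be projective in
  \<open>E\<close>, so the given exact sequence is taken for a projective \<open>P\<close> of
  \<open>E\<close> covering \<open>P'\<close>, and has to be cut down to \<open>P'\<close>.\<close>

lemma support_tau_tilting_tilting:
  assumes wic: "weakly_idempotent_complete E" and ep: "enough_projectives E" and T: "support_tau_tilting E T"
  shows "tilting (E_sub E T) T"
proof -
  let ?F = "E_sub E T"
  have rigid: "tau_rigid E T" and seq: "\<And>P. P \<in> projectives E \<Longrightarrow> \<exists>T0 \<in> T. \<exists>T1 \<in> T. \<exists>f \<in> Hom E P T0. \<exists>g \<in> Hom E T0 T1.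
        exact_seq E [f, g] \<and> deflation E g \<and> left_approximation E T P f"
    using T unfolding support_tau_tilting_def by blast+
  have ac: "additively_closed E T" using rigid unfolding tau_rigid_def by blast
  then have TO: "T \<subseteq> Obj E" unfolding additively_closed_def subcategory_def by blast
  have TA: "T \<subseteq> A_sub E T" using T_subset_A_sub[OF TO] .
  have partial: "partial_tilting ?F T"
  proof (rule tau_rigid_partial_tilting[OF wic ep rigid])
    fix P assume "P \<in> projectives E"
    then obtain f g where "exact_seq E [f, g]" "left_approximation E T P f" using seq by blast
    then show "\<exists>f. left_approximation E T P f \<and> admissible E f" unfolding exact_seq_def by auto
  qed
  have "\<exists>(i, d) \<in> Confl ?F. Dom ?F i = P' \<and> Cod ?F i \<in> T \<and> Cod ?F d \<in> T" if P': "P' \<in> projectives ?F" for P'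
  proof -
    have P'A: "P' \<in> A_sub E T" using P' unfolding projectives_def by (simp add: E_sub_simps)
    obtain P q0 where P: "P \<in> projectives E" "q0 \<in> Hom E P P'" "deflation E q0"
      using ep A_sub_Obj[OF P'A] unfolding enough_projectives_def by blast
    obtain T0 T1 f g where h: "T0 \<in> T" "T1 \<in> T" "f \<in> Hom E P T0" "g \<in> Hom E T0 T1" "exact_seq E [f, g]" "deflation E g"
      "left_approximation E T P f" using seq[OF P(1)] by blast
    have "exact_at E f g" using h(5) unfolding exact_seq_def by simp
    then obtain i d where id: "deflation E d" "inflation E i" "Cod E d = Dom E i" "f = i \<cdot> d" "is_kernel E i g"
      unfolding exact_at_def by blast
    obtain J where J: "d \<in> Hom E P J" "i \<in> Hom E J T0"
      using id deflation_Arr[OF id(1)] inflation_Arr[OF id(2)] h(3) by (auto simp: Hom_def Dom_comp Cod_comp)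
    obtain U where U: "f \<in> Hom E P U" "\<forall>V \<in> T. \<forall>g \<in> Hom E P V. \<exists>h \<in> Hom E U V. g = h \<cdot> f"
      using h(7) unfolding left_approximation_def by blast
    have "U = T0" using U(1) h(3) by (simp add: Hom_def)
    then have approx: "\<exists>h \<in> Hom E T0 V. g = h \<cdot> (i \<cdot> d)" if "V \<in> T" "g \<in> Hom E P V" for V g
      using U(2) that id(4) by blast
    obtain q where q: "q \<in> Hom ?F J P'" "deflation E q"
      using E_sub_cover(2)[OF wic ep TO P(1) J(1) id(1) J(2) id(2) h(1) approx P'A P(2,3)] by blast
    have qF: "deflation ?F q" using q unfolding deflation_E_sub by (simp add: Hom_def)
    interpret F: exact_category ?F by (rule exact_category_E_sub)
    \<comment> \<open>The deflation from \<open>J\<close> splits because \<open>P'\<close> is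
      projective in \<open>E_sub E T\<close>.\<close>
    obtain a where a: "a \<in> Hom ?F P' J" "q \<cdot>\<^bsub>?F\<^esub> a = Id ?F P'"
      using F.projective_lift[OF P' qF q(1) F.Id_in] P'A by (auto simp: E_sub_simps)
    have a': "a \<in> Hom E P' J" "q \<in> Hom E J P'" "q \<cdot> a = Id E P'" using a q by (simp_all add: Hom_E_sub E_sub_simps)
    have iaq: "i \<cdot> (a \<cdot> q) \<in> Hom E J T0" using comp_in a' J by blast
    \<comment> \<open>The arrow \<open>i \<cdot> (a \<cdot> q) \<cdot> d\<close> from
      \<open>P\<close> to \<open>T0\<close> extends along the approximation; cancelling the
      epimorphism \<open>d\<close> turns this into a statement about \<open>i\<close>.\<close>
    obtain t where t: "t \<in> Hom E T0 T0" "(i \<cdot> (a \<cdot> q)) \<cdot> d = t \<cdot> (i \<cdot> d)"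
      using approx[OF h(1) comp_in[OF J(1) iaq]] by blast
    have "(t \<cdot> i) \<cdot> d = (i \<cdot> (a \<cdot> q)) \<cdot> d" using t comp_assoc[OF J t(1)] by simp
    then have "t \<cdot> i = i \<cdot> (a \<cdot> q)" using deflation_epi[OF id(1) J(1) comp_in[OF J(2) t(1)] iaq] by blast
    then obtain j c where jc: "(j, c) \<in> Confl E" "j \<in> Hom E P' T0" "Cod E c \<in> T"
      using retract_tilting_sequence[OF wic ac confl_of_deflation_kernel[OF h(6) id(5)] J(2) h(4,1,2) a' t(1)] by blast
    have "(j, c) \<in> Confl ?F" using jc P'A h(1) TA by (auto simp: E_sub_simps Hom_def)
    then show ?thesis using jc h(1) by (force simp: E_sub_simps Hom_def)
  qed
  then show ?thesis unfolding tilting_def using partial by blast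
qed

end

theorem theorem4p4:
  fixes E :: "('o, 'm) excat" and T :: "'o set"
  assumes "exact_category E" "weakly_idempotent_complete E" "enough_projectives E"
  shows "(tau_rigid E T \<and>
            (\<forall>P \<in> projectives E. \<exists>f. left_approximation E T P f \<and> admissible E f)
          \<longrightarrow> partial_tilting (E_sub E T) T)
       \<and> (support_tau_tilting E T \<longrightarrow> tilting (E_sub E T) T)"
  using exact_category.tau_rigid_partial_tilting[OF assms] exact_category.support_tau_tilting_tilting[OF assms]
  by blast

end
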